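(* Let $d\geq2$. A real fibered rational function $f\in\mathbb{R}(z)_d$ belongs to $\mathscr{R}_d$ (i.e. has only real periodic points) if and only if $f^2=f\circ f$ has only real fixed points. In particular, the real fibered functions in $\mathscr{R}_d$ form a closed semialgebraic set in $\mathscr{R}_d\subset\mathbb{R}(z)_d$, and the boundary of this set consists of the real fibered $f\in\mathbb{R}(z)_d$ that have an indifferent fixed point.
   Context: $\overline{\mathbb{C}}=\mathbb{C}\cup\{\infty\}$ is the Riemann sphere and $\overline{\mathbb{R}}=\mathbb{R}\cup\{\infty\}\subset\overline{\mathbb{C}}$. "Real" for points means lying in $\overline{\mathbb{R}}$. $\mathbb{R}(z)_d$ is the set of real rational functions of degree $d$: ratios $f=p/q$ of coprime polynomials $p=p_dz^d+\dots+p_0$, $q=q_dz^d+\dots+q_0\in\mathbb{R}[z]$ with $p_d,q_d$ not both zero. Via the coefficient vector $(p_d,\dots,p_0,q_d,\dots,q_0)$, up to a nonzero real scalar, it is identified with the complement of a hypersurface in real projective space $\mathbb{P}^{2d+1}(\mathbb{R})$, from which it gets its topology and its notion of semialgebraic subset. Boundaries are taken in $\mathbb{R}(z)_d$. Each $f\in\mathbb{R}(z)_d$ is regarded as a map $\overline{\mathbb{C}}\to\overline{\mathbb{C}}$. $f\in\mathbb{R}(z)_d$ is real fibered if for all $z\in\overline{\mathbb{C}}$: $z\in\overline{\mathbb{R}}\Leftrightarrow f(z)\in\overline{\mathbb{R}}$. Iterates are $f^1=f$, $f^{k+1}=f^k\circ f$. $\mathscr{R}_d$ is the set of $f\in\mathbb{R}(z)_d$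 having only real periodic points, i.e. such that for all $k\geq1$ every solution $z\in\overline{\mathbb{C}}$ of $f^k(z)=z$ lies in $\overline{\mathbb{R}}$. The multiplier of a fixed point $z$ of $f$ is $f'(z)$ if $z\in\mathbb{C}$ and $\left(\lim_{w\to\infty}f'(w)\right)^{-1}$ if $z=\infty$ (with $\infty^{-1}=0$); the fixed point is indifferent if its multiplier has absolute value $1$. *)

theory Defs
  imports
    "HOL-Analysis.Analysis"
    "HOL-Computational_Algebra.Computational_Algebra"
    "HOL-Computational_Algebra.Field_as_Ring"
begin

section \<open>Real rational functions and the Riemann sphere\<close>

text \<open>The Riemann sphere is \<^typ>\<open>complex option\<close>, with \<^const>\<open>None\<close> as the point at infinity.\<close>

type_synonym sphere = "complex option"

definition real_sphere :: "sphere set" where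
  "real_sphere = insert None (Some ` \<real>)"

text \<open>A rational function is an element of the field of fractions of the polynomial ring. The
  pair \<^term>\<open>quot_of_fract f\<close> is coprime and has monic second component.\<close>

definition numer :: "real poly fract \<Rightarrow> real poly" where
  "numer f = fst (quot_of_fract f)"

definition denom :: "real poly fract \<Rightarrow> real poly" where
  "denom f = snd (quot_of_fract f)"

definition rat_degree :: "real poly fract \<Rightarrow> nat" where
  "rat_degree f = max (degree (numer f)) (degree (denom f))"

definition rat_deg :: "nat \<Rightarrow> real poly fract set" where
  "rat_deg d = {f. rat_degree f = d}"

definition cpoly :: "real poly \<Rightarrow> complex poly" where
  "cpoly p = map_poly of_real p"

text \<open>The affine part of a rational function; its value at a pole is the junk value 0.\<close>

definition rat_fun :: "real poly fract \<Rightarrow> complex \<Rightarrow> complex" where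
  "rat_fun f w = poly (cpoly (numer f)) w / poly (cpoly (denom f)) w"

text \<open>At infinity, a rational function of degree n takes the value p_n / q_n in homogeneous
  terms, where p_n and q_n are the coefficients of z^n and do not both vanish.\<close>

definition rat_map :: "real poly fract \<Rightarrow> sphere \<Rightarrow> sphere" where
  "rat_map f z =
    (case z of
       Some w \<Rightarrow> if poly (cpoly (denom f)) w = 0 then None else Some (rat_fun f w)
     | None \<Rightarrow>
         if coeff (denom f) (rat_degree f) = 0 then None
         else Some (of_real (coeff (numer f) (rat_degree f) / coeff (denom f) (rat_degree f))))"

definition real_fibered :: "real poly fract \<Rightarrow> bool" where
  "real_fibered f \<longleftrightarrow> (\<forall>z. z \<in> real_sphere \<longleftrightarrow> rat_map f z \<in> real_sphere)"

definition only_real_fixed_points :: "(sphere \<Rightarrow> sphere) \<Rightarrow> bool" where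
  "only_real_fixed_points g \<longleftrightarrow> (\<forall>z. g z = z \<longrightarrow> z \<in> real_sphere)"

definition real_periodic :: "nat \<Rightarrow> real poly fract set" where
  "real_periodic d = {f \<in> rat_deg d. \<forall>k\<ge>1. only_real_fixed_points (rat_map f ^^ k)}"

text \<open>Only meaningful at fixed points. If infinity is fixed, then the derivative tends either to
  a nonzero complex number or to infinity as the argument tends to infinity.\<close>

definition multiplier :: "real poly fract \<Rightarrow> sphere \<Rightarrow> complex" where
  "multiplier f z =
    (case z of
       Some w \<Rightarrow> deriv (rat_fun f) w
     | None \<Rightarrow>
         if filterlim (deriv (rat_fun f)) at_infinity at_infinity then 0
         else inverse (Lim at_infinity (deriv (rat_fun f))))"

definition has_indifferent_fixed_point :: "real poly fract \<Rightarrow> bool" where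
  "has_indifferent_fixed_point f \<longleftrightarrow> (\<exists>z. rat_map f z = z \<and> norm (multiplier f z) = 1)"


section \<open>Semialgebraic sets and real projective space\<close>

inductive_set polynomial_functions :: "nat \<Rightarrow> ((nat \<Rightarrow> real) \<Rightarrow> real) set" for n :: nat where
  const: "(\<lambda>_. c) \<in> polynomial_functions n"
| coord: "i < n \<Longrightarrow> (\<lambda>x. x i) \<in> polynomial_functions n"
| add: "P \<in> polynomial_functions n \<Longrightarrow> Q \<in> polynomial_functions n
    \<Longrightarrow> (\<lambda>x. P x + Q x) \<in> polynomial_functions n"
| mult: "P \<in> polynomial_functions n \<Longrightarrow> Q \<in> polynomial_functions n
    \<Longrightarrow> (\<lambda>x. P x * Q x) \<in> polynomial_functions n"

text \<open>The Boolean algebra of subsets of \<^term>\<open>topspace (Euclidean_space n)\<close> generated by the sets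
  where a polynomial is positive.\<close>

inductive semialgebraic :: "nat \<Rightarrow> (nat \<Rightarrow> real) set \<Rightarrow> bool" for n :: nat where
  pos: "P \<in> polynomial_functions n
    \<Longrightarrow> semialgebraic n {x \<in> topspace (Euclidean_space n). P x > 0}"
| compl: "semialgebraic n S \<Longrightarrow> semialgebraic n (topspace (Euclidean_space n) - S)"
| union: "semialgebraic n S \<Longrightarrow> semialgebraic n T \<Longrightarrow> semialgebraic n (S \<union> T)"

definition punctured_space :: "nat \<Rightarrow> (nat \<Rightarrow> real) topology" where
  "punctured_space n = subtopology (Euclidean_space n) (- {\<lambda>_. 0})"

text \<open>Points of projective space are lines through the origin, with the origin removed.\<close>

definition proj_point :: "(nat \<Rightarrow> real) \<Rightarrow> (nat \<Rightarrow> real) set" where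
  "proj_point v = {(\<lambda>i. c * v i) | c. c \<noteq> 0}"

definition real_projective_space :: "nat \<Rightarrow> (nat \<Rightarrow> real) set topology" where
  "real_projective_space n =
    topology (\<lambda>U. U \<subseteq> proj_point ` topspace (punctured_space (Suc n)) \<and>
      openin (punctured_space (Suc n)) {v \<in> topspace (punctured_space (Suc n)). proj_point v \<in> U})"

text \<open>A subset of projective space is semialgebraic if the cone over it is.\<close>

definition semialgebraic_proj :: "nat \<Rightarrow> (nat \<Rightarrow> real) set set \<Rightarrow> bool" where
  "semialgebraic_proj n X \<longleftrightarrow>
     X \<subseteq> topspace (real_projective_space n) \<and>
     semialgebraic (Suc n) {v \<in> topspace (punctured_space (Suc n)). proj_point v \<in> X}"

lemma openin_real_projective_space:
  "openin (real_projective_space n) U \<longleftrightarrow>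
     U \<subseteq> proj_point ` topspace (punctured_space (Suc n)) \<and>
     openin (punctured_space (Suc n)) {v \<in> topspace (punctured_space (Suc n)). proj_point v \<in> U}"
proof -
  let ?X = "punctured_space (Suc n)"
  let ?pre = "\<lambda>U. {v \<in> topspace ?X. proj_point v \<in> U}"
  let ?op = "\<lambda>U. U \<subseteq> proj_point ` topspace ?X \<and> openin ?X (?pre U)"
  have "istopology ?op"
    unfolding istopology_def
  proof (intro conjI allI impI)
    fix S T assume S: "?op S" and T: "?op T"
    have "?pre (S \<inter> T) = ?pre S \<inter> ?pre T" by auto
    with S T show "openin ?X (?pre (S \<inter> T))" by auto
    show "S \<inter> T \<subseteq> proj_point ` topspace ?X" using S by auto
  next
    fix K assume K: "\<forall>U\<in>K. ?op U"
    have "?pre (\<Union>K) = (\<Union>U\<in>K. ?pre U)" by auto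
    with K show "openin ?X (?pre (\<Union>K))" by auto
    show "\<Union>K \<subseteq> proj_point ` topspace ?X" using K by auto
  qed
  then show ?thesis
    unfolding real_projective_space_def by (simp add: topology_inverse')
qed

lemma topspace_real_projective_space:
  "topspace (real_projective_space n) = proj_point ` topspace (punctured_space (Suc n))"
proof (rule antisym)
  show "topspace (real_projective_space n) \<subseteq> proj_point ` topspace (punctured_space (Suc n))"
    using openin_real_projective_space openin_topspace by blast
  have "{v \<in> topspace (punctured_space (Suc n)).
      proj_point v \<in> proj_point ` topspace (punctured_space (Suc n))}
      = topspace (punctured_space (Suc n))" by auto
  then have "openin (real_projective_space n) (proj_point ` topspace (punctured_space (Suc n)))"
    by (simp add: openin_real_projective_space)
  then show "proj_point ` topspace (punctured_space (Suc n)) \<subseteq> topspace (real_projective_space n)"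
    by (rule openin_subset)
qed

lemma quotient_map_proj_point:
  "quotient_map (punctured_space (Suc n)) (real_projective_space n) proj_point"
  unfolding quotient_map_def
  by (auto simp: topspace_real_projective_space openin_real_projective_space)


section \<open>The space of real rational functions of degree d\<close>

text \<open>The coefficient vector is (p_d, ..., p_0, q_d, ..., q_0), padded with zeros.\<close>

definition coeff_vec :: "nat \<Rightarrow> real poly fract \<Rightarrow> nat \<Rightarrow> real" where
  "coeff_vec d f i =
    (if i \<le> d then coeff (numer f) (d - i)
     else if i \<le> 2 * d + 1 then coeff (denom f) (2 * d + 1 - i)
     else 0)"

definition coeff_point :: "nat \<Rightarrow> real poly fract \<Rightarrow> (nat \<Rightarrow> real) set" where
  "coeff_point d f = proj_point (coeff_vec d f)"

definition rat_topology :: "nat \<Rightarrow> real poly fract topology" where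
  "rat_topology d = pullback_topology (rat_deg d) (coeff_point d) (real_projective_space (2 * d + 1))"

definition semialgebraic_rat :: "nat \<Rightarrow> real poly fract set \<Rightarrow> bool" where
  "semialgebraic_rat d S \<longleftrightarrow>
     S \<subseteq> rat_deg d \<and> semialgebraic_proj (2 * d + 1) (coeff_point d ` S)"

lemma denom_nonzero: "denom f \<noteq> 0"
  by (simp add: denom_def)

lemma coeff_vec_denom:
  assumes "j \<le> d" shows "coeff_vec d f (2 * d + 1 - j) = coeff (denom f) j"
proof -
  have "\<not> 2 * d + 1 - j \<le> d" and "2 * d + 1 - (2 * d + 1 - j) = j"
    using assms by linarith+
  then show ?thesis unfolding coeff_vec_def by simp
qed

lemma coeff_vec_numer:
  assumes "j \<le> d" shows "coeff_vec d f (d - j) = coeff (numer f) j"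
  using assms by (simp add: coeff_vec_def)

lemma coeff_vec_in_punctured_space:
  assumes "f \<in> rat_deg d"
  shows "coeff_vec d f \<in> topspace (punctured_space (Suc (2 * d + 1)))"
proof -
  have "degree (denom f) \<le> d"
    using assms by (auto simp: rat_deg_def rat_degree_def)
  then have "coeff_vec d f (2 * d + 1 - degree (denom f)) \<noteq> 0"
    using coeff_vec_denom[of "degree (denom f)" d f] denom_nonzero[of f] by simp
  then have "coeff_vec d f \<noteq> (\<lambda>_. 0)" by metis
  then show ?thesis
    by (auto simp: punctured_space_def topspace_Euclidean_space coeff_vec_def)
qed

lemma topspace_rat_topology: "topspace (rat_topology d) = rat_deg d"
  using coeff_vec_in_punctured_space
  by (auto simp: rat_topology_def topspace_pullback_topology topspace_real_projective_space
      coeff_point_def)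

lemma inj_on_coeff_point: "inj_on (coeff_point d) (rat_deg d)"
proof (rule inj_onI)
  fix f g assume f: "f \<in> rat_deg d" and g: "g \<in> rat_deg d"
    and eq: "coeff_point d f = coeff_point d g"
  have "coeff_vec d f \<in> proj_point (coeff_vec d f)"
    unfolding proj_point_def by (rule CollectI, rule exI[of _ 1]) simp
  then obtain c where c: "c \<noteq> 0" and v: "coeff_vec d f = (\<lambda>i. c * coeff_vec d g i)"
    using eq unfolding coeff_point_def proj_point_def by blast
  have deg: "degree (numer f) \<le> d" "degree (denom f) \<le> d"
      "degree (numer g) \<le> d" "degree (denom g) \<le> d"
    using f g by (auto simp: rat_deg_def rat_degree_def)
  have n: "numer f = smult c (numer g)"
  proof (rule poly_eqI)
    fix j show "coeff (numer f) j = coeff (smult c (numer g)) j"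
    proof (cases "j \<le> d")
      case True then show ?thesis
        using fun_cong[OF v, of "d - j"] by (simp only: coeff_vec_numer coeff_smult)
    qed (use deg in \<open>simp add: coeff_eq_0\<close>)
  qed
  have e: "denom f = smult c (denom g)"
  proof (rule poly_eqI)
    fix j show "coeff (denom f) j = coeff (smult c (denom g)) j"
    proof (cases "j \<le> d")
      case True then show ?thesis
        using fun_cong[OF v, of "2 * d + 1 - j"] by (simp only: coeff_vec_denom coeff_smult)
    qed (use deg in \<open>simp add: coeff_eq_0\<close>)
  qed
  have "f = Fraction_Field.Fract (numer f) (denom f)"
    by (simp add: numer_def denom_def)
  also have "\<dots> = Fraction_Field.Fract (numer g) (denom g)"
    using c denom_nonzero by (simp add: n e Fraction_Field.eq_fract)
  also have "\<dots> = g"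
    by (simp add: numer_def denom_def)
  finally show "f = g" .
qed

end

theory Submission
  imports Defs
begin

text \<open>Write a rational function as a pair of binary forms, \<open>F = (p, q)\<close>, and let \<open>K\<close> be the
  kernel of the Bezoutian, so that \<open>F X \<and> F Y = (X \<and> Y) K(X, Y)\<close>. A function of degree \<open>d\<close> is
  real fibered iff its Bezoutian is definite, and then the strict Cauchy-Schwarz inequality for \<open>K\<close>
  is the Schwarz-Pick inequality at two nonreal points and Julia's inequality at a nonreal point and
  a real fixed point. Schwarz-Pick shows that nonreal periodic points are fixed by the second
  iterate. A real fixed vector \<open>F E = \<kappa> E\<close> has multiplier \<open>K(E, E) / \<kappa>\<^sup>2\<close>, and by Julia's
  inequality no nonreal periodic points exist if this is at most 1 in absolute value.

  Conversely, if all real fixed points are repelling, then so are the real 2-cycles, by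
  Cauchy-Schwarz at the two points of the cycle; if moreover all fixed points of the second iterate
  were real, this would contradict the formula expressing the sum of \<open>1 / (1 - multiplier)\<close> over its
  fixed points. Hence interior points of the set have an attracting or indifferent real fixed point;
  an attracting one persists under perturbation, and an indifferent one can be split into a nonreal
  pair. Finally the set is given by definiteness of one matrix and semidefiniteness of another, the
  Bezoutian of the fixed point polynomial of the second iterate and its derivative.\<close>

section \<open>Quadratic forms and semialgebraic sets\<close>

text \<open>Binary forms put poles and infinity on the same footing as all other points. The factor
  \<open>K\<close> exists because the wedge of \<open>F X\<close> and \<open>F Y\<close> vanishes
  for proportional \<open>X\<close> and \<open>Y\<close>. Taken at \<open>X\<close> and its
  conjugate it compares imaginary parts, so for a real fibered function its sign there is constant;
  on the diagonal it is the numerator of the derivative. Once \<open>d \<ge> 2\<close>,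
  nonproportional points have independent vectors of monomials, and this makes Cauchy-Schwarz
  strict. The obstacle to closedness is that definiteness is an open condition. For coprime pairs
  semidefiniteness already implies it, since an isotropic monomial vector of a nonreal point would
  make the function constant. The condition on the second iterate is only semidefinite, because real
  fixed points may be multiple and infinity may be among them, in which case the degree drops. Both
  conditions quantify over all vectors; division-free Schur complements turn them into finitely many
  polynomial conditions.\<close>

definition bilin :: "nat \<Rightarrow> (nat \<Rightarrow> nat \<Rightarrow> real) \<Rightarrow> (nat \<Rightarrow> 'a::real_field) \<Rightarrow> (nat \<Rightarrow> 'a) \<Rightarrow> 'a" where
  "bilin n M a b = (\<Sum>i<n. \<Sum>j<n. of_real (M i j) * a i * b j)"

definition pos_def :: "nat \<Rightarrow> (nat \<Rightarrow> nat \<Rightarrow> real) \<Rightarrow> bool" where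
  "pos_def n M \<longleftrightarrow> (\<forall>a::nat \<Rightarrow> real. (\<exists>i<n. a i \<noteq> 0) \<longrightarrow> bilin n M a a > 0)"

definition pos_semidef :: "nat \<Rightarrow> (nat \<Rightarrow> nat \<Rightarrow> real) \<Rightarrow> bool" where
  "pos_semidef n M \<longleftrightarrow> (\<forall>a::nat \<Rightarrow> real. bilin n M a a \<ge> 0)"

definition sym_mat :: "(nat \<Rightarrow> nat \<Rightarrow> real) \<Rightarrow> bool" where
  "sym_mat M \<longleftrightarrow> (\<forall>i j. M i j = M j i)"

definition shift_mat :: "(nat \<Rightarrow> nat \<Rightarrow> real) \<Rightarrow> nat \<Rightarrow> nat \<Rightarrow> real" where
  "shift_mat M i j = M (Suc i) (Suc j)"

text \<open>The Schur complement of the corner entry, multiplied by that entry. Without the division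
  its entries stay polynomial in those of \<open>M\<close>, as the semialgebraic descriptions
  require.\<close>

definition schur :: "(nat \<Rightarrow> nat \<Rightarrow> real) \<Rightarrow> nat \<Rightarrow> nat \<Rightarrow> real" where
  "schur M i j = M 0 0 * M (Suc i) (Suc j) - M 0 (Suc i) * M 0 (Suc j)"

lemma sym_mat_schur: "sym_mat M \<Longrightarrow> sym_mat (schur M)"
  by (simp add: sym_mat_def schur_def mult.commute)

lemma sym_mat_shift: "sym_mat M \<Longrightarrow> sym_mat (shift_mat M)"
  by (simp add: sym_mat_def shift_mat_def)

lemma bilin_add_left: "bilin n M (\<lambda>i. a i + b i) c = bilin n M a c + bilin n M b c"
  by (simp add: bilin_def algebra_simps sum.distrib)

lemma bilin_add_right: "bilin n M c (\<lambda>i. a i + b i) = bilin n M c a + bilin n M c b"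
  by (simp add: bilin_def algebra_simps sum.distrib)

lemma bilin_mult_left: "bilin n M (\<lambda>i. k * a i) b = k * bilin n M a b"
  by (simp add: bilin_def sum_distrib_left mult_ac)

lemma bilin_mult_right: "bilin n M a (\<lambda>i. k * b i) = k * bilin n M a b"
  by (simp add: bilin_def sum_distrib_left mult_ac)

lemma bilin_uminus: "bilin n (\<lambda>i j. - M i j) a b = - bilin n M a b"
  by (simp add: bilin_def sum_negf)

lemma bilin_commute:
  assumes "sym_mat M"
  shows "bilin n M a b = bilin n M b a"
proof -
  have "bilin n M a b = (\<Sum>j<n. \<Sum>i<n. of_real (M i j) * a i * b j)"
    unfolding bilin_def by (rule sum.swap)
  also have "\<dots> = bilin n M b a"
    unfolding bilin_def using assms by (intro sum.cong refl) (simp add: sym_mat_def mult_ac)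
  finally show ?thesis .
qed

lemma bilin_of_real:
  "bilin n M (\<lambda>i. of_real (a i)) (\<lambda>i. of_real (b i)) = of_real (bilin n M a b)"
  by (simp add: bilin_def)

lemma bilin_cong:
  assumes "\<And>i. i < n \<Longrightarrow> a i = a' i" and "\<And>i. i < n \<Longrightarrow> b i = b' i"
  shows "bilin n M a b = bilin n M a' b'"
  unfolding bilin_def using assms by (intro sum.cong refl) simp

lemma cnj_bilin: "cnj (bilin n M a b) = bilin n M (\<lambda>i. cnj (a i)) (\<lambda>i. cnj (b i))"
  by (simp add: bilin_def)

lemma bilin_Suc:
  fixes a :: "nat \<Rightarrow> real"
  assumes "sym_mat M"
  shows "bilin (Suc n) M a a = M 0 0 * (a 0)\<^sup>2 + 2 * a 0 * (\<Sum>j<n. M 0 (Suc j) * a (Suc j))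
      + bilin n (shift_mat M) (\<lambda>i. a (Suc i)) (\<lambda>i. a (Suc i))"
proof -
  have "M (Suc i) 0 = M 0 (Suc i)" for i using assms by (simp add: sym_mat_def)
  then show ?thesis
    unfolding bilin_def shift_mat_def
    by (simp add: sum.lessThan_Suc_shift sum.distrib power2_eq_square sum_distrib_left
        algebra_simps del: sum.lessThan_Suc)
qed

lemma bilin_schur:
  fixes a :: "nat \<Rightarrow> real"
  assumes "sym_mat M"
  shows "M 0 0 * bilin (Suc n) M a a
    = (M 0 0 * a 0 + (\<Sum>j<n. M 0 (Suc j) * a (Suc j)))\<^sup>2
      + bilin n (schur M) (\<lambda>i. a (Suc i)) (\<lambda>i. a (Suc i))"
proof -
  let ?s = "\<Sum>j<n. M 0 (Suc j) * a (Suc j)"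
  have "?s\<^sup>2 = (\<Sum>i<n. \<Sum>j<n. (M 0 (Suc i) * a (Suc i)) * (M 0 (Suc j) * a (Suc j)))"
    by (simp add: power2_eq_square sum_product)
  then have "bilin n (schur M) (\<lambda>i. a (Suc i)) (\<lambda>i. a (Suc i))
      = M 0 0 * bilin n (shift_mat M) (\<lambda>i. a (Suc i)) (\<lambda>i. a (Suc i)) - ?s\<^sup>2"
    unfolding bilin_def schur_def shift_mat_def
    by (simp add: sum_distrib_left sum_subtractf algebra_simps)
  then show ?thesis
    unfolding bilin_Suc[OF assms] by (simp add: algebra_simps power2_eq_square)
qed

lemma pos_def_Suc:
  assumes M: "sym_mat M"
  shows "pos_def (Suc n) M \<longleftrightarrow> M 0 0 > 0 \<and> pos_def n (schur M)"
proof (intro iffI conjI)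
  assume pd: "pos_def (Suc n) M"
  let ?e = "\<lambda>i. if i = 0 then 1 else 0 :: real"
  have "bilin (Suc n) M ?e ?e > 0" using pd unfolding pos_def_def by auto
  then show M0: "M 0 0 > 0" unfolding bilin_Suc[OF M] by (simp add: bilin_def)
  show "pos_def n (schur M)" unfolding pos_def_def
  proof (intro allI impI)
    fix b :: "nat \<Rightarrow> real" assume b: "\<exists>i<n. b i \<noteq> 0"
    \<comment> \<open>The entry at 0 makes the completed square vanish, so that only the Schur
      complement is left.\<close>
    define a where "a i = (case i of 0 \<Rightarrow> - (\<Sum>j<n. M 0 (Suc j) * b j) / M 0 0 | Suc k \<Rightarrow> b k)" for i
    from b have "\<exists>i<Suc n. a i \<noteq> 0" unfolding a_def
      by (metis Suc_less_eq nat.case(2))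
    then have "0 < M 0 0 * bilin (Suc n) M a a" using pd M0 unfolding pos_def_def by simp
    then show "bilin n (schur M) b b > 0"
      unfolding bilin_schur[OF M] using M0 by (simp add: a_def)
  qed
next
  assume "M 0 0 > 0 \<and> pos_def n (schur M)"
  then have M0: "M 0 0 > 0" and pd: "pos_def n (schur M)" by auto
  show "pos_def (Suc n) M" unfolding pos_def_def
  proof (intro allI impI)
    fix a :: "nat \<Rightarrow> real" assume a: "\<exists>i<Suc n. a i \<noteq> 0"
    have "M 0 0 * bilin (Suc n) M a a > 0"
    proof (cases "\<exists>i<n. a (Suc i) \<noteq> 0")
      case True
      then have "bilin n (schur M) (\<lambda>i. a (Suc i)) (\<lambda>i. a (Suc i)) > 0"
        using pd[unfolded pos_def_def, rule_format, of "\<lambda>i. a (Suc i)"] by blast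
      then show ?thesis unfolding bilin_schur[OF M] by (simp add: add_nonneg_pos)
    next
      case False
      then have "a 0 \<noteq> 0" using a less_Suc_eq_0_disj by auto
      moreover have "bilin n (schur M) (\<lambda>i. a (Suc i)) (\<lambda>i. a (Suc i)) = 0"
        unfolding bilin_def using False by (intro sum.neutral ballI) auto
      moreover have "(\<Sum>j<n. M 0 (Suc j) * a (Suc j)) = 0"
        using False by (intro sum.neutral ballI) auto
      ultimately show ?thesis unfolding bilin_schur[OF M] using M0 by simp
    qed
    then show "bilin (Suc n) M a a > 0" using M0 by (simp add: zero_less_mult_iff)
  qed
qed

text \<open>A zero corner entry rules out completing the square, but then the form is affine in the
  first coordinate and can stay nonnegative only if its slope, given by the rest of the first row,
  vanishes.\<close>

lemma pos_semidef_Suc: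
  assumes M: "sym_mat M"
  shows "pos_semidef (Suc n) M \<longleftrightarrow>
    (M 0 0 > 0 \<and> pos_semidef n (schur M)) \<or>
    (M 0 0 = 0 \<and> (\<forall>j<n. M 0 (Suc j) = 0) \<and> pos_semidef n (shift_mat M))"
proof
  assume psd: "pos_semidef (Suc n) M"
  have "bilin (Suc n) M (\<lambda>i. if i = 0 then 1 else 0 :: real) (\<lambda>i. if i = 0 then 1 else 0) \<ge> 0"
    using psd unfolding pos_semidef_def by blast
  then have "M 0 0 \<ge> 0" unfolding bilin_Suc[OF M] by (simp add: bilin_def)
  then consider "M 0 0 > 0" | "M 0 0 = 0" by linarith
  then show "(M 0 0 > 0 \<and> pos_semidef n (schur M)) \<or>
    (M 0 0 = 0 \<and> (\<forall>j<n. M 0 (Suc j) = 0) \<and> pos_semidef n (shift_mat M))"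
  proof cases
    case 1
    have "bilin n (schur M) b b \<ge> 0" for b :: "nat \<Rightarrow> real"
    proof -
      define a where "a i = (case i of 0 \<Rightarrow> - (\<Sum>j<n. M 0 (Suc j) * b j) / M 0 0 | Suc k \<Rightarrow> b k)" for i
      have "0 \<le> M 0 0 * bilin (Suc n) M a a" using psd 1 unfolding pos_semidef_def by simp
      then show "bilin n (schur M) b b \<ge> 0"
        unfolding bilin_schur[OF M] using 1 by (simp add: a_def)
    qed
    then show ?thesis using 1 by (simp add: pos_semidef_def)
  next
    case 2
    have "bilin n (shift_mat M) b b \<ge> 0" for b :: "nat \<Rightarrow> real"
    proof -
      have "0 \<le> bilin (Suc n) M (case_nat 0 b) (case_nat 0 b)"
        using psd unfolding pos_semidef_def by blast
      then show ?thesis unfolding bilin_Suc[OF M] by simp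
    qed
    moreover have "M 0 (Suc j) = 0" if "j < n" for j
    proof (rule ccontr)
      assume m: "M 0 (Suc j) \<noteq> 0"
      define b where "b i = (if i = j then 1 else 0 :: real)" for i
      \<comment> \<open>Chosen so that the form takes the value -1 at
        \<open>case_nat t b\<close>.\<close>
      define t where "t = - (bilin n (shift_mat M) b b + 1) / (2 * M 0 (Suc j))"
      have "(\<Sum>i<n. M 0 (Suc i) * b i) = M 0 (Suc j)"
        using that by (simp add: b_def if_distrib sum.delta cong: if_cong)
      moreover have "0 \<le> bilin (Suc n) M (case_nat t b) (case_nat t b)"
        using psd unfolding pos_semidef_def by blast
      ultimately show False unfolding bilin_Suc[OF M] using m 2 by (simp add: t_def)
    qed
    ultimately show ?thesis using 2 by (simp add: pos_semidef_def)
  qed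
next
  assume R: "(M 0 0 > 0 \<and> pos_semidef n (schur M)) \<or>
    (M 0 0 = 0 \<and> (\<forall>j<n. M 0 (Suc j) = 0) \<and> pos_semidef n (shift_mat M))"
  show "pos_semidef (Suc n) M" unfolding pos_semidef_def
  proof
    fix a :: "nat \<Rightarrow> real"
    from R show "bilin (Suc n) M a a \<ge> 0"
    proof (elim disjE conjE)
      assume M0: "M 0 0 > 0" and p: "pos_semidef n (schur M)"
      have "0 \<le> M 0 0 * bilin (Suc n) M a a"
        unfolding bilin_schur[OF M] using p by (simp add: pos_semidef_def)
      then show ?thesis using M0 by (simp add: zero_le_mult_iff)
    next
      assume "M 0 0 = 0" "\<forall>j<n. M 0 (Suc j) = 0" "pos_semidef n (shift_mat M)"
      then show ?thesis unfolding bilin_Suc[OF M] by (simp add: pos_semidef_def)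
    qed
  qed
qed

section \<open>Semialgebraic, open and closed conditions on matrices\<close>

definition sa_pred :: "nat \<Rightarrow> ((nat \<Rightarrow> real) \<Rightarrow> bool) \<Rightarrow> bool" where
  "sa_pred n \<phi> \<longleftrightarrow> semialgebraic n {x \<in> topspace (Euclidean_space n). \<phi> x}"

lemma sa_pred_not: "sa_pred n \<phi> \<Longrightarrow> sa_pred n (\<lambda>x. \<not> \<phi> x)"
  unfolding sa_pred_def
  by (drule semialgebraic.compl) (simp add: set_diff_eq cong: conj_cong)

lemma sa_pred_or: "sa_pred n \<phi> \<Longrightarrow> sa_pred n \<psi> \<Longrightarrow> sa_pred n (\<lambda>x. \<phi> x \<or> \<psi> x)"
  unfolding sa_pred_def
  by (drule (1) semialgebraic.union) (simp add: Un_def conj_disj_distribL)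

lemma sa_pred_and: "sa_pred n \<phi> \<Longrightarrow> sa_pred n \<psi> \<Longrightarrow> sa_pred n (\<lambda>x. \<phi> x \<and> \<psi> x)"
  using sa_pred_not[OF sa_pred_or[OF sa_pred_not sa_pred_not], of n \<phi> \<psi>] by simp

lemma sa_pred_pos: "P \<in> polynomial_functions n \<Longrightarrow> sa_pred n (\<lambda>x. P x > 0)"
  unfolding sa_pred_def by (rule semialgebraic.pos)

lemma polynomial_functions_uminus:
  "P \<in> polynomial_functions n \<Longrightarrow> (\<lambda>x. - P x) \<in> polynomial_functions n"
  using polynomial_functions.mult[OF polynomial_functions.const[of "-1"], of P n] by simp

lemma polynomial_functions_diff:
  "P \<in> polynomial_functions n \<Longrightarrow> Q \<in> polynomial_functions n
    \<Longrightarrow> (\<lambda>x. P x - Q x) \<in> polynomial_functions n"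
  using polynomial_functions.add[OF _ polynomial_functions_uminus] by simp

lemma polynomial_functions_sum:
  assumes "\<And>i. i \<in> I \<Longrightarrow> (\<lambda>x. P i x) \<in> polynomial_functions n"
  shows "(\<lambda>x. \<Sum>i\<in>I. P i x) \<in> polynomial_functions n"
  using assms
proof (induction I rule: infinite_finite_induct)
  case (insert i I)
  then show ?case by (simp add: polynomial_functions.add)
qed (simp_all add: polynomial_functions.const)

lemma sa_pred_zero:
  assumes "P \<in> polynomial_functions n"
  shows "sa_pred n (\<lambda>x. P x = 0)"
proof -
  have "sa_pred n (\<lambda>x. \<not> P x > 0 \<and> \<not> - P x > 0)"
    by (intro sa_pred_and sa_pred_not sa_pred_pos polynomial_functions_uminus assms)
  moreover have "(\<lambda>x. \<not> P x > 0 \<and> \<not> - P x > 0) = (\<lambda>x. P x = 0)" by auto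
  ultimately show ?thesis by simp
qed

lemma sa_pred_True: "sa_pred n (\<lambda>x. True)"
  using sa_pred_pos[OF polynomial_functions.const[of 1 n]] by simp

lemma sa_pred_all: "(\<And>j. j < (k::nat) \<Longrightarrow> sa_pred n (\<phi> j)) \<Longrightarrow> sa_pred n (\<lambda>x. \<forall>j<k. \<phi> j x)"
proof (induction k)
  case (Suc k)
  then show ?case using sa_pred_and[of n "\<lambda>x. \<forall>j<k. \<phi> j x" "\<phi> k"]
    by (simp add: All_less_Suc conj_commute)
qed (simp add: sa_pred_True)

text \<open>The recursion through Schur complements removes the quantifier over vectors and leaves
  finitely many strict polynomial inequalities.\<close>

lemma sa_pred_pos_def:
  assumes "\<And>i j. (\<lambda>v. M v i j) \<in> polynomial_functions n" and "\<And>v. sym_mat (M v)"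
  shows "sa_pred n (\<lambda>v. pos_def k (M v))"
  using assms
proof (induction k arbitrary: M)
  case 0
  then show ?case by (simp add: pos_def_def sa_pred_True)
next
  case (Suc k)
  have "(\<lambda>v. schur (M v) i j) \<in> polynomial_functions n" for i j
    unfolding schur_def by (intro polynomial_functions_diff polynomial_functions.mult Suc.prems)
  then have "sa_pred n (\<lambda>v. pos_def k (schur (M v)))"
    using Suc.prems(2) by (intro Suc.IH) (auto simp: sym_mat_schur)
  then show ?case
    unfolding pos_def_Suc[OF Suc.prems(2)] by (intro sa_pred_and sa_pred_pos Suc.prems)
qed

lemma sa_pred_pos_semidef:
  assumes "\<And>i j. (\<lambda>v. M v i j) \<in> polynomial_functions n" and "\<And>v. sym_mat (M v)"
  shows "sa_pred n (\<lambda>v. pos_semidef k (M v))"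
  using assms
proof (induction k arbitrary: M)
  case 0
  then show ?case by (simp add: pos_semidef_def bilin_def sa_pred_True)
next
  case (Suc k)
  have "(\<lambda>v. schur (M v) i j) \<in> polynomial_functions n" for i j
    unfolding schur_def by (intro polynomial_functions_diff polynomial_functions.mult Suc.prems)
  then have 1: "sa_pred n (\<lambda>v. pos_semidef k (schur (M v)))"
    using Suc.prems(2) by (intro Suc.IH) (auto simp: sym_mat_schur)
  have 2: "sa_pred n (\<lambda>v. pos_semidef k (shift_mat (M v)))"
    by (intro Suc.IH sym_mat_shift Suc.prems(2)) (simp add: shift_mat_def Suc.prems(1))
  have 3: "sa_pred n (\<lambda>v. M v 0 0 > 0)" "sa_pred n (\<lambda>v. M v 0 0 = 0)"
    by (rule sa_pred_pos sa_pred_zero, rule Suc.prems)+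
  have 4: "sa_pred n (\<lambda>v. \<forall>j<k. M v 0 (Suc j) = 0)"
    by (rule sa_pred_all, rule sa_pred_zero, rule Suc.prems)
  show ?case
    unfolding pos_semidef_Suc[OF Suc.prems(2)]
    by (rule sa_pred_or; (rule sa_pred_and)?; (rule 3 sa_pred_and)?; rule 1 2 3 4)
qed

lemma continuous_on_polynomial_functions:
  "P \<in> polynomial_functions n \<Longrightarrow> continuous_on UNIV P"
  by (induction rule: polynomial_functions.induct) (auto intro!: continuous_intros)

text \<open>An intersection of open conditions over all vectors need not be open; the Schur
  recursion makes it a finite one.\<close>

lemma open_pos_def:
  assumes "\<And>i j. continuous_on UNIV (\<lambda>v. M v i j)" and "\<And>v. sym_mat (M v)"
  shows "open {v::nat \<Rightarrow> real. pos_def k (M v)}"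
  using assms
proof (induction k arbitrary: M)
  case 0
  then show ?case by (simp add: pos_def_def)
next
  case (Suc k)
  have "open {v. pos_def k (schur (M v))}"
    using Suc.prems by (intro Suc.IH sym_mat_schur) (auto simp: schur_def intro!: continuous_intros)
  moreover have "open {v. M v 0 0 > 0}"
    by (intro open_Collect_less continuous_intros Suc.prems)
  ultimately show ?case
    unfolding pos_def_Suc[OF Suc.prems(2)] by (intro open_Collect_conj)
qed

lemma closed_pos_semidef:
  assumes "\<And>i j. continuous_on UNIV (\<lambda>v. M v i j)"
  shows "closed {v::nat \<Rightarrow> real. pos_semidef k (M v)}"
  unfolding pos_semidef_def bilin_def
  by (intro closed_Collect_all closed_Collect_le continuous_intros) (simp add: assms)+

section \<open>Hermitian extension and strict Cauchy-Schwarz\<close>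

lemma bilin_cnj_self:
  assumes "sym_mat M"
  shows "bilin n M c (\<lambda>i. cnj (c i))
    = of_real (bilin n M (\<lambda>i. Re (c i)) (\<lambda>i. Re (c i)) + bilin n M (\<lambda>i. Im (c i)) (\<lambda>i. Im (c i)))"
proof -
  let ?u = "\<lambda>i. complex_of_real (Re (c i))" and ?v = "\<lambda>i. complex_of_real (Im (c i))"
  have 1: "c = (\<lambda>i. ?u i + \<i> * ?v i)"
    by (simp add: fun_eq_iff complex_eq_iff)
  have 2: "(\<lambda>i. cnj (c i)) = (\<lambda>i. ?u i + (- \<i>) * ?v i)"
    by (simp add: fun_eq_iff complex_eq_iff)
  have "bilin n M c (\<lambda>i. cnj (c i)) = bilin n M (\<lambda>i. ?u i + \<i> * ?v i) (\<lambda>i. ?u i + (- \<i>) * ?v i)"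
    using 1 2 by simp
  also have "\<dots> = bilin n M ?u ?u + bilin n M ?v ?v"
    unfolding bilin_add_left bilin_add_right bilin_mult_left bilin_mult_right
    using bilin_commute[OF assms, of n ?u ?v] by (simp add: algebra_simps)
  finally show ?thesis by (simp add: bilin_of_real)
qed

lemma pos_def_complex:
  assumes "pos_def n M" "sym_mat M" "i < n" "c i \<noteq> 0"
  shows "Re (bilin n M c (\<lambda>i. cnj (c i))) > 0" and "Im (bilin n M c (\<lambda>i. cnj (c i))) = 0"
proof -
  have pos: "bilin n M a a \<ge> 0" "(\<exists>i<n. a i \<noteq> 0) \<Longrightarrow> bilin n M a a > 0" for a :: "nat \<Rightarrow> real"
  proof -
    show "(\<exists>i<n. a i \<noteq> 0) \<Longrightarrow> bilin n M a a > 0" using assms by (simp add: pos_def_def)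
    then show "bilin n M a a \<ge> 0"
      by (cases "\<exists>i<n. a i \<noteq> 0") (auto simp: bilin_def intro!: sum_nonneg)
  qed
  from assms(4) have "Re (c i) \<noteq> 0 \<or> Im (c i) \<noteq> 0" by (simp add: complex_eq_iff)
  then show "Re (bilin n M c (\<lambda>i. cnj (c i))) > 0"
    unfolding bilin_cnj_self[OF assms(2)]
    using pos[of "\<lambda>i. Re (c i)"] pos[of "\<lambda>i. Im (c i)"] assms(3)
    by (auto intro: add_pos_nonneg add_nonneg_pos)
  show "Im (bilin n M c (\<lambda>i. cnj (c i))) = 0"
    unfolding bilin_cnj_self[OF assms(2)] by simp
qed

text \<open>The vector \<open>w\<close>, which is \<open>G\<close> times the component of
  \<open>c\<close> orthogonal to \<open>e\<close>, is nonzero by independence, and the form takes on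
  it the value \<open>G * (G * A - |b|^2)\<close>.\<close>

lemma cauchy_schwarz_pos_def:
  fixes c e :: "nat \<Rightarrow> complex"
  assumes pd: "pos_def n M" and M: "sym_mat M"
    and ind: "\<And>\<alpha> \<beta>. (\<And>i. i < n \<Longrightarrow> \<alpha> * c i + \<beta> * e i = 0) \<Longrightarrow> \<alpha> = 0 \<and> \<beta> = 0"
  shows "(cmod (bilin n M c (\<lambda>i. cnj (e i))))\<^sup>2
    < Re (bilin n M c (\<lambda>i. cnj (c i))) * Re (bilin n M e (\<lambda>i. cnj (e i)))"
proof -
  define A where "A = Re (bilin n M c (\<lambda>i. cnj (c i)))"
  define G where "G = Re (bilin n M e (\<lambda>i. cnj (e i)))"
  define b where "b = bilin n M c (\<lambda>i. cnj (e i))"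
  have A: "bilin n M c (\<lambda>i. cnj (c i)) = of_real A"
    unfolding A_def bilin_cnj_self[OF M] by simp
  have G: "bilin n M e (\<lambda>i. cnj (e i)) = of_real G"
    unfolding G_def bilin_cnj_self[OF M] by simp
  have b': "bilin n M e (\<lambda>i. cnj (c i)) = cnj b"
    unfolding b_def cnj_bilin using bilin_commute[OF M] by simp
  obtain i where i: "i < n" "e i \<noteq> 0" using ind[of 0 1] by auto
  then have Gpos: "G > 0" unfolding G_def by (intro pos_def_complex(1)[OF pd M])
  define w where "w i = of_real G * c i + (- b) * e i" for i
  have cw: "(\<lambda>i. cnj (w i)) = (\<lambda>i. of_real G * cnj (c i) + (- cnj b) * cnj (e i))"
    by (simp add: w_def)
  have "\<exists>i<n. w i \<noteq> 0" unfolding w_def using ind[of "of_real G" "- b"] Gpos by auto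
  then have "Re (bilin n M w (\<lambda>i. cnj (w i))) > 0"
    using pos_def_complex(1)[OF pd M] by blast
  moreover have "bilin n M w (\<lambda>i. cnj (w i)) = of_real G * (of_real G * of_real A - b * cnj b)"
    unfolding cw unfolding w_def
    unfolding bilin_add_left bilin_add_right bilin_mult_left bilin_mult_right A G b' b_def[symmetric]
    by (simp add: algebra_simps)
  moreover have "b * cnj b = of_real ((cmod b)\<^sup>2)" by (simp add: complex_norm_square[symmetric])
  ultimately have "G * (G * A - (cmod b)\<^sup>2) > 0"
    by (simp del: of_real_power)
  then show ?thesis using Gpos unfolding A_def[symmetric] G_def[symmetric] b_def[symmetric]
    by (simp add: zero_less_mult_iff mult.commute)
qed

definition definite :: "nat \<Rightarrow> (nat \<Rightarrow> nat \<Rightarrow> real) \<Rightarrow> bool" where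
  "definite n M \<longleftrightarrow> pos_def n M \<or> pos_def n (\<lambda>i j. - M i j)"

lemma definite_sign:
  assumes "definite n M"
  obtains \<sigma> :: real where "\<sigma> = 1 \<or> \<sigma> = - 1" "pos_def n (\<lambda>i j. \<sigma> * M i j)"
proof -
  have "pos_def n (\<lambda>i j. 1 * M i j) \<or> pos_def n (\<lambda>i j. (-1) * M i j)"
    using assms by (simp add: definite_def)
  then show thesis using that by blast
qed

lemma bilin_scale: "bilin n (\<lambda>i j. \<sigma> * M i j) a b = of_real \<sigma> * bilin n M a b"
  by (simp add: bilin_def sum_distrib_left mult_ac)

text \<open>Both sides are quadratic in the matrix, so a change of its sign does not affect
  them.\<close>

lemma cauchy_schwarz_definite:
  fixes c e :: "nat \<Rightarrow> complex"
  assumes d: "definite n M" and M: "sym_mat M"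
    and ind: "\<And>\<alpha> \<beta>. (\<And>i. i < n \<Longrightarrow> \<alpha> * c i + \<beta> * e i = 0) \<Longrightarrow> \<alpha> = 0 \<and> \<beta> = 0"
  shows "(cmod (bilin n M c (\<lambda>i. cnj (e i))))\<^sup>2
    < Re (bilin n M c (\<lambda>i. cnj (c i))) * Re (bilin n M e (\<lambda>i. cnj (e i)))"
proof -
  obtain \<sigma> :: real where s: "\<sigma> = 1 \<or> \<sigma> = - 1" and pd: "pos_def n (\<lambda>i j. \<sigma> * M i j)"
    using d by (rule definite_sign)
  have "sym_mat (\<lambda>i j. \<sigma> * M i j)" using M by (simp add: sym_mat_def)
  from cauchy_schwarz_pos_def[OF pd this ind, unfolded bilin_scale] s show ?thesis by auto
qed

section \<open>Binary forms and the Bezoutian\<close>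

abbreviation ceval :: "real poly \<Rightarrow> complex \<Rightarrow> complex" where
  "ceval p \<equiv> poly (cpoly p)"

text \<open>For \<open>degree p \<le> d\<close> this is the homogenization of \<open>p\<close> to
  degree \<open>d\<close>; a smaller degree of \<open>p\<close> shows as a zero at
  \<open>(1, 0)\<close>, the point at infinity.\<close>

definition hform :: "nat \<Rightarrow> real poly \<Rightarrow> 'a::real_field \<times> 'a \<Rightarrow> 'a" where
  "hform d p X = (\<Sum>i\<le>d. of_real (coeff p i) * fst X ^ i * snd X ^ (d - i))"

definition form_pair :: "nat \<Rightarrow> real poly \<Rightarrow> real poly \<Rightarrow> 'a::real_field \<times> 'a \<Rightarrow> 'a \<times> 'a" where
  "form_pair d p q X = (hform d p X, hform d q X)"

text \<open>The coefficient of \<open>x^i y^j\<close> in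
  \<open>(p(x) q(y) - p(y) q(x)) / (x - y)\<close>. It does not refer to \<open>d\<close>, so one
  matrix serves for every size.\<close>

definition bez :: "real poly \<Rightarrow> real poly \<Rightarrow> nat \<Rightarrow> nat \<Rightarrow> real" where
  "bez p q i j = (\<Sum>k\<le>min i j. coeff p (i + j + 1 - k) * coeff q k - coeff p k * coeff q (i + j + 1 - k))"

definition wedge :: "'a::real_field \<times> 'a \<Rightarrow> 'a \<times> 'a \<Rightarrow> 'a" where
  "wedge X Y = fst X * snd Y - fst Y * snd X"

definition pvec :: "nat \<Rightarrow> 'a::real_field \<times> 'a \<Rightarrow> nat \<Rightarrow> 'a" where
  "pvec d X i = fst X ^ i * snd X ^ (d - 1 - i)"

definition kernel :: "nat \<Rightarrow> real poly \<Rightarrow> real poly \<Rightarrow> 'a::real_field \<times> 'a \<Rightarrow> 'a \<times> 'a \<Rightarrow> 'a" where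
  "kernel d p q X Y = bilin d (bez p q) (pvec d X) (pvec d Y)"

lemma sym_mat_bez: "sym_mat (bez p q)"
  by (simp add: sym_mat_def bez_def min.commute add.commute)

lemma bez_eq_0:
  assumes "degree p \<le> d" "degree q \<le> d" "d \<le> i \<or> d \<le> j"
  shows "bez p q i j = 0"
  unfolding bez_def
proof (intro sum.neutral ballI)
  fix k assume "k \<in> {..min i j}"
  then have "i + j + 1 - k > d" using assms(3) by auto
  then show "coeff p (i + j + 1 - k) * coeff q k - coeff p k * coeff q (i + j + 1 - k) = 0"
    using assms(1,2) by (simp add: coeff_eq_0)
qed

text \<open>The coefficient of \<open>x^i y^j\<close> in the product of \<open>x - y\<close> with
  the Bezoutian, where \<open>case_nat 0\<close> supplies the missing entry before index 0. The two
  sums differ by at most one term.\<close>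

lemma bez_diff:
  "case_nat 0 (\<lambda>k. bez p q k j) i - case_nat 0 (\<lambda>k. bez p q k i) j
    = coeff p i * coeff q j - coeff p j * coeff q i"
proof (cases i)
  case 0
  then show ?thesis by (cases j) (simp_all add: bez_def)
next
  case (Suc a)
  note i = Suc
  show ?thesis
  proof (cases j)
    case 0
    then show ?thesis using i by (simp add: bez_def)
  next
    case (Suc m)
    let ?D = "\<lambda>k. coeff p (a + m + 2 - k) * coeff q k - coeff p k * coeff q (a + m + 2 - k)"
    have 1: "bez p q a (Suc m) = (\<Sum>k\<le>min a (Suc m). ?D k)"
      by (simp add: bez_def)
    have 2: "bez p q m (Suc a) = (\<Sum>k\<le>min m (Suc a). ?D k)"
      by (simp add: bez_def add.commute)
    consider "a < m" | "a = m" | "m < a" by linarith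
    then show ?thesis
    proof cases
      case 1
      then have "min a (Suc m) = a" "min m (Suc a) = Suc a" by auto
      with 1 show ?thesis using i Suc \<open>bez p q a (Suc m) = _\<close> 2 by simp
    next
      case 2
      then show ?thesis using i Suc by simp
    next
      case 3
      then have "min a (Suc m) = Suc m" "min m (Suc a) = m" by auto
      with 3 show ?thesis using i Suc 1 2 by simp
    qed
  qed
qed

text \<open>Comparing coefficients reduces this to \<open>bez_diff\<close>. Nothing is divided out,
  so poles, infinity and the diagonal are included.\<close>

lemma wedge_kernel:
  assumes p: "degree p \<le> d" and q: "degree q \<le> d"
  shows "wedge X Y * kernel d p q X Y = wedge (form_pair d p q X) (form_pair d p q Y)"
proof -
  obtain x y where X: "X = (x, y)" by (cases X)
  obtain u v where Y: "Y = (u, v)" by (cases Y)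
  define T where "T i j = x ^ i * y ^ (d - i) * (u ^ j * v ^ (d - j))" for i j
  define b :: "nat \<Rightarrow> nat \<Rightarrow> 'a" where "b i j = of_real (bez p q i j)" for i j
  define c :: "nat \<Rightarrow> nat \<Rightarrow> 'a" where "c i j = case_nat 0 (\<lambda>k. b k j) i" for i j
  have e1: "y ^ (d - i) = y * y ^ (d - 1 - i)" "v ^ (d - i) = v * v ^ (d - 1 - i)" if "i < d" for i
    using that by (metis One_nat_def Suc_diff_Suc diff_Suc_eq_diff_pred power_Suc)+
  have e: "of_real (bez p q i j) * pvec d X i * pvec d Y j * (x * v) = b i j * T (Suc i) j"
          "of_real (bez p q i j) * pvec d X i * pvec d Y j * (u * y) = b i j * T i (Suc j)"
    if "i < d" "j < d" for i j
    using that by (simp_all add: T_def pvec_def X Y b_def e1)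
  have z: "b i j = 0" if "d \<le> i \<or> d \<le> j" for i j
    using bez_eq_0[OF p q that] by (simp add: b_def)
  have d: "{..d} = insert d {..<d}" by auto
  \<comment> \<open>The factor \<open>x * v\<close> raises the first index by one, and the terms
    with index \<open>d\<close> that the longer sums add vanish by \<open>z\<close>.\<close>
  have bT1: "(\<Sum>i<d. \<Sum>j<d. b i j * T (Suc i) j) = (\<Sum>i\<le>d. \<Sum>j\<le>d. c i j * T i j)"
    by (subst sum.atMost_shift) (simp add: c_def d z)
  have bs: "b i j = b j i" for i j
    using sym_mat_bez[of p q] by (simp add: b_def sym_mat_def)
  have "(\<Sum>i<d. \<Sum>j<d. b i j * T i (Suc j)) = (\<Sum>j<d. \<Sum>i<d. b i j * T i (Suc j))"
    by (rule sum.swap)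
  also have "\<dots> = (\<Sum>j\<le>d. \<Sum>i\<le>d. c j i * T i j)"
    by (subst sum.atMost_shift) (simp add: c_def d z bs)
  also have "\<dots> = (\<Sum>i\<le>d. \<Sum>j\<le>d. c j i * T i j)"
    by (rule sum.swap)
  finally have bT2: "(\<Sum>i<d. \<Sum>j<d. b i j * T i (Suc j)) = (\<Sum>i\<le>d. \<Sum>j\<le>d. c j i * T i j)" .
  have "wedge X Y * kernel d p q X Y = (\<Sum>i<d. \<Sum>j<d. b i j * T (Suc i) j) - (\<Sum>i<d. \<Sum>j<d. b i j * T i (Suc j))"
  proof -
    have "wedge X Y * kernel d p q X Y = 
      (\<Sum>i<d. \<Sum>j<d. of_real (bez p q i j) * pvec d X i * pvec d Y j * (x * v)) - 
      (\<Sum>i<d. \<Sum>j<d. of_real (bez p q i j) * pvec d X i * pvec d Y j * (u * y))"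
      unfolding kernel_def bilin_def wedge_def
      by (simp add: X Y sum_distrib_right sum_distrib_left sum_subtractf[symmetric] algebra_simps)
    then show ?thesis by (simp add: e)
  qed
  also have "\<dots> = (\<Sum>i\<le>d. \<Sum>j\<le>d. (c i j - c j i) * T i j)"
    unfolding bT1 bT2 by (simp add: sum_subtractf algebra_simps)
  also have "\<dots> = (\<Sum>i\<le>d. \<Sum>j\<le>d. of_real (coeff p i * coeff q j - coeff p j * coeff q i) * T i j)"
  proof -
    have "c i j - c j i = of_real (coeff p i * coeff q j - coeff p j * coeff q i)" for i j
      unfolding bez_diff[of p q j i, symmetric] c_def b_def by (cases i; cases j) simp_all
    then show ?thesis by simp
  qed
  also have "\<dots> = hform d p X * hform d q Y - (\<Sum>i\<le>d. \<Sum>j\<le>d. of_real (coeff p j * coeff q i) * T i j)"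
    unfolding hform_def sum_product sum_subtractf[symmetric]
    by (intro sum.cong refl) (simp add: X Y T_def algebra_simps)
  also have "(\<Sum>i\<le>d. \<Sum>j\<le>d. of_real (coeff p j * coeff q i) * T i j) = hform d p Y * hform d q X"
    unfolding mult.commute[of "hform d p Y" "hform d q X"] unfolding hform_def sum_product
    by (intro sum.cong refl) (simp add: X Y T_def algebra_simps)
  finally show ?thesis by (simp add: wedge_def form_pair_def)
qed

lemma sum_power_eq_0:
  fixes c :: "nat \<Rightarrow> 'a::real_field"
  assumes "finite A" "\<And>x. x \<notin> A \<Longrightarrow> (\<Sum>i<n. c i * x ^ i) = 0" "i < n"
  shows "c i = 0"
proof -
  define P where "P = (\<Sum>i<n. monom (c i) i)"
  have "UNIV - A \<subseteq> {x. poly P x = 0}"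
    using assms(2) by (auto simp: P_def poly_sum poly_monom)
  moreover have "infinite (UNIV - A)"
    using assms(1) by (simp add: Diff_infinite_finite infinite_UNIV_char_0)
  ultimately have "P = 0" using poly_roots_finite[of P] finite_subset by blast
  then have "coeff P i = 0" by simp
  then show ?thesis using assms(3)
    by (simp add: P_def coeff_sum if_distrib cong: if_cong)
qed

lemma hform_affine:
  assumes "degree p \<le> d"
  shows "hform d p (x, 1) = poly (map_poly of_real p) x"
proof -
  have "poly (map_poly of_real p) x = (\<Sum>i\<le>degree p. of_real (coeff p i) * x ^ i)"
    by (simp add: poly_altdef degree_map_poly coeff_map_poly)
  also have "\<dots> = (\<Sum>i\<le>d. of_real (coeff p i) * x ^ i)"
    using assms by (intro sum.mono_neutral_left) (auto simp: coeff_eq_0)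
  finally show ?thesis by (simp add: hform_def)
qed

lemma map_poly_of_real_id [simp]: "map_poly of_real p = (p :: real poly)"
  by (rule poly_eqI) (simp add: coeff_map_poly)

lemma hform_affine_real: "degree p \<le> d \<Longrightarrow> hform d p (x, 1) = poly p x"
  by (simp add: hform_affine)

lemma hform_affine_complex: "degree p \<le> d \<Longrightarrow> hform d p (z, 1) = ceval p z"
  by (simp add: hform_affine cpoly_def)

lemma hform_scale: "hform d p (c * x, c * y) = c ^ d * hform d p (x, y)"
proof -
  have "of_real (coeff p i) * (c * x) ^ i * (c * y) ^ (d - i)
      = c ^ d * (of_real (coeff p i) * x ^ i * y ^ (d - i))" if "i \<le> d" for i
  proof -
    have "c ^ d = c ^ i * c ^ (d - i)" using that by (simp flip: power_add)
    then show ?thesis by (simp add: power_mult_distrib)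
  qed
  then show ?thesis unfolding hform_def sum_distrib_left fst_conv snd_conv
    by (intro sum.cong refl) simp
qed

lemma hform_infinity: "hform d p (c, 0) = of_real (coeff p d) * c ^ d"
proof -
  have "hform d p (c, 0) = (\<Sum>i\<le>d. if i = d then of_real (coeff p d) * c ^ d else 0)"
    unfolding hform_def by (intro sum.cong refl) auto
  then show ?thesis by simp
qed

lemma cnj_hform: "cnj (hform d p X) = hform d p (cnj (fst X), cnj (snd X))"
  by (simp add: hform_def)

lemma hform_of_real: "hform d p (of_real x, of_real y) = of_real (hform d p (x, y))"
  by (simp add: hform_def)

lemma pvec_scale:
  assumes "i < d"
  shows "pvec d (c * x, c * y) i = c ^ (d - 1) * pvec d (x, y) i"
proof -
  have "c ^ (d - 1) = c ^ i * c ^ (d - 1 - i)" using assms by (simp flip: power_add)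
  then show ?thesis by (simp add: pvec_def power_mult_distrib)
qed

lemma kernel_scale_left: "kernel d p q (c * x, c * y) Y = c ^ (d - 1) * kernel d p q (x, y) Y"
  unfolding kernel_def bilin_mult_left[symmetric]
  by (rule bilin_cong) (simp_all add: pvec_scale)

lemma kernel_commute: "kernel d p q X Y = kernel d p q Y X"
  unfolding kernel_def by (rule bilin_commute[OF sym_mat_bez])

lemma kernel_scale_right: "kernel d p q X (c * x, c * y) = c ^ (d - 1) * kernel d p q X (x, y)"
  using kernel_scale_left[of d p q c x y X] by (simp add: kernel_commute)

lemma kernel_of_real:
  "kernel d p q (of_real x, of_real y) (of_real u, of_real v) = (of_real (kernel d p q (x, y) (u, v)) :: 'a::real_field)"
proof -
  have "pvec d (of_real x, of_real y :: 'a) = (\<lambda>i. of_real (pvec d (x, y) i))" for x y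
    by (simp add: pvec_def fun_eq_iff)
  then show ?thesis unfolding kernel_def by (simp add: bilin_of_real)
qed

lemma kernel_affine:
  "kernel d p q (x, 1) (y, 1) = (\<Sum>i<d. \<Sum>j<d. of_real (bez p q i j) * x ^ i * y ^ j)"
  by (simp add: kernel_def bilin_def pvec_def)

lemma kernel_infinity:
  assumes "d > 0"
  shows "kernel d p q (1, 0) (1, 0) = of_real (bez p q (d - 1) (d - 1))"
proof -
  have e: "pvec d (1, 0 :: 'a) i = (if i = d - 1 then 1 else 0)" if "i < d" for i
    using that by (auto simp: pvec_def power_0_left)
  have "kernel d p q (1, 0) (1, 0 :: 'a)
      = (\<Sum>i<d. \<Sum>j<d. if i = d - 1 \<and> j = d - 1 then of_real (bez p q (d - 1) (d - 1)) else 0)"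
    unfolding kernel_def bilin_def by (intro sum.cong refl) (simp add: e)
  also have "\<dots> = (\<Sum>i<d. if i = d - 1 then of_real (bez p q (d - 1) (d - 1)) else 0)"
    using assms by (intro sum.cong refl) (simp add: sum.delta if_distrib cong: if_cong)
  finally show ?thesis using assms by simp
qed

text \<open>The kernel is the difference quotient of \<open>p(y) q(x) - p(x) q(y)\<close> in
  \<open>y\<close>, so its diagonal is the Wronskian, the numerator of the derivative of
  \<open>p / q\<close>.\<close>

lemma kernel_diag:
  fixes x :: "'a::real_normed_field"
  assumes "degree p \<le> d" "degree q \<le> d"
  defines "P \<equiv> map_poly of_real p" and "Q \<equiv> map_poly of_real q"
  shows "kernel d p q (x, 1) (x, 1) = poly (pderiv P) x * poly Q x - poly P x * poly (pderiv Q) x"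
proof -
  let ?f = "\<lambda>y. poly P y * poly Q x - poly P x * poly Q y"
  let ?k = "\<lambda>y. kernel d p q (y, 1) (x, 1)"
  have "isCont ?k x" unfolding kernel_affine by (intro continuous_intros)
  moreover have "?f y - ?f x = ?k y * (y - x)" for y
    using wedge_kernel[OF assms(1,2), of "(y, 1)" "(x, 1)"]
    by (simp add: wedge_def form_pair_def hform_affine assms mult.commute)
  ultimately have "DERIV ?f x :> ?k x"
    unfolding CARAT_DERIV by (intro exI[of _ ?k]) auto
  moreover have "DERIV ?f x :> poly (pderiv P) x * poly Q x - poly P x * poly (pderiv Q) x"
    by (auto intro!: derivative_eq_intros)
  ultimately show ?thesis by (rule DERIV_unique)
qed

text \<open>Turns a decomposition of the kernel as a polynomial into a diagonalization of the
  quadratic form. It serves both the Lagrange basis of a real fibre and the quotients of a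
  real-rooted polynomial by its linear factors.\<close>

lemma bez_sum_of_squares:
  fixes S :: "'b set" and l :: "'b \<Rightarrow> real poly"
  assumes p: "degree p \<le> d" and q: "degree q \<le> d"
    and l: "\<And>s. s \<in> S \<Longrightarrow> degree (l s) < d"
    and eq: "\<And>x y. poly p x * poly q y - poly p y * poly q x
      = (x - y) * (\<Sum>s\<in>S. m s * poly (l s) x * poly (l s) y)"
  shows "bilin d (bez p q) a a = (\<Sum>s\<in>S. m s * (\<Sum>k<d. coeff (l s) k * a k)\<^sup>2)"
proof -
  define c where "c i j = (\<Sum>s\<in>S. m s * coeff (l s) i * coeff (l s) j)" for i j
  have L: "poly (l s) x = (\<Sum>i<d. coeff (l s) i * x ^ i)" if "s \<in> S" for s x
    unfolding poly_altdef using l[OF that] by (intro sum.mono_neutral_left) (auto simp: coeff_eq_0)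
  have C: "(\<Sum>s\<in>S. m s * poly (l s) x * poly (l s) y) = (\<Sum>i<d. \<Sum>j<d. c i j * x ^ i * y ^ j)" for x y
  proof -
    have "(\<Sum>s\<in>S. m s * poly (l s) x * poly (l s) y)
      = (\<Sum>s\<in>S. \<Sum>i<d. \<Sum>j<d. m s * coeff (l s) i * coeff (l s) j * x ^ i * y ^ j)"
      by (intro sum.cong refl) (simp add: L sum_product sum_distrib_left mult_ac)
    also have "\<dots> = (\<Sum>i<d. \<Sum>s\<in>S. \<Sum>j<d. m s * coeff (l s) i * coeff (l s) j * x ^ i * y ^ j)"
      by (rule sum.swap)
    also have "\<dots> = (\<Sum>i<d. \<Sum>j<d. \<Sum>s\<in>S. m s * coeff (l s) i * coeff (l s) j * x ^ i * y ^ j)"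
      by (intro sum.cong refl sum.swap)
    also have "\<dots> = (\<Sum>i<d. \<Sum>j<d. c i j * x ^ i * y ^ j)"
      by (simp add: c_def sum_distrib_right)
    finally show ?thesis .
  qed
  \<comment> \<open>Cancelling \<open>x - y\<close> leaves out \<open>x = y\<close>, but for fixed
    \<open>y\<close> a polynomial in \<open>x\<close> that vanishes everywhere else is zero.\<close>
  have D: "(\<Sum>i<d. (\<Sum>j<d. (bez p q i j - c i j) * y ^ j) * x ^ i) = 0" if "x \<notin> {y}" for x y
  proof -
    have "(x - y) * kernel d p q (x, 1) (y, 1) = (x - y) * (\<Sum>i<d. \<Sum>j<d. c i j * x ^ i * y ^ j)"
      using wedge_kernel[OF p q, of "(x, 1)" "(y, 1)"] eq[of x y]
      by (simp add: wedge_def form_pair_def hform_affine_real p q C)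
    then have "(\<Sum>i<d. \<Sum>j<d. bez p q i j * x ^ i * y ^ j) = (\<Sum>i<d. \<Sum>j<d. c i j * x ^ i * y ^ j)"
      using that by (simp add: kernel_affine)
    then have "(\<Sum>i<d. \<Sum>j<d. (bez p q i j - c i j) * x ^ i * y ^ j) = 0"
      by (simp add: left_diff_distrib sum_subtractf)
    then show ?thesis
      by (simp add: sum_distrib_left mult_ac)
  qed
  have "(\<Sum>j<d. (bez p q i j - c i j) * y ^ j) = 0" if "i < d" for i y
    by (rule sum_power_eq_0[OF _ D that, of "{y}"]) auto
  then have "bez p q i j = c i j" if "i < d" "j < d" for i j
    using sum_power_eq_0[where A = "{}" and n = d and c = "\<lambda>j. bez p q i j - c i j" and i = j] that by simp
  then have "bilin d (bez p q) a a = (\<Sum>i<d. \<Sum>j<d. \<Sum>s\<in>S. m s * coeff (l s) i * coeff (l s) j * a i * a j)"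
    unfolding bilin_def by (intro sum.cong refl) (simp add: c_def sum_distrib_right)
  also have "\<dots> = (\<Sum>i<d. \<Sum>s\<in>S. \<Sum>j<d. m s * coeff (l s) i * coeff (l s) j * a i * a j)"
    by (intro sum.cong refl sum.swap)
  also have "\<dots> = (\<Sum>s\<in>S. \<Sum>i<d. \<Sum>j<d. m s * coeff (l s) i * coeff (l s) j * a i * a j)"
    by (rule sum.swap)
  also have "\<dots> = (\<Sum>s\<in>S. m s * (\<Sum>k<d. coeff (l s) k * a k)\<^sup>2)"
    by (simp add: power2_eq_square sum_product sum_distrib_left mult_ac)
  finally show ?thesis .
qed

text \<open>Combining two consecutive coordinates with the entries of \<open>Y\<close> eliminates
  \<open>Y\<close> and leaves \<open>wedge X Y\<close> times a monomial of degree
  \<open>d - 2\<close> in \<open>X\<close>. For \<open>d = 1\<close> the vectors would have a single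
  entry and Cauchy-Schwarz could not be strict.\<close>

lemma pvec_independent:
  assumes d: "d \<ge> 2" and o: "wedge X Y \<noteq> 0" and z: "\<And>i. i < d \<Longrightarrow> \<alpha> * pvec d X i + \<beta> * pvec d Y i = 0"
  shows "\<alpha> = 0 \<and> \<beta> = 0"
proof -
  have *: "\<alpha> = 0" if o: "wedge X Y \<noteq> 0" and z: "\<And>i. i < d \<Longrightarrow> \<alpha> * pvec d X i + \<beta> * pvec d Y i = 0"
    for X Y :: "'a \<times> 'a" and \<alpha> \<beta>
  proof (rule ccontr)
    assume a: "\<alpha> \<noteq> 0"
    have 0: "fst X ^ i * snd X ^ (d - 2 - i) = 0" if "i \<le> d - 2" for i
    proof -
      have i: "Suc i < d" "i < d" using that d by auto
      have e: "d - 1 - i = Suc (d - 2 - i)" "d - 1 - Suc i = d - 2 - i" using that d by auto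
      have "\<alpha> * (fst X ^ i * snd X ^ (d - 2 - i)) * wedge X Y
        = snd Y * (\<alpha> * pvec d X (Suc i) + \<beta> * pvec d Y (Suc i))
          - fst Y * (\<alpha> * pvec d X i + \<beta> * pvec d Y i)"
        unfolding pvec_def e wedge_def by (simp add: algebra_simps)
      then show ?thesis using a o z[OF i(1)] z[OF i(2)] by simp
    qed
    have "snd X ^ (d - 2) = 0" "fst X ^ (d - 2) = 0" using 0[of 0] 0[of "d - 2"] by auto
    then show False using o by (simp add: wedge_def)
  qed
  have "wedge Y X \<noteq> 0" using o by (simp add: wedge_def algebra_simps)
  moreover have "\<beta> * pvec d Y i + \<alpha> * pvec d X i = 0" if "i < d" for i
    using z[OF that] by (simp add: add.commute)
  ultimately show ?thesis using *[OF o z] *[of Y X \<beta> \<alpha>] by auto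
qed

section \<open>Schwarz-Pick and Julia inequalities\<close>

definition cnj_pair :: "complex \<times> complex \<Rightarrow> complex \<times> complex" where
  "cnj_pair X = (cnj (fst X), cnj (snd X))"

lemma strict_descent:
  fixes g :: "nat \<Rightarrow> real"
  assumes "g 1 < g 0" "\<And>n. g (Suc n) \<le> g n" "k \<ge> 1"
  shows "g k < g 0"
  using assms(3)
proof (induction k rule: dec_induct)
  case (step n)
  then show ?case using assms(2)[of n] by simp
qed (rule assms(1))

locale definite_pair =
  fixes d :: nat and p q :: "real poly"
  assumes two_le: "d \<ge> 2" and deg_p: "degree p \<le> d" and deg_q: "degree q \<le> d"
    and definite_bez: "definite d (bez p q)"
begin

abbreviation "F \<equiv> form_pair d p q"
abbreviation "K \<equiv> kernel d p q"

text \<open>\<open>wedge X (cnj_pair X)\<close> measures the imaginary part of the point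
  \<open>X\<close>, and \<open>L X\<close> is the factor by which \<open>F\<close> multiplies
  it.\<close>

definition L :: "complex \<times> complex \<Rightarrow> real" where
  "L X = Re (K X (cnj_pair X))"

definition \<phi> :: "complex \<Rightarrow> complex" where
  "\<phi> z = ceval p z / ceval q z"

lemmas wedge_K = wedge_kernel[OF deg_p deg_q]

lemma F_cnj_pair: "F (cnj_pair X) = cnj_pair (F X)"
  by (simp add: form_pair_def cnj_pair_def cnj_hform)

lemma pvec_cnj_pair: "pvec d (cnj_pair X) = (\<lambda>i. cnj (pvec d X i))"
  by (simp add: pvec_def cnj_pair_def fun_eq_iff)

lemma F_affine: "F (z, 1) = (ceval p z, ceval q z)"
  by (simp add: form_pair_def hform_affine_complex deg_p deg_q)

lemma pvec_nonzero:
  assumes "X \<noteq> (0, 0)"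
  obtains i where "i < d" "pvec d X i \<noteq> (0::'a::real_field)"
proof (cases "snd X = 0")
  case True
  then have "fst X \<noteq> 0" using assms by (cases X) auto
  then show ?thesis using that[of "d - 1"] two_le by (simp add: pvec_def)
next
  case False
  then show ?thesis using that[of 0] two_le by (simp add: pvec_def)
qed

lemma K_cnj_pair_self: "K X (cnj_pair X) = of_real (L X)"
  unfolding L_def kernel_def pvec_cnj_pair bilin_cnj_self[OF sym_mat_bez] by simp

lemma L_sign:
  obtains \<sigma> :: real where "\<sigma> = 1 \<or> \<sigma> = -1" "\<And>X. X \<noteq> (0, 0) \<Longrightarrow> \<sigma> * L X > 0"
proof -
  obtain \<sigma> :: real where s: "\<sigma> = 1 \<or> \<sigma> = - 1" and pd: "pos_def d (\<lambda>i j. \<sigma> * bez p q i j)"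
    using definite_bez by (rule definite_sign)
  have sym: "sym_mat (\<lambda>i j. \<sigma> * bez p q i j)" using sym_mat_bez[of p q] by (simp add: sym_mat_def)
  have "\<sigma> * L X > 0" if X: "X \<noteq> (0, 0)" for X
  proof -
    obtain i where i: "i < d" "pvec d X i \<noteq> 0" using pvec_nonzero[OF X] .
    have "0 < Re (bilin d (\<lambda>i j. \<sigma> * bez p q i j) (pvec d X) (\<lambda>i. cnj (pvec d X i)))"
      by (rule pos_def_complex(1)[OF pd sym i(1)]) (rule i(2))
    then show ?thesis by (simp add: bilin_scale L_def kernel_def pvec_cnj_pair)
  qed
  then show thesis using that s by blast
qed

lemma L_mult_pos:
  assumes "X \<noteq> (0, 0)" "Y \<noteq> (0, 0)"
  shows "L X * L Y > 0"
proof -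
  obtain \<sigma> :: real where "\<And>X. X \<noteq> (0, 0) \<Longrightarrow> \<sigma> * L X > 0"
    using L_sign by blast
  then have "0 < (\<sigma> * L X) * (\<sigma> * L Y)" using assms by simp
  also have "\<dots> = \<sigma>\<^sup>2 * (L X * L Y)" by (simp add: power2_eq_square)
  finally show ?thesis by (simp add: zero_less_mult_iff)
qed

lemma L_nonzero: "X \<noteq> (0, 0) \<Longrightarrow> L X \<noteq> 0"
  using L_mult_pos[of X X] by auto

lemma K_strict:
  assumes "wedge X Y \<noteq> 0"
  shows "(cmod (K X (cnj_pair Y)))\<^sup>2 < L X * L Y"
  unfolding L_def kernel_def pvec_cnj_pair
  by (rule cauchy_schwarz_definite[OF definite_bez sym_mat_bez])
    (rule pvec_independent[OF two_le assms])

text \<open>If \<open>F X\<close> vanished, then so would \<open>K X Y\<close> for all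
  \<open>Y\<close>, and the monomial vector of \<open>X\<close> would lie in the radical of a
  definite form. Hence \<open>p\<close> and \<open>q\<close> are coprime, and one of them has degree
  \<open>d\<close>.\<close>

lemma F_nonzero:
  fixes X :: "complex \<times> complex"
  assumes X: "X \<noteq> (0, 0)"
  shows "F X \<noteq> (0, 0)"
proof
  assume F: "F X = (0, 0)"
  define r where "r j = (\<Sum>i<d. of_real (bez p q i j) * pvec d X i)" for j
  have K: "K X Y = (\<Sum>j<d. r j * pvec d Y j)" for Y
  proof -
    have "K X Y = (\<Sum>j<d. \<Sum>i<d. of_real (bez p q i j) * pvec d X i * pvec d Y j)"
      unfolding kernel_def bilin_def by (rule sum.swap)
    then show ?thesis by (simp add: r_def sum_distrib_right)
  qed
  have "(\<Sum>j<d. r j * t ^ j) = 0" if t: "t \<notin> (if snd X = 0 then {} else {fst X / snd X})" for t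
  proof -
    have "wedge X (t, 1) * K X (t, 1) = 0" using wedge_K[of X "(t, 1)"] by (simp add: F wedge_def)
    moreover have "wedge X (t, 1) \<noteq> 0"
      using t X by (cases X) (auto simp: wedge_def field_simps split: if_splits)
    ultimately show ?thesis by (simp add: K pvec_def)
  qed
  then have "r j = 0" if "j < d" for j
    using sum_power_eq_0[where A = "if snd X = 0 then {} else {fst X / snd X}" and c = r and n = d and i = j] that
    by simp
  then have "K X (cnj_pair X) = 0" by (simp add: K)
  then show False using L_nonzero[OF X] by (simp add: K_cnj_pair_self)
qed

lemma L_affine:
  assumes "ceval q z \<noteq> 0"
  shows "Im (\<phi> z) * (cmod (ceval q z))\<^sup>2 = Im z * L (z, 1)"
proof -
  let ?p = "ceval p z" and ?q = "ceval q z"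
  have "wedge (z, 1) (cnj_pair (z, 1)) * K (z, 1) (cnj_pair (z, 1)) = wedge (F (z, 1)) (cnj_pair (F (z, 1)))"
    unfolding wedge_K F_cnj_pair ..
  then have "(z - cnj z) * of_real (L (z, 1)) = ?p * cnj ?q - cnj ?p * ?q"
    unfolding K_cnj_pair_self F_affine by (simp add: wedge_def cnj_pair_def)
  then have "2 * \<i> * of_real (Im z * L (z, 1)) = ?p * cnj ?q - cnj ?p * ?q"
    by (simp add: complex_diff_cnj mult_ac)
  also have "\<dots> = (\<phi> z - cnj (\<phi> z)) * (?q * cnj ?q)"
    using assms by (simp add: \<phi>_def field_simps)
  also have "\<dots> = 2 * \<i> * of_real (Im (\<phi> z) * (cmod ?q)\<^sup>2)"
    unfolding complex_diff_cnj complex_norm_square[symmetric] by simp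
  finally have "complex_of_real (Im z * L (z, 1)) = of_real (Im (\<phi> z) * (cmod ?q)\<^sup>2)"
    by simp
  then show ?thesis by (simp only: of_real_eq_iff)
qed

lemma q_nonzero:
  assumes "Im z \<noteq> 0"
  shows "ceval q z \<noteq> 0"
proof
  assume q: "ceval q z = 0"
  have "wedge (z, 1) (cnj_pair (z, 1)) * K (z, 1) (cnj_pair (z, 1)) = wedge (F (z, 1)) (cnj_pair (F (z, 1)))"
    unfolding wedge_K F_cnj_pair ..
  then have "(z - cnj z) * of_real (L (z, 1)) = 0"
    unfolding K_cnj_pair_self F_affine by (simp add: wedge_def cnj_pair_def q)
  then show False using assms L_nonzero[of "(z, 1)"] by (simp add: complex_diff_cnj)
qed

lemma Im_\<phi>:
  assumes "Im z \<noteq> 0"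
  shows "Im (\<phi> z) \<noteq> 0"
  using L_affine[OF q_nonzero[OF assms]] L_nonzero[of "(z, 1)"] assms
  by auto

lemma Im_\<phi>_mult:
  assumes "Im z * Im w > 0"
  shows "Im (\<phi> z) * Im (\<phi> w) > 0"
proof -
  have nz: "Im z \<noteq> 0" "Im w \<noteq> 0" using assms by auto
  let ?a = "(cmod (ceval q z))\<^sup>2" and ?b = "(cmod (ceval q w))\<^sup>2"
  have "(Im (\<phi> z) * Im (\<phi> w)) * (?a * ?b) = (Im (\<phi> z) * ?a) * (Im (\<phi> w) * ?b)"
    by simp
  also have "\<dots> = (Im z * Im w) * (L (z, 1) * L (w, 1))"
    unfolding L_affine[OF q_nonzero[OF nz(1)]] L_affine[OF q_nonzero[OF nz(2)]] by simp
  also have "\<dots> > 0" by (intro mult_pos_pos assms L_mult_pos) auto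
  finally have "0 < (Im (\<phi> z) * Im (\<phi> w)) * (?a * ?b)" .
  moreover have "?a * ?b > 0" using q_nonzero nz by simp
  ultimately show ?thesis using zero_less_mult_pos2 by blast
qed

text \<open>For two points of the same half plane at hyperbolic distance \<open>r\<close> this is
  \<open>4 cosh^2 (r / 2)\<close>; it equals 4 when they coincide.\<close>

definition \<delta> :: "complex \<Rightarrow> complex \<Rightarrow> real" where
  "\<delta> z w = (cmod (z - cnj w))\<^sup>2 / (Im z * Im w)"

text \<open>The square root of the numerator of \<open>\<delta>\<close> is transformed by
  \<open>K (z, 1) (cnj_pair (w, 1))\<close> and the denominator by
  \<open>L (z, 1) * L (w, 1)\<close>, up to the same values of \<open>q\<close>;
  \<open>K_strict\<close> compares these factors.\<close>

lemma schwarz_pick: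
  assumes "Im z * Im w > 0" "z \<noteq> w"
  shows "\<delta> (\<phi> z) (\<phi> w) < \<delta> z w"
proof -
  have nz: "Im z \<noteq> 0" "Im w \<noteq> 0" using assms by auto
  let ?q = "\<lambda>z. ceval q z" and ?p = "\<lambda>z. ceval p z"
  have qz: "?q z \<noteq> 0" "?q w \<noteq> 0" using q_nonzero nz by auto
  have zw: "z - cnj w \<noteq> 0"
  proof
    assume "z - cnj w = 0"
    then have "Im z = - Im w" by (simp add: complex_eq_iff)
    then show False using assms(1) by (simp add: not_sum_squares_lt_zero zero_less_mult_iff)
  qed
  have "wedge (z, 1) (cnj_pair (w, 1)) * K (z, 1) (cnj_pair (w, 1)) = wedge (F (z, 1)) (cnj_pair (F (w, 1)))"
    unfolding wedge_K F_cnj_pair ..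
  then have "(z - cnj w) * K (z, 1) (cnj_pair (w, 1)) = ?p z * cnj (?q w) - cnj (?p w) * ?q z"
    unfolding F_affine by (simp add: wedge_def cnj_pair_def)
  also have "\<dots> = (\<phi> z - cnj (\<phi> w)) * (?q z * cnj (?q w))"
    using qz by (simp add: \<phi>_def field_simps)
  finally have "(\<phi> z - cnj (\<phi> w)) * (?q z * cnj (?q w)) = (z - cnj w) * K (z, 1) (cnj_pair (w, 1))" ..
  then have "(cmod ((\<phi> z - cnj (\<phi> w)) * (?q z * cnj (?q w))))\<^sup>2
      = (cmod (z - cnj w))\<^sup>2 * (cmod (K (z, 1) (cnj_pair (w, 1))))\<^sup>2"
    by (simp only: norm_mult power_mult_distrib)
  also have "\<dots> < (cmod (z - cnj w))\<^sup>2 * (L (z, 1) * L (w, 1))"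
    using zw assms(2) by (intro mult_strict_left_mono K_strict) (auto simp: wedge_def)
  finally have *: "(cmod (\<phi> z - cnj (\<phi> w)))\<^sup>2 * ((cmod (?q z))\<^sup>2 * (cmod (?q w))\<^sup>2)
      < (cmod (z - cnj w))\<^sup>2 * (L (z, 1) * L (w, 1))"
    by (simp add: norm_mult power_mult_distrib)
  let ?N = "(cmod (?q z))\<^sup>2 * (cmod (?q w))\<^sup>2"
  have N: "?N > 0" using qz by simp
  have "\<delta> (\<phi> z) (\<phi> w) * (Im z * Im w) * (L (z, 1) * L (w, 1))
      = \<delta> (\<phi> z) (\<phi> w) * ((Im z * L (z, 1)) * (Im w * L (w, 1)))"
    by simp
  also have "\<dots> = \<delta> (\<phi> z) (\<phi> w) * (Im (\<phi> z) * Im (\<phi> w)) * ?N"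
    unfolding L_affine[OF qz(1), symmetric] L_affine[OF qz(2), symmetric] by simp
  also have "\<dots> = (cmod (\<phi> z - cnj (\<phi> w)))\<^sup>2 * ?N"
    using Im_\<phi>[OF nz(1)] Im_\<phi>[OF nz(2)] by (simp add: \<delta>_def)
  also have "\<dots> < \<delta> z w * (Im z * Im w) * (L (z, 1) * L (w, 1))"
    using * nz by (simp add: \<delta>_def)
  finally have "\<delta> (\<phi> z) (\<phi> w) * (Im z * Im w * (L (z, 1) * L (w, 1)))
      < \<delta> z w * (Im z * Im w * (L (z, 1) * L (w, 1)))"
    by (simp add: mult.assoc)
  moreover have "Im z * Im w * (L (z, 1) * L (w, 1)) > 0"
    by (intro mult_pos_pos assms L_mult_pos) auto
  ultimately show ?thesis using mult_less_cancel_right_pos by blast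
qed

text \<open>The points \<open>z\<close> and \<open>\<phi> (\<phi> z)\<close> lie in the same half
  plane even if \<open>\<phi>\<close> exchanges the two, and \<open>k\<close> steps return both of
  them. If they were different, their hyperbolic distance would have shrunk.\<close>

lemma period_divides_two:
  assumes z: "Im z \<noteq> 0" and k: "k \<ge> 1" and per: "(\<phi> ^^ k) z = z"
  shows "\<phi> (\<phi> z) = z"
proof (rule ccontr)
  define w where "w = \<phi> (\<phi> z)"
  assume "\<phi> (\<phi> z) \<noteq> z"
  then have ne: "z \<noteq> w" by (simp add: w_def)
  obtain \<sigma> :: real where s: "\<And>X. X \<noteq> (0, 0) \<Longrightarrow> \<sigma> * L X > 0"
    using L_sign by blast
  \<comment> \<open>The sign \<open>\<sigma>\<close> tells whether \<open>\<phi>\<close> preserves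
    or exchanges the half planes.\<close>
  have sg: "\<sigma> * Im v * Im (\<phi> v) > 0" if "Im v \<noteq> 0" for v
  proof -
    have "(\<sigma> * Im v * Im (\<phi> v)) * (cmod (ceval q v))\<^sup>2 = (Im v)\<^sup>2 * (\<sigma> * L (v, 1))"
      using L_affine[OF q_nonzero[OF that]] by (simp add: power2_eq_square)
    also have "\<dots> > 0" using that by (intro mult_pos_pos[OF _ s]) auto
    finally show ?thesis using q_nonzero[OF that] by (simp add: zero_less_mult_iff)
  qed
  have zw: "Im z * Im w > 0"
  proof -
    have "0 < (\<sigma> * Im z * Im (\<phi> z)) * (\<sigma> * Im (\<phi> z) * Im (\<phi> (\<phi> z)))"
      by (intro mult_pos_pos sg z Im_\<phi>)
    also have "\<dots> = (\<sigma> * Im (\<phi> z))\<^sup>2 * (Im z * Im w)"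
      by (simp add: w_def power2_eq_square)
    finally show ?thesis by (simp add: zero_less_mult_iff)
  qed
  have pos: "Im ((\<phi> ^^ n) z) * Im ((\<phi> ^^ n) w) > 0" for n
    by (induction n) (simp_all add: zw Im_\<phi>_mult)
  define g where "g n = \<delta> ((\<phi> ^^ n) z) ((\<phi> ^^ n) w)" for n
  have le: "\<delta> (\<phi> a) (\<phi> b) \<le> \<delta> a b" if ab: "Im a * Im b > 0" for a b
  proof (cases "a = b")
    case True
    have "\<delta> c c = 4" if "Im c \<noteq> 0" for c
      using that by (simp add: \<delta>_def complex_diff_cnj norm_mult power_mult_distrib power2_eq_square)
    moreover have "Im b \<noteq> 0" using ab by auto
    ultimately show ?thesis using True Im_\<phi>[of b] by simp
  next
    case False
    then show ?thesis using schwarz_pick[OF ab] by simp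
  qed
  have "g k < g 0"
    by (rule strict_descent[OF _ _ k]) (simp_all add: g_def schwarz_pick[OF zw ne] le pos)
  moreover have "(\<phi> ^^ k) w = w"
  proof -
    have "(\<phi> ^^ k) w = \<phi> (\<phi> ((\<phi> ^^ k) z))" unfolding w_def
      by (metis funpow_swap1)
    then show ?thesis by (simp add: per w_def)
  qed
  ultimately show False by (simp add: g_def per)
qed

text \<open>Cauchy-Schwarz between a nonreal point and the fixed vector. It says that
  \<open>|z b - a|^2 / |Im z|\<close> decreases under \<open>\<phi>\<close>; the sublevel sets of
  this function are the horodisks at the fixed point \<open>a / b\<close>, with infinity included as
  \<open>b = 0\<close>. The absolute values allow the half planes to be exchanged.\<close>

lemma julia:
  assumes E: "(a, b) \<noteq> (0, 0 :: real)"
    and F: "F (a, b) = (\<kappa> * a, \<kappa> * b)" and le: "\<bar>K (a, b) (a, b)\<bar> \<le> \<kappa>\<^sup>2"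
    and z: "Im z \<noteq> 0"
  shows "\<bar>Im z\<bar> * (cmod (\<phi> z * of_real b - of_real a))\<^sup>2
    < \<bar>Im (\<phi> z)\<bar> * (cmod (z * of_real b - of_real a))\<^sup>2"
proof -
  let ?E = "(of_real a, of_real b) :: complex \<times> complex"
  let ?q = "ceval q z"
  have E0: "?E \<noteq> (0, 0)" using E by auto
  have cE: "cnj_pair ?E = ?E" by (simp add: cnj_pair_def)
  have FE: "F ?E = (of_real \<kappa> * of_real a, of_real \<kappa> * of_real b)"
    using F by (simp add: form_pair_def hform_of_real)
  have LE: "L ?E = K (a, b) (a, b)"
    using K_cnj_pair_self[of ?E] unfolding cE kernel_of_real by simp
  have o: "wedge (z, 1) ?E \<noteq> 0"
  proof
    assume "wedge (z, 1) ?E = 0"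
    then have *: "z * of_real b = of_real a" by (simp add: wedge_def)
    then have "Im (z * of_real b) = 0" by simp
    then have "b = 0" using z by simp
    then show False using * E by simp
  qed
  have q: "?q \<noteq> 0" by (rule q_nonzero[OF z])
  have "wedge (z, 1) ?E * K (z, 1) ?E = of_real \<kappa> * ?q * (\<phi> z * of_real b - of_real a)"
    unfolding wedge_K FE F_affine using q by (simp add: wedge_def \<phi>_def field_simps)
  then have "(cmod (of_real \<kappa> * ?q * (\<phi> z * of_real b - of_real a)))\<^sup>2
      = (cmod (wedge (z, 1) ?E))\<^sup>2 * (cmod (K (z, 1) (cnj_pair ?E)))\<^sup>2"
    unfolding cE by (metis norm_mult power_mult_distrib)
  also have "\<dots> < (cmod (wedge (z, 1) ?E))\<^sup>2 * (L (z, 1) * L ?E)"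
    using o by (intro mult_strict_left_mono K_strict o) simp
  also have "L (z, 1) * L ?E = \<bar>L (z, 1)\<bar> * \<bar>L ?E\<bar>"
    using L_mult_pos[of "(z, 1)" ?E] E0 by (simp add: abs_mult[symmetric])
  also have "(cmod (wedge (z, 1) ?E))\<^sup>2 * (\<bar>L (z, 1)\<bar> * \<bar>L ?E\<bar>)
      \<le> (cmod (wedge (z, 1) ?E))\<^sup>2 * (\<bar>L (z, 1)\<bar> * \<kappa>\<^sup>2)"
    using le unfolding LE by (intro mult_left_mono) auto
  finally have *: "\<kappa>\<^sup>2 * ((cmod ?q)\<^sup>2 * (cmod (\<phi> z * of_real b - of_real a))\<^sup>2)
      < \<kappa>\<^sup>2 * ((cmod (z * of_real b - of_real a))\<^sup>2 * \<bar>L (z, 1)\<bar>)"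
    by (simp add: wedge_def norm_mult power_mult_distrib mult_ac)
  then have "\<kappa>\<^sup>2 > 0" by (cases "\<kappa> = 0") auto
  then have "(cmod ?q)\<^sup>2 * (cmod (\<phi> z * of_real b - of_real a))\<^sup>2
      < (cmod (z * of_real b - of_real a))\<^sup>2 * \<bar>L (z, 1)\<bar>"
    using * by simp
  then have "\<bar>Im z\<bar> * ((cmod ?q)\<^sup>2 * (cmod (\<phi> z * of_real b - of_real a))\<^sup>2)
      < \<bar>Im z\<bar> * ((cmod (z * of_real b - of_real a))\<^sup>2 * \<bar>L (z, 1)\<bar>)"
    using z by (intro mult_strict_left_mono) auto
  also have "\<dots> = \<bar>Im z * L (z, 1)\<bar> * (cmod (z * of_real b - of_real a))\<^sup>2"
    by (simp add: abs_mult)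
  also have "\<bar>Im z * L (z, 1)\<bar> = \<bar>Im (\<phi> z)\<bar> * (cmod ?q)\<^sup>2"
    unfolding L_affine[OF q, symmetric] by (simp add: abs_mult)
  finally have "(cmod ?q)\<^sup>2 * (\<bar>Im z\<bar> * (cmod (\<phi> z * of_real b - of_real a))\<^sup>2)
      < (cmod ?q)\<^sup>2 * (\<bar>Im (\<phi> z)\<bar> * (cmod (z * of_real b - of_real a))\<^sup>2)"
    by (simp add: mult_ac)
  then show ?thesis using q by simp
qed

lemma no_nonreal_periodic:
  assumes E: "(a, b) \<noteq> (0, 0 :: real)"
    and F: "F (a, b) = (\<kappa> * a, \<kappa> * b)" and le: "\<bar>K (a, b) (a, b)\<bar> \<le> \<kappa>\<^sup>2"
    and z: "Im z \<noteq> 0" and k: "k \<ge> 1"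
  shows "(\<phi> ^^ k) z \<noteq> z"
proof
  assume per: "(\<phi> ^^ k) z = z"
  have im: "Im ((\<phi> ^^ n) z) \<noteq> 0" for n
    by (induction n) (simp_all add: z Im_\<phi>)
  define h where "h z = (cmod (z * of_real b - of_real a))\<^sup>2 / \<bar>Im z\<bar>" for z
  have h: "h (\<phi> v) < h v" if "Im v \<noteq> 0" for v
    using julia[OF E F le that] that Im_\<phi>[OF that] unfolding h_def by (simp add: field_simps)
  have "h ((\<phi> ^^ k) z) < h ((\<phi> ^^ 0) z)"
    by (rule strict_descent[OF _ _ k]) (simp_all add: h z im less_imp_le)
  then show False by (simp add: per)
qed

text \<open>Cauchy-Schwarz between \<open>z\<close> and its conjugate, whose mixed term is the
  diagonal value \<open>K (z, 1) (z, 1)\<close>. Nonreal fixed points are therefore attracting and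
  never indifferent.\<close>

lemma nonreal_fixed_multiplier:
  assumes z: "Im z \<noteq> 0" and fp: "\<phi> z = z"
  shows "cmod (ceval (pderiv p) z * ceval q z - ceval p z * ceval (pderiv q) z)
    < (cmod (ceval q z))\<^sup>2"
proof -
  have L: "L (z, 1) = (cmod (ceval q z))\<^sup>2"
    using L_affine[OF q_nonzero[OF z]] z by (simp add: fp)
  have "K (cnj_pair (z, 1)) (cnj_pair (cnj_pair (z, 1))) = K (z, 1) (cnj_pair (z, 1))"
    by (simp add: cnj_pair_def kernel_commute)
  then have L': "L (cnj_pair (z, 1)) = L (z, 1)" by (simp add: L_def)
  have "wedge (z, 1) (cnj_pair (z, 1)) \<noteq> 0" using z by (simp add: wedge_def cnj_pair_def complex_diff_cnj)
  from K_strict[OF this] have "(cmod (K (z, 1) (z, 1)))\<^sup>2 < ((cmod (ceval q z))\<^sup>2)\<^sup>2"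
    unfolding L' L by (simp add: cnj_pair_def power2_eq_square)
  then have "cmod (K (z, 1) (z, 1)) < (cmod (ceval q z))\<^sup>2"
    by (rule power_less_imp_less_base) simp
  moreover have "pderiv (map_poly of_real r) = map_poly complex_of_real (pderiv r)" for r
    by (rule poly_eqI) (simp add: coeff_pderiv coeff_map_poly)
  ultimately show ?thesis by (simp add: kernel_diag deg_p deg_q cpoly_def)
qed

lemma K_strict_real:
  assumes "wedge X Y \<noteq> (0::real)"
  shows "(K X Y)\<^sup>2 < K X X * K Y Y"
proof -
  obtain x y u v where XY: "X = (x, y)" "Y = (u, v)" by (cases X, cases Y)
  let ?X = "(of_real x, of_real y) :: complex \<times> complex" and ?Y = "(of_real u, of_real v) :: complex \<times> complex"
  have cnj_pair: "cnj_pair ?X = ?X" "cnj_pair ?Y = ?Y" by (simp_all add: cnj_pair_def)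
  have "wedge ?X ?Y = of_real (wedge X Y)" by (simp add: wedge_def XY)
  then have "wedge ?X ?Y \<noteq> 0" using assms by simp
  from K_strict[OF this] show ?thesis
    unfolding L_def cnj_pair kernel_of_real by (simp add: XY)
qed

lemma F_nonzero_real:
  assumes "(x, y) \<noteq> (0, 0 :: real)"
  shows "F (x, y) \<noteq> (0, 0)"
  using F_nonzero[of "(of_real x, of_real y)"] assms
  by (auto simp: form_pair_def hform_of_real)

end

section \<open>Real fibered functions and definite Bezoutians\<close>

lemma coeff_cpoly [simp]: "coeff (cpoly p) n = of_real (coeff p n)"
  by (simp add: cpoly_def coeff_map_poly)

lemma degree_cpoly [simp]: "degree (cpoly p) = degree p"
  by (simp add: cpoly_def degree_map_poly)

lemma cpoly_eq_0_iff [simp]: "cpoly p = 0 \<longleftrightarrow> p = 0"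
  by (simp add: poly_eq_iff)

lemma cpoly_mult [simp]: "cpoly (p * q) = cpoly p * cpoly q"
  by (rule poly_eqI) (simp add: coeff_mult)

lemma cpoly_add [simp]: "cpoly (p + q) = cpoly p + cpoly q"
  by (rule poly_eqI) simp

lemma cpoly_diff [simp]: "cpoly (p - q) = cpoly p - cpoly q"
  by (rule poly_eqI) simp

lemma cpoly_uminus [simp]: "cpoly (- p) = - cpoly p"
  by (rule poly_eqI) simp

lemma cpoly_smult [simp]: "cpoly (smult c p) = smult (of_real c) (cpoly p)"
  by (rule poly_eqI) simp

lemma cpoly_pCons [simp]: "cpoly (pCons a p) = pCons (of_real a) (cpoly p)"
  by (rule poly_eqI) (simp add: coeff_pCons split: nat.split)

lemma cpoly_0 [simp]: "cpoly 0 = 0"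
  by simp

lemma cpoly_1 [simp]: "cpoly 1 = 1"
  by (rule poly_eqI) simp

lemma cpoly_power [simp]: "cpoly (p ^ n) = cpoly p ^ n"
  by (induction n) simp_all

lemma cpoly_sum [simp]: "cpoly (sum f A) = (\<Sum>x\<in>A. cpoly (f x))"
  by (induction A rule: infinite_finite_induct) simp_all

lemma cpoly_pderiv: "cpoly (pderiv p) = pderiv (cpoly p)"
  by (rule poly_eqI) (simp add: coeff_pderiv)

lemma poly_cpoly_of_real: "ceval p (of_real x) = of_real (poly p x)"
  by (simp add: poly_altdef)

lemma poly_cpoly_cnj: "ceval p (cnj z) = cnj (ceval p z)"
  by (simp add: poly_altdef)

lemma coprime_no_common_root:
  assumes "coprime p (q :: real poly)"
  shows "ceval p z \<noteq> 0 \<or> ceval q z \<noteq> 0"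
proof (rule ccontr)
  assume *: "\<not> ?thesis"
  obtain a b where "a * p + b * q = 1"
    using bezout_coefficients_fst_snd[of p q] assms by auto
  then have "ceval (a * p + b * q) z = 1" by simp
  then show False using * by simp
qed

text \<open>If the derivative of \<open>p / q\<close> vanished, coprimality would make each of the
  two polynomials divide its own derivative.\<close>

lemma wronskian_nonzero:
  fixes p q :: "real poly"
  assumes co: "coprime p q" and deg: "degree p > 0 \<or> degree q > 0"
  shows "pderiv p * q - p * pderiv q \<noteq> 0"
proof
  assume "pderiv p * q - p * pderiv q = 0"
  then have eq: "pderiv p * q = p * pderiv q" by simp
  have *: "degree b = 0" if "coprime a b" "a * pderiv b = pderiv a * b" for a b :: "real poly"
  proof (rule ccontr)
    assume b: "degree b \<noteq> 0"
    have "b dvd a * pderiv b" using that(2) by simp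
    then have "b dvd pderiv b"
      using that(1) by (simp add: coprime_dvd_mult_right_iff coprime_commute)
    moreover have "pderiv b \<noteq> 0" using b by (simp add: pderiv_eq_0_iff)
    ultimately have "degree b \<le> degree (pderiv b)" by (rule dvd_imp_degree_le)
    then show False using b by (simp add: degree_pderiv)
  qed
  have "degree q = 0" using *[OF co] eq by simp
  moreover have "degree p = 0" using *[of q p] co eq by (simp add: coprime_commute mult.commute)
  ultimately show False using deg by simp
qed

section \<open>Lagrange interpolation on a real fibre\<close>

definition root_prod :: "'a::comm_ring_1 set \<Rightarrow> 'a poly" where
  "root_prod S = (\<Prod>s\<in>S. [:- s, 1:])"

lemma poly_root_prod: "poly (root_prod S) x = (\<Prod>s\<in>S. x - s)"
  by (simp add: root_prod_def poly_prod)

lemma degree_root_prod: "finite S \<Longrightarrow> degree (root_prod (S :: 'a::field set)) = card S"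
  unfolding root_prod_def by (subst degree_prod_sum_eq) auto

lemma lead_coeff_root_prod: "lead_coeff (root_prod (S :: 'a::field set)) = 1"
  unfolding root_prod_def by (simp add: lead_coeff_prod)

lemma poly_root_prod_remove:
  assumes "finite S" "s \<in> S"
  shows "poly (root_prod S) x = (x - s) * poly (root_prod (S - {s})) x"
  unfolding poly_root_prod by (rule prod.remove[OF assms])

lemma poly_root_prod_nonzero:
  assumes "finite S"
  shows "poly (root_prod (S - {s})) s \<noteq> (0 :: 'a::field)"
  unfolding poly_root_prod using assms by simp

lemma lagrange_interpolation:
  fixes S :: "'a::field set"
  assumes S: "finite S" and g: "degree g < card S"
  shows "g = (\<Sum>s\<in>S. smult (poly g s / poly (root_prod (S - {s})) s) (root_prod (S - {s})))"
    (is "g = ?h")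
proof (rule poly_eqI_degree[of S])
  show "degree ?h < card S"
  proof (rule le_less_trans[OF degree_sum_le[of S _ "card S - 1"]])
    show "card S - 1 < card S" using g by simp
  qed (use S in \<open>auto simp: degree_root_prod intro: order_trans[OF degree_smult_le]\<close>)
  fix x assume x: "x \<in> S"
  have "poly ?h x = (\<Sum>s\<in>S. if s = x then poly g x else 0)"
    unfolding poly_sum
  proof (rule sum.cong[OF refl])
    fix s assume s: "s \<in> S"
    show "poly (smult (poly g s / poly (root_prod (S - {s})) s) (root_prod (S - {s}))) x
      = (if s = x then poly g x else 0)"
    proof (cases "s = x")
      case True
      then show ?thesis using poly_root_prod_nonzero[OF S, of s] by simp
    next
      case False
      then have "poly (root_prod (S - {s})) x = 0"
        unfolding poly_root_prod using S x by (intro prod_zero) auto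
      then show ?thesis using False by simp
    qed
  qed
  then show "poly g x = poly ?h x" using S x by simp
qed (rule g)

lemma real_simple_roots:
  fixes u :: "real poly"
  assumes u: "u \<noteq> 0"
    and real: "\<And>z. ceval u z = 0 \<Longrightarrow> Im z = 0"
    and simple: "\<And>x. poly u x = 0 \<Longrightarrow> poly (pderiv u) x \<noteq> 0"
  defines "S \<equiv> {x. poly u x = 0}"
  shows "finite S" and "card S = degree u" and "u = smult (lead_coeff u) (root_prod S)"
proof -
  show fin: "finite S" unfolding S_def using u by (rule poly_roots_finite)
  have Z: "{z. ceval u z = 0} = of_real ` S"
  proof (intro equalityI subsetI)
    fix z assume "z \<in> {z. ceval u z = 0}"
    then have z: "ceval u z = 0" by simp
    then have "z = of_real (Re z)" using real[OF z] by (simp add: complex_eq_iff)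
    then have "poly u (Re z) = 0" using z by (metis of_real_eq_0_iff poly_cpoly_of_real)
    then show "z \<in> of_real ` S" using \<open>z = of_real (Re z)\<close> by (auto simp: S_def)
  qed (auto simp: S_def poly_cpoly_of_real)
  have "rsquarefree (cpoly u)"
    unfolding rsquarefree_roots
  proof (intro allI notI, elim conjE)
    fix a assume a: "ceval u a = 0" "poly (pderiv (cpoly u)) a = 0"
    then obtain s where s: "a = of_real s" "s \<in> S" using Z by blast
    then have "poly (pderiv u) s = 0"
      using a(2) by (simp add: poly_cpoly_of_real flip: cpoly_pderiv)
    then show False using simple[of s] s by (simp add: S_def)
  qed
  then have "cpoly u = smult (lead_coeff (cpoly u)) (root_prod (of_real ` S))"
    unfolding root_prod_def Z[symmetric] by (rule complex_poly_decompose_rsquarefree[symmetric])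
  then have "degree (cpoly u) = degree (smult (lead_coeff (cpoly u)) (root_prod (of_real ` S)))"
    by simp
  also have "\<dots> = card (of_real ` S :: complex set)" using u fin by (simp add: degree_root_prod)
  also have "\<dots> = card S" by (intro card_image) (simp add: inj_on_def)
  finally show card: "card S = degree u" by simp
  show "u = smult (lead_coeff u) (root_prod S)"
  proof (rule poly_eqI_degree_lead_coeff[of _ "card S" _ S])
    show "coeff u (card S) = coeff (smult (lead_coeff u) (root_prod S)) (card S)"
      using lead_coeff_root_prod[of S] by (simp add: card degree_root_prod fin)
    fix z assume "z \<in> S"
    then show "poly u z = poly (smult (lead_coeff u) (root_prod S)) z"
      using fin by (auto simp: S_def poly_root_prod)
  qed (auto simp: card degree_root_prod fin u)
qed

text \<open>The roots of \<open>u\<close> form the fibre of \<open>p / q\<close> over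
  \<open>t\<close>. If it consists of \<open>d\<close> distinct real points, their Lagrange
  polynomials diagonalize the Bezoutian.\<close>

lemma bez_lagrange:
  fixes p q u :: "real poly"
  assumes p: "degree p \<le> d" and q: "degree q \<le> d"
    and u: "u = p - smult t q" and deg: "degree u = d" and d: "d > 0"
    and real: "\<And>z. ceval u z = 0 \<Longrightarrow> Im z = 0"
    and simple: "\<And>x. poly u x = 0 \<Longrightarrow> poly (pderiv u) x \<noteq> 0"
  defines "S \<equiv> {x. poly u x = 0}"
  shows "bilin d (bez p q) a a
    = (\<Sum>s\<in>S. lead_coeff u * poly q s / poly (root_prod (S - {s})) s
        * (\<Sum>k<d. coeff (root_prod (S - {s})) k * a k)\<^sup>2)"
proof -
  have u0: "u \<noteq> 0" using deg d by auto
  note S = real_simple_roots[OF u0 real simple, folded S_def]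
  define c where "c = lead_coeff u"
  define w where "w s = root_prod (S - {s})" for s
  \<comment> \<open>Passing from \<open>(p, q)\<close> to \<open>(u, g)\<close> is a unimodular
    change and keeps the Bezoutian. It also keeps the values of \<open>q\<close> on the roots and
    brings the degree below the number of nodes.\<close>
  define g where "g = q - smult (coeff q d / c) u"
  have c0: "c \<noteq> 0" using u0 by (simp add: c_def)
  have dw: "degree (w s) < d" if "s \<in> S" for s
    using that S(1,2) deg d by (simp add: w_def degree_root_prod)
  have "degree g \<le> d" unfolding g_def using q deg
    by (intro degree_diff_le) (auto intro: order_trans[OF degree_smult_le])
  moreover have "coeff g d = 0" using c0 by (simp add: g_def c_def deg)
  ultimately have dg: "degree g < d" using d
    by (metis degree_0 le_neq_implies_less leading_coeff_0_iff)
  have "poly g s = poly q s" if "s \<in> S" for s using that by (simp add: g_def S_def)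
  then have G: "poly g x = (\<Sum>s\<in>S. poly q s / poly (w s) s * poly (w s) x)" for x
    using lagrange_interpolation[OF S(1), of g] dg S(2) deg
    by (subst lagrange_interpolation[OF S(1), of g]) (auto simp: poly_sum w_def intro!: sum.cong)
  have U: "poly u x = c * (x - s) * poly (w s) x" if "s \<in> S" for s x
  proof -
    have "poly u x = poly (smult (lead_coeff u) (root_prod S)) x"
      by (rule arg_cong[OF S(3)])
    then show ?thesis
      by (simp only: poly_smult poly_root_prod_remove[OF S(1) that] w_def c_def mult.assoc)
  qed
  have "poly p x * poly q y - poly p y * poly q x
      = (x - y) * (\<Sum>s\<in>S. (c * poly q s / poly (w s) s) * poly (w s) x * poly (w s) y)" for x y
  proof -
    have P: "poly p v = poly u v + t * poly q v" for v by (simp add: u)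
    have Q: "poly g v = poly q v - coeff q d / c * poly u v" for v by (simp add: g_def)
    have "poly p x * poly q y - poly p y * poly q x = poly u x * poly g y - poly u y * poly g x"
      unfolding P Q by (simp add: algebra_simps)
    also have "\<dots> = (\<Sum>s\<in>S. poly q s / poly (w s) s * (poly u x * poly (w s) y - poly u y * poly (w s) x))"
      unfolding G by (simp add: sum_distrib_left sum_subtractf right_diff_distrib mult_ac)
    also have "\<dots> = (\<Sum>s\<in>S. (x - y) * ((c * poly q s / poly (w s) s) * poly (w s) x * poly (w s) y))"
      by (intro sum.cong refl) (simp add: U divide_inverse algebra_simps)
    finally show ?thesis by (simp add: sum_distrib_left)
  qed
  from bez_sum_of_squares[OF p q dw this] show ?thesis
    by (simp add: w_def c_def)
qed

lemma connected_same_sign: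
  fixes g :: "'a::topological_space \<Rightarrow> real"
  assumes "connected A" "continuous_on A g" "\<And>x. x \<in> A \<Longrightarrow> g x \<noteq> 0"
  obtains \<sigma> :: real where "\<sigma> = 1 \<or> \<sigma> = - 1" "\<And>x. x \<in> A \<Longrightarrow> \<sigma> * g x > 0"
proof (rule ccontr)
  assume no: "\<not> thesis"
  have "\<not> (\<forall>x\<in>A. g x > 0)" "\<not> (\<forall>x\<in>A. - g x > 0)"
    using no that[of 1] that[of "-1"] by auto
  then obtain x y where xy: "x \<in> A" "g x < 0" "y \<in> A" "g y > 0"
    using assms(3) by (metis neg_0_less_iff_less not_less_iff_gr_or_eq)
  have "connected (g ` A)" by (rule connected_continuous_image[OF assms(2,1)])
  then have "0 \<in> g ` A" using xy unfolding connected_iff_interval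
    by (meson imageI less_imp_le)
  then show False using assms(3) by auto
qed

text \<open>The imaginary part of \<open>p / q\<close> has constant sign on the upper half plane. In
  the limit this fixes the sign of the kernel on the real diagonal, and at the points of a generic
  fibre the diagonal values are the Lagrange weights up to squares.\<close>

lemma definite_if_nonreal_preserved:
  fixes p q :: "real poly"
  assumes co: "coprime p q" and d: "d = max (degree p) (degree q)" "d > 0"
    and nr: "\<And>z. Im z \<noteq> 0 \<Longrightarrow> ceval q z \<noteq> 0 \<and> Im (ceval p z / ceval q z) \<noteq> 0"
  shows "definite d (bez p q)"
proof -
  have p: "degree p \<le> d" and q: "degree q \<le> d" using d by auto
  define g where "g z = Im (ceval p z * cnj (ceval q z))" for z
  have g: "g z \<noteq> 0" if "Im z > 0" for z
  proof -
    let ?p = "ceval p z" and ?q = "ceval q z"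
    have "?q \<noteq> 0" "Im (?p / ?q) \<noteq> 0" using nr[of z] that by auto
    moreover define r where "r = (cmod ?q)\<^sup>2"
    moreover define v where "v = ?p / ?q"
    moreover have "?p * cnj ?q = of_real r * v"
      using \<open>?q \<noteq> 0\<close> unfolding r_def v_def complex_norm_square by simp
    then have "g z = r * Im v"
      by (simp add: g_def)
    ultimately show ?thesis by simp
  qed
  have "connected {z. Im z > 0}"
    by (intro convex_connected convex_halfspace_Im_gt)
  moreover have "continuous_on {z. Im z > 0} g"
    unfolding g_def by (intro continuous_intros)
  ultimately obtain \<sigma> :: real where s1: "\<sigma> = 1 \<or> \<sigma> = - 1" and s: "\<And>z. Im z > 0 \<Longrightarrow> \<sigma> * g z > 0"
    using g by (rule connected_same_sign) auto
  \<comment> \<open>The kernel at \<open>z\<close> and its conjugate is \<open>g z / Im z\<close>,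
    which has the sign \<open>\<sigma>\<close>; then \<open>z\<close> tends to \<open>s\<close>
    vertically.\<close>
  have diag: "\<sigma> * kernel d p q (s, 1) (s, 1) \<ge> 0" for s :: real
  proof -
    define k where "k e = Re (kernel d p q (Complex s e, 1) (cnj (Complex s e), 1))" for e
    have pos: "\<sigma> * k e \<ge> 0" if "e > 0" for e
    proof -
      let ?z = "Complex s e"
      let ?p = "ceval p ?z" and ?q = "ceval q ?z"
      have "(?z - cnj ?z) * kernel d p q (?z, 1) (cnj ?z, 1) = ?p * cnj ?q - cnj (?p * cnj ?q)"
        using wedge_kernel[OF p q, of "(?z, 1)" "(cnj ?z, 1)"]
        by (simp add: wedge_def form_pair_def hform_affine_complex p q poly_cpoly_cnj)
      then have "2 * \<i> * (of_real e * kernel d p q (?z, 1) (cnj ?z, 1)) = 2 * \<i> * of_real (g ?z)"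
        by (simp only: complex_diff_cnj complex.sel g_def of_real_mult mult.assoc of_real_numeral)
          (simp add: mult_ac)
      then have "of_real e * kernel d p q (?z, 1) (cnj ?z, 1) = of_real (g ?z)" by simp
      then have "Re (of_real e * kernel d p q (?z, 1) (cnj ?z, 1)) = g ?z" by simp
      then have "e * (\<sigma> * k e) = \<sigma> * g ?z" by (simp add: k_def mult_ac)
      moreover have "0 < \<sigma> * g ?z" using s[of ?z] that by simp
      ultimately have "0 < e * (\<sigma> * k e)" by (simp only:)
      then have "0 < \<sigma> * k e" using that by (rule zero_less_mult_pos)
      then show ?thesis by simp
    qed
    have "continuous_on UNIV k"
      unfolding k_def kernel_affine Complex_eq by (intro continuous_intros)
    then have "isCont k 0" by (simp add: continuous_on_eq_continuous_at)
    then have "(k \<longlongrightarrow> k 0) (at_right 0)"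
      unfolding isCont_def by (rule tendsto_mono[OF at_le[OF subset_UNIV]])
    then have "((\<lambda>e. \<sigma> * k e) \<longlongrightarrow> \<sigma> * k 0) (at_right 0)"
      by (rule tendsto_mult_left)
    moreover have "eventually (\<lambda>e. 0 \<le> \<sigma> * k e) (at_right 0)"
      by (rule eventually_mono[OF eventually_at_right_less[of 0]]) (rule pos)
    ultimately have "\<sigma> * k 0 \<ge> 0"
      by (intro tendsto_lowerbound[where F = "at_right (0::real)"]) auto
    moreover have "k 0 = kernel d p q (s, 1) (s, 1)"
      using kernel_of_real[of d p q s 1 s 1, where 'a = complex] by (simp add: k_def Complex_eq)
    ultimately show ?thesis by simp
  qed
  let ?W = "pderiv p * q - p * pderiv q"
  have W: "?W \<noteq> 0" using co d by (intro wronskian_nonzero) auto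
  \<comment> \<open>Avoiding the value at infinity and the critical values leaves a \<open>t\<close>
    with \<open>d\<close> distinct points in its fibre. Where a denominator vanishes the quotient is
    0 by convention, which only excludes one more value.\<close>
  have "finite (insert (coeff p d / coeff q d) ((\<lambda>x. poly p x / poly q x) ` {x. poly ?W x = 0}))"
    using poly_roots_finite[OF W] by simp
  then obtain t where t: "t \<notin> insert (coeff p d / coeff q d) ((\<lambda>x. poly p x / poly q x) ` {x. poly ?W x = 0})"
    using ex_new_if_finite[OF infinite_UNIV_char_0] by blast
  define u where "u = p - smult t q"
  have nc: "poly p x \<noteq> 0 \<or> poly q x \<noteq> 0" for x
    using coprime_no_common_root[OF co, of "of_real x"] by (simp add: poly_cpoly_of_real)
  have uq: "poly q x \<noteq> 0" if "poly u x = 0" for x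
    using that nc[of x] by (auto simp: u_def)
  have "coeff u d \<noteq> 0"
  proof (cases "coeff q d = 0")
    case True
    then have "degree q \<noteq> d" using d(2) by (metis leading_coeff_0_iff degree_0 less_irrefl)
    then have "degree p = d" using d by linarith
    then have "coeff p d \<noteq> 0" using d(2) by (metis leading_coeff_0_iff degree_0 less_irrefl)
    then show ?thesis using True by (simp add: u_def)
  next
    case False
    then show ?thesis using t by (auto simp: u_def field_simps)
  qed
  moreover have "degree u \<le> d" unfolding u_def
    by (intro degree_diff_le p) (use q in \<open>auto intro: order_trans[OF degree_smult_le]\<close>)
  ultimately have du: "degree u = d" by (simp add: le_antisym le_degree)
  have real: "Im z = 0" if "ceval u z = 0" for z
  proof (rule ccontr)
    assume z: "Im z \<noteq> 0"
    then have "ceval q z \<noteq> 0" using nr by blast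
    then have "ceval p z / ceval q z = of_real t"
      using that by (simp add: u_def field_simps)
    then show False using nr[OF z] by simp
  qed
  have simple: "poly (pderiv u) x \<noteq> 0" if x: "poly u x = 0" for x
  proof
    assume "poly (pderiv u) x = 0"
    then have "poly ?W x = 0" using x by (simp add: u_def pderiv_diff pderiv_smult)
    moreover have "t = poly p x / poly q x" using x uq[OF x] by (simp add: u_def field_simps)
    ultimately show False using t by auto
  qed
  define S where "S = {x. poly u x = 0}"
  define w where "w s = root_prod (S - {s})" for s
  define m where "m s = lead_coeff u * poly q s / poly (w s) s" for s
  have u0: "u \<noteq> 0" using du d by auto
  note S = real_simple_roots[OF u0 real simple, folded S_def]
  note B = bez_lagrange[OF p q u_def du d(2) real simple, folded S_def, folded w_def, folded m_def]
  have ws: "poly (w s) s \<noteq> 0" for s unfolding w_def by (rule poly_root_prod_nonzero[OF S(1)])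
  have dw: "degree (w s) < d" if "s \<in> S" for s
    using that S(1,2) du d by (simp add: w_def degree_root_prod)
  have wv: "(\<Sum>k<d. coeff (w s) k * x ^ k) = poly (w s) x" if "s \<in> S" for s x
    unfolding poly_altdef using dw[OF that] by (intro sum.mono_neutral_right) (auto simp: coeff_eq_0)
  \<comment> \<open>At \<open>s\<close> all Lagrange polynomials except that of \<open>s\<close>
    vanish, so the diagonal value is the weight \<open>m s\<close> times a square.\<close>
  have m: "\<sigma> * m s > 0" if s: "s \<in> S" for s
  proof -
    have "pvec d (s, 1) = (\<lambda>k. s ^ k)" by (simp add: pvec_def fun_eq_iff)
    then have "kernel d p q (s, 1) (s, 1) = (\<Sum>r\<in>S. m r * (poly (w r) s)\<^sup>2)"
      unfolding kernel_def by (simp add: B wv cong: sum.cong)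
    also have "\<dots> = (\<Sum>r\<in>S. if r = s then m s * (poly (w s) s)\<^sup>2 else 0)"
    proof (rule sum.cong[OF refl])
      fix r assume "r \<in> S"
      show "m r * (poly (w r) s)\<^sup>2 = (if r = s then m s * (poly (w s) s)\<^sup>2 else 0)"
        using s S(1) by (auto simp: w_def poly_root_prod)
    qed
    also have "\<dots> = m s * (poly (w s) s)\<^sup>2" using s S(1) by simp
    finally have "\<sigma> * m s * (poly (w s) s)\<^sup>2 \<ge> 0" using diag[of s] by (simp add: mult.assoc)
    then have "\<sigma> * m s \<ge> 0" using ws[of s] by (simp add: zero_le_mult_iff)
    moreover have "m s \<noteq> 0" using ws[of s] u0 uq[of s] s by (simp add: m_def S_def)
    ultimately show ?thesis using s1 by auto
  qed
  have "pos_def d (\<lambda>i j. \<sigma> * bez p q i j)"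
    unfolding pos_def_def
  proof (intro allI impI)
    fix a :: "nat \<Rightarrow> real" assume "\<exists>i<d. a i \<noteq> 0"
    then obtain k where k: "k < d" "a k \<noteq> 0" by blast
    have B': "bilin d (\<lambda>i j. \<sigma> * bez p q i j) a a = (\<Sum>s\<in>S. \<sigma> * m s * (\<Sum>j<d. coeff (w s) j * a j)\<^sup>2)"
      by (simp add: bilin_scale B sum_distrib_left mult_ac)
    \<comment> \<open>Otherwise the expansion of \<open>monom 1 k\<close> in the Lagrange basis
      would give \<open>a k = 0\<close>.\<close>
    have "\<exists>s\<in>S. (\<Sum>j<d. coeff (w s) j * a j) \<noteq> 0"
    proof (rule ccontr)
      assume no: "\<not> ?thesis"
      let ?g = "monom 1 k :: real poly"
      define c where "c s = poly ?g s / poly (w s) s" for s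
      have "?g = (\<Sum>s\<in>S. smult (c s) (w s))"
        unfolding c_def w_def using k S du
        by (intro lagrange_interpolation) (auto simp: degree_monom_eq)
      then have "coeff ?g j = (\<Sum>s\<in>S. c s * coeff (w s) j)" for j
        by (simp add: coeff_sum)
      then have "(\<Sum>j<d. coeff ?g j * a j) = (\<Sum>j<d. \<Sum>s\<in>S. c s * (coeff (w s) j * a j))"
        by (simp only: sum_distrib_right mult.assoc)
      also have "\<dots> = (\<Sum>s\<in>S. c s * (\<Sum>j<d. coeff (w s) j * a j))"
        by (subst sum.swap) (simp add: sum_distrib_left)
      also have "\<dots> = 0" using no by (intro sum.neutral) auto
      finally show False using k by (simp add: if_distrib if_distribR cong: if_cong)
    qed
    then obtain s where s: "s \<in> S" "(\<Sum>j<d. coeff (w s) j * a j) \<noteq> 0" by blast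
    have "0 < \<sigma> * m s * (\<Sum>j<d. coeff (w s) j * a j)\<^sup>2"
      by (rule mult_pos_pos[OF m[OF s(1)]]) (use s(2) in simp)
    moreover have "0 \<le> \<sigma> * m r * (\<Sum>j<d. coeff (w r) j * a j)\<^sup>2" if "r \<in> S" for r
      by (rule mult_nonneg_nonneg[OF less_imp_le[OF m[OF that]]]) simp
    ultimately show "bilin d (\<lambda>i j. \<sigma> * bez p q i j) a a > 0"
      unfolding B' by (intro sum_pos2[OF S(1) s(1)])
  qed
  then show ?thesis using s1 by (auto simp: definite_def)
qed

text \<open>An isotropic vector of a semidefinite form lies in its radical: otherwise the form is
  affine with nonzero slope along \<open>t * a + e\<close>, and the \<open>t\<close> below gives it
  the value -1.\<close>

lemma pos_semidef_kernel:
  fixes a e :: "nat \<Rightarrow> real"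
  assumes psd: "pos_semidef n M" and M: "sym_mat M" and a: "bilin n M a a = 0"
  shows "bilin n M a e = 0"
proof (rule ccontr)
  assume b: "bilin n M a e \<noteq> 0"
  define t where "t = - (bilin n M e e + 1) / (2 * bilin n M a e)"
  have "bilin n M (\<lambda>i. t * a i + e i) (\<lambda>i. t * a i + e i) \<ge> 0"
    using psd unfolding pos_semidef_def by blast
  moreover have "bilin n M (\<lambda>i. t * a i + e i) (\<lambda>i. t * a i + e i) = 2 * t * bilin n M a e + bilin n M e e"
    unfolding bilin_add_left bilin_add_right bilin_mult_left bilin_mult_right
    using bilin_commute[OF M, of n e a] a by simp
  ultimately show False using b by (simp add: t_def)
qed

lemma pos_semidef_kernel_complex:
  fixes c :: "nat \<Rightarrow> complex"
  assumes psd: "pos_semidef n M" and M: "sym_mat M" and c: "bilin n M c (\<lambda>i. cnj (c i)) = 0"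
  shows "bilin n M c e = 0"
proof -
  let ?u = "\<lambda>i. Re (c i)" and ?v = "\<lambda>i. Im (c i)"
  have "complex_of_real (bilin n M ?u ?u + bilin n M ?v ?v) = 0"
    using c unfolding bilin_cnj_self[OF M] .
  then have "bilin n M ?u ?u + bilin n M ?v ?v = 0" by (simp only: of_real_eq_0_iff)
  moreover have "bilin n M ?u ?u \<ge> 0" "bilin n M ?v ?v \<ge> 0"
    using psd by (simp_all add: pos_semidef_def)
  ultimately have 0: "bilin n M ?u ?u = 0" "bilin n M ?v ?v = 0" by linarith+
  have *: "bilin n M (\<lambda>i. complex_of_real (a i)) e = 0" if "bilin n M a a = 0" for a
  proof -
    have e: "e = (\<lambda>i. of_real (Re (e i)) + \<i> * of_real (Im (e i)))"
      by (simp add: fun_eq_iff complex_eq_iff)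
    have "bilin n M (\<lambda>i. complex_of_real (a i)) e
        = of_real (bilin n M a (\<lambda>i. Re (e i))) + \<i> * of_real (bilin n M a (\<lambda>i. Im (e i)))"
      by (subst e) (simp only: bilin_add_right bilin_mult_right bilin_of_real)
    then show ?thesis by (simp add: pos_semidef_kernel[OF psd M that])
  qed
  have c': "c = (\<lambda>i. of_real (Re (c i)) + \<i> * of_real (Im (c i)))"
    by (simp add: fun_eq_iff complex_eq_iff)
  show ?thesis
    by (subst c') (simp only: bilin_add_left bilin_mult_left *[OF 0(1)] *[OF 0(2)], simp)
qed

lemma kernel_cnj_eq:
  "kernel d p q (z, 1) (cnj z, 1) = bilin d (bez p q) (pvec d (z, 1)) (\<lambda>i. cnj (pvec d (z, 1) i))"
  unfolding kernel_def by (rule bilin_cong) (simp_all add: pvec_def)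

text \<open>If \<open>z\<close> had a real image, its monomial vector would be isotropic, hence in
  the radical, and \<open>p / q\<close> would be constant. Through this lemma a closed condition on
  the coefficients describes the real fibered functions of degree \<open>d\<close>.\<close>

lemma nonreal_preserved_if_semidefinite:
  fixes p q :: "real poly"
  assumes co: "coprime p q" and p: "degree p \<le> d" and q: "degree q \<le> d"
    and pos: "degree p > 0 \<or> degree q > 0"
    and psd: "pos_semidef d (bez p q) \<or> pos_semidef d (\<lambda>i j. - bez p q i j)"
    and z: "Im z \<noteq> 0"
  shows "ceval q z \<noteq> 0 \<and> Im (ceval p z / ceval q z) \<noteq> 0"
proof (rule ccontr)
  let ?p = "ceval p" and ?q = "ceval q"
  assume no: "\<not> ?thesis"
  have "?p z * cnj (?q z) - cnj (?p z) * ?q z = 0"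
  proof (cases "?q z = 0")
    case False
    then have "Im (?p z / ?q z) = 0" using no by simp
    then have "?p z / ?q z = cnj (?p z / ?q z)" by (simp add: complex_eq_iff del: complex_cnj_divide)
    then show ?thesis using False by (simp add: field_simps)
  qed simp
  then have "(z - cnj z) * kernel d p q (z, 1) (cnj z, 1) = 0"
    using wedge_kernel[OF p q, of "(z, 1)" "(cnj z, 1)"]
    by (simp add: wedge_def form_pair_def hform_affine_complex p q poly_cpoly_cnj)
  then have k0: "bilin d (bez p q) (pvec d (z, 1)) (\<lambda>i. cnj (pvec d (z, 1) i)) = 0"
    using z by (simp add: kernel_cnj_eq complex_diff_cnj)
  have sym: "sym_mat (\<lambda>i j. - bez p q i j)" using sym_mat_bez[of p q] by (simp add: sym_mat_def)
  have "kernel d p q (z, 1) (w, 1) = 0" for w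
    using psd
  proof
    assume "pos_semidef d (bez p q)"
    then show ?thesis unfolding kernel_def by (rule pos_semidef_kernel_complex[OF _ sym_mat_bez k0])
  next
    assume "pos_semidef d (\<lambda>i j. - bez p q i j)"
    moreover have "bilin d (\<lambda>i j. - bez p q i j) (pvec d (z, 1)) (\<lambda>i. cnj (pvec d (z, 1) i)) = 0"
      by (simp add: bilin_uminus k0)
    ultimately have "bilin d (\<lambda>i j. - bez p q i j) (pvec d (z, 1)) (pvec d (w, 1)) = 0"
      by (rule pos_semidef_kernel_complex[OF _ sym])
    then show ?thesis by (simp add: kernel_def bilin_uminus)
  qed
  then have eq: "?p z * ?q w = ?p w * ?q z" for w
    using wedge_kernel[OF p q, of "(z, 1)" "(w, 1)"]
    by (simp add: wedge_def form_pair_def hform_affine_complex p q)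
  have root: "\<exists>w. ceval r w = 0" if "degree r > 0" for r
    using that alg_closed_imp_poly_has_root[of "cpoly r"] by auto
  from pos show False
  proof
    assume "degree p > 0"
    then obtain w where w: "?p w = 0" using root by blast
    then have "?q w \<noteq> 0" using coprime_no_common_root[OF co, of w] by simp
    then have "?p z = 0" using eq[of w] w by simp
    then have "?q z \<noteq> 0" using coprime_no_common_root[OF co, of z] by simp
    then have "?p v = 0" for v using eq[of v] \<open>?p z = 0\<close> by simp
    then have "cpoly p = 0" using poly_all_0_iff_0 by blast
    then show False using \<open>degree p > 0\<close> by simp
  next
    assume "degree q > 0"
    then obtain w where w: "?q w = 0" using root by blast
    then have "?p w \<noteq> 0" using coprime_no_common_root[OF co, of w] by simp
    then have "?q z = 0" using eq[of w] w by simp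
    then have "?p z \<noteq> 0" using coprime_no_common_root[OF co, of z] by simp
    then have "?q v = 0" for v using eq[of v] \<open>?q z = 0\<close> by simp
    then have "cpoly q = 0" using poly_all_0_iff_0 by blast
    then show False using \<open>degree q > 0\<close> by simp
  qed
qed

section \<open>Real fibered functions\<close>

lemma some_in_real_sphere: "Some w \<in> real_sphere \<longleftrightarrow> Im w = 0"
  by (auto simp: real_sphere_def complex_is_Real_iff)

text \<open>Real coefficients send real points and infinity to real points, so only nonreal points
  impose a condition.\<close>

lemma real_fibered_iff:
  "real_fibered f \<longleftrightarrow> (\<forall>z. Im z \<noteq> 0 \<longrightarrow> ceval (denom f) z \<noteq> 0 \<and> Im (rat_fun f z) \<noteq> 0)"
proof -
  have inf: "rat_map f None \<in> real_sphere" "None \<in> real_sphere"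
    by (simp_all add: rat_map_def real_sphere_def)
  have nr: "rat_map f (Some z) \<in> real_sphere \<longleftrightarrow> ceval (denom f) z = 0 \<or> Im (rat_fun f z) = 0" for z
    using inf(2) by (simp add: rat_map_def some_in_real_sphere)
  have re: "Im (rat_fun f z) = 0" if "Im z = 0" for z
  proof -
    have "z = of_real (Re z)" using that by (simp add: complex_eq_iff)
    then obtain x where "z = of_real x" by blast
    then show ?thesis by (simp add: rat_fun_def poly_cpoly_of_real flip: of_real_divide)
  qed
  have "real_fibered f \<longleftrightarrow> (\<forall>z. Some z \<in> real_sphere \<longleftrightarrow> rat_map f (Some z) \<in> real_sphere)"
    unfolding real_fibered_def using inf by (metis option.exhaust)
  then show ?thesis unfolding nr some_in_real_sphere using re by blast
qed

lemma coprime_numer_denom: "coprime (numer f) (denom f)"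
  unfolding numer_def denom_def by (rule coprime_quot_of_fract)

lemma real_fibered_iff_definite:
  assumes f: "f \<in> rat_deg d" and d: "d > 0"
  shows "real_fibered f \<longleftrightarrow> definite d (bez (numer f) (denom f))"
    and "real_fibered f \<longleftrightarrow> pos_semidef d (bez (numer f) (denom f))
      \<or> pos_semidef d (\<lambda>i j. - bez (numer f) (denom f) i j)"
proof -
  let ?p = "numer f" and ?q = "denom f"
  have deg: "d = max (degree ?p) (degree ?q)" using f by (simp add: rat_deg_def rat_degree_def)
  have 1: "definite d (bez ?p ?q)" if "real_fibered f"
    using that unfolding real_fibered_iff rat_fun_def
    by (intro definite_if_nonreal_preserved[OF coprime_numer_denom deg d]) blast
  have "pos_def d M \<Longrightarrow> pos_semidef d M" for M
    unfolding pos_def_def pos_semidef_def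
  proof
    fix a :: "nat \<Rightarrow> real" assume *: "\<forall>a::nat \<Rightarrow> real. (\<exists>i<d. a i \<noteq> 0) \<longrightarrow> 0 < bilin d M a a"
    show "0 \<le> bilin d M a a"
    proof (cases "\<exists>i<d. a i \<noteq> 0")
      case True
      then have "0 < bilin d M a a" by (rule *[THEN spec, THEN mp])
      then show ?thesis by simp
    next
      case False
      then have "bilin d M a a = 0" unfolding bilin_def by (intro sum.neutral ballI) auto
      then show ?thesis by simp
    qed
  qed
  then have 2: "pos_semidef d (bez ?p ?q) \<or> pos_semidef d (\<lambda>i j. - bez ?p ?q i j)" if "definite d (bez ?p ?q)"
    using that unfolding definite_def by blast
  have 3: "real_fibered f" if "pos_semidef d (bez ?p ?q) \<or> pos_semidef d (\<lambda>i j. - bez ?p ?q i j)"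
    unfolding real_fibered_iff rat_fun_def
    using deg d by (intro allI impI nonreal_preserved_if_semidefinite[OF coprime_numer_denom _ _ _ that]) auto
  show "real_fibered f \<longleftrightarrow> definite d (bez ?p ?q)"
    "real_fibered f \<longleftrightarrow> pos_semidef d (bez ?p ?q) \<or> pos_semidef d (\<lambda>i j. - bez ?p ?q i j)"
    using 1 2 3 by blast+
qed

text \<open>Together with \<open>coprime\<close> this shows that a definite Bezoutian alone singles
  out coefficient vectors of functions of degree \<open>d\<close>, so no resultant enters the
  description of the cone.\<close>

lemma (in definite_pair) max_degree: "max (degree p) (degree q) = d"
proof -
  have "F (1, 0) \<noteq> (0, 0 :: real)" by (rule F_nonzero_real) simp
  then have "coeff p d \<noteq> 0 \<or> coeff q d \<noteq> 0" by (simp add: form_pair_def hform_infinity)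
  then have "d \<le> degree p \<or> d \<le> degree q" using le_degree by blast
  then show ?thesis using deg_p deg_q by auto
qed

lemma (in definite_pair) coprime: "coprime p q"
proof (rule ccontr)
  assume nc: "\<not> coprime p q"
  have "gcd p q \<noteq> 0" using max_degree two_le by auto
  moreover have "\<not> is_unit (gcd p q)" using nc unfolding is_unit_gcd .
  ultimately have "degree (gcd p q) > 0" by (metis is_unit_iff_degree neq0_conv)
  then obtain z where z: "ceval (gcd p q) z = 0"
    using alg_closed_imp_poly_has_root[of "cpoly (gcd p q)"] by auto
  have "ceval r z = 0" if "gcd p q dvd r" for r
    using that z by (auto elim!: dvdE)
  then have "F (z, 1) = (0, 0)" by (simp add: F_affine)
  then show False using F_nonzero[of "(z, 1)"] by simp
qed

lemma (in definite_pair) denominator_nonzero: "q \<noteq> 0"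
  using coprime max_degree two_le by (auto simp: is_unit_poly_iff)

lemma numer_denom_Fract:
  assumes co: "coprime p q" and q: "q \<noteq> 0"
  obtains c where "c \<noteq> 0" "numer (Fraction_Field.Fract p q) = smult c p"
    "denom (Fraction_Field.Fract p q) = smult c q"
proof -
  let ?f = "Fraction_Field.Fract p q"
  have "Fraction_Field.Fract (numer ?f) (denom ?f) = ?f" by (simp add: numer_def denom_def)
  then have eq: "numer ?f * q = p * denom ?f"
    using q denom_nonzero by (simp add: Fraction_Field.eq_fract)
  then have "q dvd p * denom ?f" by (metis dvd_triv_right)
  then have "q dvd denom ?f" using co by (simp add: coprime_dvd_mult_right_iff coprime_commute)
  then obtain k where k: "denom ?f = q * k" by (rule dvdE)
  have "denom ?f dvd numer ?f * q" unfolding eq by simp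
  then have "denom ?f dvd q"
    using coprime_numer_denom[of ?f] by (simp add: coprime_dvd_mult_right_iff coprime_commute)
  then have "q * k dvd q * 1" by (simp add: k)
  then have "k dvd 1" using q by (simp only: dvd_mult_cancel_left) simp
  then obtain c where c: "k = [:c:]" "c dvd 1" unfolding is_unit_poly_iff by blast
  then have c0: "c \<noteq> 0" by auto
  have d: "denom ?f = smult c q" by (simp add: k c)
  then have "numer ?f * q = smult c p * q" using eq by (simp add: mult.commute)
  then have "numer ?f = smult c p" using q by (simp only: mult_cancel_right) simp
  then show thesis using that c0 d by blast
qed

section \<open>Fixed points of the second iterate\<close>

text \<open>The form of \<open>r\<close>, evaluated at \<open>(p, q)\<close>. With
  \<open>r = p\<close> and \<open>r = q\<close> this is the numerator and the denominator of the
  second iterate, of formal degree \<open>d * d\<close>.\<close>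

definition comp_form :: "nat \<Rightarrow> real poly \<Rightarrow> real poly \<Rightarrow> real poly \<Rightarrow> real poly" where
  "comp_form d r p q = (\<Sum>i\<le>d. smult (coeff r i) (p ^ i * q ^ (d - i)))"

text \<open>This is \<open>z Q - P\<close> for the second iterate \<open>P / Q\<close>. Its formal
  degree is \<open>d * d + 1\<close>; the actual degree is smaller when infinity is fixed by the
  second iterate.\<close>

definition fixpoly :: "nat \<Rightarrow> real poly \<Rightarrow> real poly \<Rightarrow> real poly" where
  "fixpoly d p q = [:0, 1:] * comp_form d q p q - comp_form d p p q"

lemma poly_comp_form: "poly (comp_form d r p q) x = hform d r (poly p x, poly q x)"
  by (simp add: comp_form_def hform_def poly_sum mult.assoc)

lemma poly_cpoly_comp_form:
  "ceval (comp_form d r p q) x = hform d r (ceval p x, ceval q x)"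
  by (simp add: comp_form_def hform_def poly_sum mult.assoc)

lemma degree_comp_form:
  assumes "degree p \<le> d" "degree q \<le> d"
  shows "degree (comp_form d r p q) \<le> d * d"
  unfolding comp_form_def
proof (intro degree_sum_le finite_atMost order_trans[OF degree_smult_le])
  fix i assume "i \<in> {..d}"
  then have i: "i \<le> d" by simp
  have "degree (p ^ i * q ^ (d - i)) \<le> degree (p ^ i) + degree (q ^ (d - i))" by (rule degree_mult_le)
  also have "\<dots> \<le> degree p * i + degree q * (d - i)" by (intro add_mono degree_power_le)
  also have "\<dots> \<le> d * i + d * (d - i)" using assms by (intro add_mono mult_right_mono) auto
  also have "\<dots> = d * d" using i by (simp flip: distrib_left)
  finally show "degree (p ^ i * q ^ (d - i)) \<le> d * d" .
qed

lemma degree_fixpoly: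
  assumes "degree p \<le> d" "degree q \<le> d"
  shows "degree (fixpoly d p q) \<le> d * d + 1"
  unfolding fixpoly_def
proof (rule degree_diff_le)
  show "degree ([:0, 1:] * comp_form d q p q) \<le> d * d + 1"
    using degree_comp_form[OF assms, of q]
    by (intro order_trans[OF degree_mult_le]) simp
  show "degree (comp_form d p p q) \<le> d * d + 1"
    using degree_comp_form[OF assms, of p] by simp
qed

context definite_pair
begin

abbreviation "R \<equiv> fixpoly d p q"

lemma fixpoly_root_iff:
  assumes z: "Im z \<noteq> 0"
  shows "ceval R z = 0 \<longleftrightarrow> \<phi> (\<phi> z) = z"
proof -
  let ?p = "ceval p" and ?q = "ceval q"
  have q: "?q z \<noteq> 0" by (rule q_nonzero[OF z])
  have q': "?q (\<phi> z) \<noteq> 0" by (rule q_nonzero[OF Im_\<phi>[OF z]])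
  have "hform d r (?p z, ?q z) = ?q z ^ d * ceval r (\<phi> z)" if "degree r \<le> d" for r
    using hform_scale[of d r "?q z" "\<phi> z" 1] q
    by (simp add: hform_affine_complex[OF that] \<phi>_def)
  then have "ceval R z = ?q z ^ d * (z * ?q (\<phi> z) - ?p (\<phi> z))"
    unfolding fixpoly_def
    by (simp add: poly_cpoly_comp_form deg_p deg_q algebra_simps)
  also have "z * ?q (\<phi> z) - ?p (\<phi> z) = ?q (\<phi> z) * (z - \<phi> (\<phi> z))"
    using q' by (simp add: \<phi>_def[of "\<phi> z"] field_simps)
  finally show ?thesis using q q' by auto
qed

text \<open>The second iterate is not the identity, because it brings the points \<open>\<i>\<close>
  and \<open>2 * \<i>\<close> closer in hyperbolic distance.\<close>

lemma fixpoly_nonzero: "R \<noteq> 0"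
proof
  assume "R = 0"
  then have fp: "\<phi> (\<phi> z) = z" if "Im z \<noteq> 0" for z
    using fixpoly_root_iff[OF that] by simp
  have i: "Im \<i> * Im (2 * \<i>) > 0" "\<i> \<noteq> 2 * \<i>" by simp_all
  have ne: "\<phi> \<i> \<noteq> \<phi> (2 * \<i>)"
  proof
    assume "\<phi> \<i> = \<phi> (2 * \<i>)"
    then have "\<phi> (\<phi> \<i>) = \<phi> (\<phi> (2 * \<i>))" by simp
    then show False using fp[of \<i>] fp[of "2 * \<i>"] i(2) by simp
  qed
  have "\<delta> (\<phi> (\<phi> \<i>)) (\<phi> (\<phi> (2 * \<i>))) < \<delta> (\<phi> \<i>) (\<phi> (2 * \<i>))"
    by (rule schwarz_pick[OF Im_\<phi>_mult[OF i(1)] ne])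
  also have "\<dots> < \<delta> \<i> (2 * \<i>)" by (rule schwarz_pick[OF i])
  finally show False by (simp add: fp)
qed

end

section \<open>Hermite's criterion for real roots\<close>

text \<open>Splitting off one root at a time also covers multiple roots, where the Lagrange basis
  breaks down. The list consists of the quotients of \<open>R\<close> by its linear factors.\<close>

lemma real_rooted_sum_of_squares:
  fixes R :: "real poly"
  assumes "R \<noteq> 0" "\<And>z. ceval R z = 0 \<Longrightarrow> Im z = 0"
  shows "\<exists>ls::real poly list. (\<forall>l\<in>set ls. degree l < degree R) \<and>
    (\<forall>x y. poly R x * poly (pderiv R) y - poly R y * poly (pderiv R) x
      = (x - y) * (\<Sum>i<length ls. poly (ls ! i) x * poly (ls ! i) y))"
  using assms
proof (induction "degree R" arbitrary: R)
  case 0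
  then obtain c where "R = [:c:]" using degree_eq_zeroE[of R] by metis
  then show ?case by (intro exI[of _ "[]"]) (simp add: pderiv_pCons)
next
  case (Suc n)
  then obtain z where z: "ceval R z = 0"
    using alg_closed_imp_poly_has_root[of "cpoly R"] by auto
  then have "z = of_real (Re z)" using Suc.prems(2)[OF z] by (simp add: complex_eq_iff)
  then obtain s where "z = of_real s" by blast
  then have "poly R s = 0" using z by (simp add: poly_cpoly_of_real)
  then obtain T where T: "R = [:- s, 1:] * T" unfolding poly_eq_0_iff_dvd by (rule dvdE)
  have T0: "T \<noteq> 0" using Suc.prems(1) T by auto
  have dT: "degree R = Suc (degree T)" unfolding T using T0 by (subst degree_mult_eq) auto
  have rT: "ceval T z = 0 \<Longrightarrow> Im z = 0" for z
    using Suc.prems(2)[of z] by (simp add: T)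
  have nT: "n = degree T" using Suc.hyps(2) dT by simp
  have "\<exists>ls::real poly list. (\<forall>l\<in>set ls. degree l < degree T) \<and>
    (\<forall>x y. poly T x * poly (pderiv T) y - poly T y * poly (pderiv T) x
      = (x - y) * (\<Sum>i<length ls. poly (ls ! i) x * poly (ls ! i) y))"
    by (rule Suc.hyps(1)[OF nT T0]) (rule rT)
  then obtain ls :: "real poly list" where ls: "\<forall>l\<in>set ls. degree l < degree T"
    and eq: "\<forall>x y. poly T x * poly (pderiv T) y - poly T y * poly (pderiv T) x
      = (x - y) * (\<Sum>i<length ls. poly (ls ! i) x * poly (ls ! i) y)"
    by (elim exE conjE)
  let ?ls = "T # map (\<lambda>l. [:- s, 1:] * l) ls"
  have "\<forall>l\<in>set ?ls. degree l < degree R"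
  proof
    fix l assume "l \<in> set ?ls"
    then consider "l = T" | l' where "l' \<in> set ls" "l = [:- s, 1:] * l'" by auto
    then show "degree l < degree R"
    proof cases
      case 2
      have "degree l \<le> 1 + degree l'" unfolding 2(2) by (rule order_trans[OF degree_mult_le]) simp
      moreover have "degree l' < degree T" using ls 2(1) by simp
      ultimately show ?thesis using dT by linarith
    qed (simp add: dT)
  qed
  moreover have "poly R x * poly (pderiv R) y - poly R y * poly (pderiv R) x
      = (x - y) * (\<Sum>i<length ?ls. poly (?ls ! i) x * poly (?ls ! i) y)" for x y
  proof -
    have R: "poly R v = (v - s) * poly T v" for v by (simp add: T algebra_simps)
    have R': "poly (pderiv R) v = poly T v + (v - s) * poly (pderiv T) v" for v
      unfolding T pderiv_mult by (simp add: pderiv_pCons algebra_simps)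
    have M: "poly ([:- s, 1:] * l) v = (v - s) * poly l v" for l v by (simp add: algebra_simps)
    have "poly R x * poly (pderiv R) y - poly R y * poly (pderiv R) x
      = (x - y) * (poly T x * poly T y)
        + (x - s) * (y - s) * (poly T x * poly (pderiv T) y - poly T y * poly (pderiv T) x)"
      unfolding R R' by (simp add: algebra_simps)
    also have "\<dots> = (x - y) * (poly T x * poly T y
        + (x - s) * (y - s) * (\<Sum>i<length ls. poly (ls ! i) x * poly (ls ! i) y))"
      unfolding eq[rule_format] by (simp add: distrib_left mult_ac)
    also have "(x - s) * (y - s) * (\<Sum>i<length ls. poly (ls ! i) x * poly (ls ! i) y)
        = (\<Sum>i<length ls. poly (?ls ! Suc i) x * poly (?ls ! Suc i) y)"
      unfolding sum_distrib_left by (intro sum.cong refl) (simp add: M algebra_simps del: mult_pCons_left)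
    also have "poly T x * poly T y + \<dots> = (\<Sum>i<length ?ls. poly (?ls ! i) x * poly (?ls ! i) y)"
      unfolding length_Cons sum.lessThan_Suc_shift length_map by simp
    finally show ?thesis .
  qed
  ultimately show ?case by blast
qed

text \<open>Semidefiniteness makes \<open>R' / R\<close> map the upper half plane, off its poles, to
  the closed lower one, and near a pole this fails. The size \<open>N\<close> is free because the
  degree of the polynomial in question varies with the coefficients.\<close>

lemma real_rooted_iff_pos_semidef:
  fixes R :: "real poly"
  assumes R0: "R \<noteq> 0" and N: "degree R \<le> N"
  shows "(\<forall>z. ceval R z = 0 \<longrightarrow> Im z = 0) \<longleftrightarrow> pos_semidef N (bez R (pderiv R))"
proof
  assume rr: "\<forall>z. ceval R z = 0 \<longrightarrow> Im z = 0"
  have "\<exists>ls::real poly list. (\<forall>l\<in>set ls. degree l < degree R) \<and>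
    (\<forall>x y. poly R x * poly (pderiv R) y - poly R y * poly (pderiv R) x
      = (x - y) * (\<Sum>i<length ls. poly (ls ! i) x * poly (ls ! i) y))"
    using rr by (intro real_rooted_sum_of_squares R0) simp
  then obtain ls :: "real poly list" where ls: "\<forall>l\<in>set ls. degree l < degree R"
    and eq: "\<forall>x y. poly R x * poly (pderiv R) y - poly R y * poly (pderiv R) x
      = (x - y) * (\<Sum>i<length ls. poly (ls ! i) x * poly (ls ! i) y)"
    by (elim exE conjE)
  have N': "degree (pderiv R) \<le> N" using N by (simp add: degree_pderiv)
  have "bilin N (bez R (pderiv R)) a a = (\<Sum>i<length ls. 1 * (\<Sum>k<N. coeff (ls ! i) k * a k)\<^sup>2)" for a
  proof (rule bez_sum_of_squares[OF N N'])
    show "degree (ls ! i) < N" if "i \<in> {..<length ls}" for i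
    proof -
      have "ls ! i \<in> set ls" using that by simp
      then have "degree (ls ! i) < degree R" using ls by simp
      then show ?thesis using N by linarith
    qed
  qed (simp add: eq[rule_format])
  then show "pos_semidef N (bez R (pderiv R))"
    unfolding pos_semidef_def by (simp add: sum_nonneg)
next
  assume psd: "pos_semidef N (bez R (pderiv R))"
  let ?R = "cpoly R"
  have N': "degree (pderiv R) \<le> N" using N by (simp add: degree_pderiv)
  have sgn: "Im (ceval (pderiv R) z * cnj (poly ?R z)) \<le> 0" if z: "Im z > 0" for z
  proof -
    define k where "k = bilin N (bez R (pderiv R)) (\<lambda>i. Re (pvec N (z, 1) i)) (\<lambda>i. Re (pvec N (z, 1) i))
      + bilin N (bez R (pderiv R)) (\<lambda>i. Im (pvec N (z, 1) i)) (\<lambda>i. Im (pvec N (z, 1) i))"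
    define v where "v = ceval (pderiv R) z * cnj (poly ?R z)"
    have k: "k \<ge> 0" using psd by (simp add: k_def pos_semidef_def)
    have "(z - cnj z) * kernel N R (pderiv R) (z, 1) (cnj z, 1) = cnj v - v"
      using wedge_kernel[OF N N', of "(z, 1)" "(cnj z, 1)"]
      by (simp add: wedge_def form_pair_def hform_affine_complex N N' poly_cpoly_cnj v_def mult_ac)
    then have "(z - cnj z) * of_real k = cnj v - v"
      unfolding kernel_cnj_eq bilin_cnj_self[OF sym_mat_bez] k_def[symmetric] .
    then have "Im ((z - cnj z) * of_real k) = Im (cnj v - v)" by (rule arg_cong)
    then have "2 * Im z * k = - 2 * Im v" by simp
    moreover have "Im z * k \<ge> 0" using z k by simp
    ultimately show ?thesis unfolding v_def[symmetric] by linarith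
  qed
  have no_root: "poly ?R z0 \<noteq> 0" if z0: "Im z0 > 0" for z0
  proof
    assume r: "poly ?R z0 = 0"
    define m where "m = order z0 ?R"
    have R0': "?R \<noteq> 0" using R0 by simp
    obtain S where S: "?R = [:- z0, 1:] ^ m * S" and nd: "\<not> [:- z0, 1:] dvd S"
      using order_decomp[OF R0', of z0] unfolding m_def by (elim exE conjE)
    have m: "m \<noteq> 0" using r R0' unfolding m_def by (simp add: order_root)
    have S0: "poly S z0 \<noteq> 0" using nd by (simp add: poly_eq_0_iff_dvd)
    \<comment> \<open>Just below the root, \<open>R' / R\<close> behaves like
      \<open>m / (z e - z0) = \<i> * m / e\<close>, whose imaginary part is positive. Up to a
      positive factor, \<open>e * g e\<close> is the imaginary part that \<open>sgn\<close> bounds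
      by 0.\<close>
    define z where "z e = z0 - \<i> * of_real e" for e :: real
    define g where "g e = Re (of_nat m * (poly S (z e) * cnj (poly S (z e)))
      + (z e - z0) * poly (pderiv S) (z e) * cnj (poly S (z e)))" for e
    have "continuous_on UNIV g" unfolding g_def z_def by (intro continuous_intros)
    then have "isCont g 0" by (simp add: continuous_on_eq_continuous_at)
    moreover have "g 0 = of_nat m * (cmod (poly S z0))\<^sup>2"
      unfolding g_def z_def complex_norm_square[symmetric] by simp
    then have "g 0 > 0" using m S0 by simp
    ultimately have "eventually (\<lambda>e. g e > 0) (at 0)"
      unfolding isCont_def by (rule order_tendstoD(1))
    then have 1: "eventually (\<lambda>e. g e > 0) (at_right 0)"
      by (rule filter_leD[OF at_le[OF subset_UNIV]])
    have 2: "eventually (\<lambda>e::real. 0 < e) (at_right 0)" by (rule eventually_at_right_less)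
    have 3: "eventually (\<lambda>e. e < Im z0) (at_right 0)"
      using z0 by (auto simp: eventually_at_right_field)
    from 1 2 3 have "eventually (\<lambda>e. g e > 0 \<and> 0 < e \<and> e < Im z0) (at_right 0)"
      by eventually_elim simp
    then obtain e where e: "g e > 0" "0 < e" "e < Im z0"
      using eventually_happens'[OF trivial_limit_at_right_real] by blast
    define h where "h = z e - z0"
    obtain n where n: "m = Suc n" using m by (cases m) auto
    have P: "poly ?R (z e) = h * h ^ n * poly S (z e)" unfolding S n h_def by (simp add: algebra_simps)
    have D: "cpoly (pderiv R) = [:- z0, 1:] ^ m * pderiv S + smult (of_nat m) ([:- z0, 1:] ^ n) * S"
      unfolding cpoly_pderiv S pderiv_mult n pderiv_power_Suc by (simp add: pderiv_pCons mult.commute)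
    have P': "ceval (pderiv R) (z e) = h ^ n * (h * poly (pderiv S) (z e) + of_nat m * poly S (z e))"
      unfolding D h_def n by (simp add: algebra_simps)
    have c: "cnj h = \<i> * of_real e" by (simp add: z_def h_def)
    have "ceval (pderiv R) (z e) * cnj (poly ?R (z e))
      = (h ^ n * cnj (h ^ n)) * (cnj h * (of_nat m * (poly S (z e) * cnj (poly S (z e)))
          + h * poly (pderiv S) (z e) * cnj (poly S (z e))))"
      unfolding P P' by (simp add: algebra_simps)
    also have "h ^ n * cnj (h ^ n) = of_real ((cmod (h ^ n))\<^sup>2)"
      by (simp only: complex_norm_square)
    finally have "Im (ceval (pderiv R) (z e) * cnj (poly ?R (z e)))
      = (cmod (h ^ n))\<^sup>2 * (e * g e)"
      unfolding c g_def h_def[symmetric] by (simp only: Im_complex_of_real complex.sel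
        times_complex.sel Re_complex_of_real imaginary_unit.sel) simp
    moreover have "(cmod (h ^ n))\<^sup>2 * (e * g e) > 0"
      using e by (intro mult_pos_pos) (auto simp: h_def z_def)
    moreover have "Im (z e) > 0" using e by (simp add: z_def)
    ultimately show False using sgn[of "z e"] by linarith
  qed
  show "\<forall>z. poly ?R z = 0 \<longrightarrow> Im z = 0"
  proof (intro allI impI)
    fix z assume z: "poly ?R z = 0"
    then have z': "poly ?R (cnj z) = 0" by (simp add: poly_cpoly_cnj)
    have "\<not> Im z > 0" using no_root z by blast
    moreover have "\<not> Im (cnj z) > 0" using no_root z' by blast
    ultimately show "Im z = 0" by simp
  qed
qed

section \<open>The fixed point formula for the second iterate\<close>

text \<open>By Lagrange interpolation the coefficient of \<open>g\<close> divided by the leading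
  coefficient of \<open>R\<close> is the sum of \<open>g(s) / R'(s)\<close> over the roots. For
  \<open>R = z Q - P\<close> and \<open>g = Q\<close> the summands are
  \<open>1 / (1 - multiplier)\<close> at the fixed points of \<open>P / Q\<close>, negative if the
  multiplier exceeds 1.\<close>

lemma lead_coeff_sign:
  fixes R g :: "real poly"
  assumes R: "R \<noteq> 0" and real: "\<And>z. ceval R z = 0 \<Longrightarrow> Im z = 0"
    and neg: "\<And>s. poly R s = 0 \<Longrightarrow> poly (pderiv R) s * poly g s < 0"
    and g: "degree g < degree R"
  shows "lead_coeff R * coeff g (degree R - 1) \<le> 0"
proof -
  define S where "S = {s. poly R s = 0}"
  define w where "w s = root_prod (S - {s})" for s
  have simple: "poly (pderiv R) s \<noteq> 0" if "poly R s = 0" for s using neg[OF that] by auto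
  note S = real_simple_roots[OF R real simple, folded S_def]
  have A: "lead_coeff R * (poly g s / poly (w s) s) \<le> 0" if s: "s \<in> S" for s
  proof -
    have "R = smult (lead_coeff R) (root_prod S)" by (rule S(3))
    also have "root_prod S = [:- s, 1:] * w s"
      unfolding root_prod_def w_def by (rule prod.remove[OF S(1) s])
    finally have D: "pderiv R = pderiv (smult (lead_coeff R) ([:- s, 1:] * w s))" by (rule arg_cong)
    have "poly (pderiv R) s = lead_coeff R * poly (w s) s"
      by (subst D) (simp only: pderiv_smult pderiv_mult, simp add: pderiv_pCons)
    moreover have "poly (pderiv R) s * poly g s < 0" using neg s by (simp add: S_def)
    ultimately have n: "lead_coeff R * poly g s * poly (w s) s < 0" by (simp add: mult_ac)
    have "lead_coeff R * (poly g s / poly (w s) s) = (lead_coeff R * poly g s * poly (w s) s) / (poly (w s) s)\<^sup>2"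
      by (simp add: power2_eq_square)
    also have "\<dots> \<le> 0" using n by (intro divide_nonpos_nonneg) auto
    finally show ?thesis .
  qed
  have w1: "coeff (w s) (degree R - 1) = 1" if "s \<in> S" for s
  proof -
    have "degree (w s) = degree R - 1" using that S(1,2) by (simp add: w_def degree_root_prod)
    moreover have "lead_coeff (w s) = 1" unfolding w_def by (rule lead_coeff_root_prod)
    ultimately show ?thesis by simp
  qed
  have "g = (\<Sum>s\<in>S. smult (poly g s / poly (w s) s) (w s))"
    unfolding w_def using S g by (intro lagrange_interpolation) auto
  then have "coeff g (degree R - 1) = coeff (\<Sum>s\<in>S. smult (poly g s / poly (w s) s) (w s)) (degree R - 1)"
    by (rule arg_cong)
  also have "\<dots> = (\<Sum>s\<in>S. poly g s / poly (w s) s)"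
    by (simp add: coeff_sum w1 del: One_nat_def)
  finally have "lead_coeff R * coeff g (degree R - 1) = (\<Sum>s\<in>S. lead_coeff R * (poly g s / poly (w s) s))"
    by (simp only: sum_distrib_left)
  also have "\<dots> \<le> 0" by (rule sum_nonpos) (rule A)
  finally show ?thesis .
qed

text \<open>Extends identities at \<open>(1, y)\<close>, obtained from affine ones at
  \<open>1 / y\<close>, to the point \<open>(1, 0)\<close> at infinity.\<close>

lemma continuous_eq_at_0:
  fixes f g :: "real \<Rightarrow> real"
  assumes f: "continuous_on UNIV f" and g: "continuous_on UNIV g" and eq: "\<And>y. y \<noteq> 0 \<Longrightarrow> f y = g y"
  shows "f 0 = g 0"
proof -
  have "(f \<longlongrightarrow> f 0) (at 0)" "(g \<longlongrightarrow> g 0) (at 0)"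
    using f g by (simp_all add: continuous_on_eq_continuous_at isCont_def)
  moreover have "eventually (\<lambda>y. f y = g y) (at 0)"
    by (simp add: eventually_at_filter eq)
  ultimately have "(g \<longlongrightarrow> f 0) (at 0)" using tendsto_cong by blast
  then show ?thesis using \<open>(g \<longlongrightarrow> g 0) (at 0)\<close> by (intro tendsto_unique[of "at (0::real)"]) auto
qed

lemma continuous_on_hform [continuous_intros]:
  fixes f g :: "'b::topological_space \<Rightarrow> 'a::real_normed_field"
  assumes "continuous_on A f" "continuous_on A g"
  shows "continuous_on A (\<lambda>y. hform d p (f y, g y))"
  unfolding hform_def fst_conv snd_conv by (intro continuous_intros assms)

lemma continuous_on_kernel [continuous_intros]:
  fixes f g h k :: "'b::topological_space \<Rightarrow> 'a::real_normed_field"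
  assumes "continuous_on A f" "continuous_on A g" "continuous_on A h" "continuous_on A k"
  shows "continuous_on A (\<lambda>y. kernel d p q (f y, g y) (h y, k y))"
  unfolding kernel_def bilin_def pvec_def fst_conv snd_conv by (intro continuous_intros assms)

lemma hform_reciprocal:
  fixes y :: real
  assumes "y \<noteq> 0"
  shows "hform n p (1, y) = y ^ n * hform n p (1 / y, 1)"
  using hform_scale[of n p y "1 / y" 1] assms by simp

lemma coeff_comp_form:
  assumes p: "degree p \<le> d" and q: "degree q \<le> d"
  shows "coeff (comp_form d r p q) (d * d) = hform d r (coeff p d, coeff q d)"
proof -
  let ?C = "comp_form d r p q"
  have "hform (d * d) ?C (1, y) = hform d r (hform d p (1, y), hform d q (1, y))" if y: "y \<noteq> 0" for y :: real
  proof -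
    have "hform d r (hform d p (1, y), hform d q (1, y))
        = hform d r (y ^ d * hform d p (1 / y, 1), y ^ d * hform d q (1 / y, 1))"
      by (simp only: hform_reciprocal[OF y])
    also have "\<dots> = y ^ (d * d) * hform d r (hform d p (1 / y, 1), hform d q (1 / y, 1))"
      by (simp add: hform_scale power_mult)
    also have "hform d r (hform d p (1 / y, 1), hform d q (1 / y, 1)) = hform (d * d) ?C (1 / y, 1)"
      by (simp add: hform_affine_real p q degree_comp_form poly_comp_form)
    finally show ?thesis by (simp only: hform_reciprocal[OF y])
  qed
  then have "hform (d * d) ?C (1, 0 :: real) = hform d r (hform d p (1, 0 :: real), hform d q (1, 0))"
    by (intro continuous_eq_at_0[where f = "\<lambda>y. hform (d * d) ?C (1, y)"
          and g = "\<lambda>y. hform d r (hform d p (1, y), hform d q (1, y))"] continuous_intros)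
  then show ?thesis by (simp add: hform_infinity)
qed

lemma wedge_eq_0_cases:
  fixes a b u v :: real
  assumes "wedge (u, v) (a, b) = 0" "(a, b) \<noteq> (0, 0)"
  obtains k where "u = k * a" "v = k * b"
proof (cases "a = 0")
  case True
  then show thesis using that[of "v / b"] assms by (simp add: wedge_def)
next
  case False
  then show thesis using that[of "u / a"] assms by (simp add: wedge_def field_simps)
qed

context definite_pair
begin

text \<open>The right-hand side is the diagonal kernel of the second iterate. On a 2-cycle the wedge
  identity gives \<open>K E (F E) = - \<kappa>\<close> for \<open>E = (a, b)\<close>, and the claim
  is Cauchy-Schwarz; if \<open>F E = k E\<close>, then \<open>\<kappa> = k ^ (d + 1)\<close> and the
  claim is the squared hypothesis up to a power of \<open>k\<close>.\<close>

lemma second_iterate_expanding: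
  fixes a b \<kappa> :: real
  assumes exp: "\<And>a b \<kappa> :: real. (a, b) \<noteq> (0, 0) \<Longrightarrow> F (a, b) = (\<kappa> * a, \<kappa> * b)
      \<Longrightarrow> \<kappa>\<^sup>2 < \<bar>K (a, b) (a, b)\<bar>"
    and E: "(a, b) \<noteq> (0, 0)" and G: "F (F (a, b)) = (\<kappa> * a, \<kappa> * b)"
  shows "\<kappa>\<^sup>2 < K (a, b) (a, b) * K (F (a, b)) (F (a, b))"
proof -
  obtain u v where uv: "F (a, b) = (u, v)" by (cases "F (a, b)")
  have uv0: "(u, v) \<noteq> (0, 0)" using F_nonzero_real[OF E] uv by simp
  show ?thesis
  proof (cases "wedge (a, b) (u, v) = 0")
    case False
    have "wedge (a, b) (u, v) * K (a, b) (u, v) = wedge (u, v) (\<kappa> * a, \<kappa> * b)"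
      unfolding wedge_K G[unfolded uv] uv ..
    also have "\<dots> = wedge (a, b) (u, v) * (- \<kappa>)" by (simp add: wedge_def algebra_simps)
    finally have "K (a, b) (u, v) = - \<kappa>" using False by (simp only: mult_cancel_left) simp
    then show ?thesis using K_strict_real[OF False] by (simp add: uv)
  next
    case True
    then have "wedge (u, v) (a, b) = 0" by (simp add: wedge_def algebra_simps)
    then obtain k where k: "u = k * a" "v = k * b" using E by (rule wedge_eq_0_cases)
    then have k0: "k \<noteq> 0" using uv0 by auto
    have "F (k * a, k * b) = (k ^ d * (k * a), k ^ d * (k * b))"
      using uv unfolding k by (simp add: form_pair_def hform_scale)
    then have "\<kappa> * a = k ^ d * (k * a)" "\<kappa> * b = k ^ d * (k * b)"
      using G unfolding uv k by simp_all
    then have \<kappa>: "\<kappa> = k ^ d * k" using E by auto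
    have e: "k\<^sup>2 < \<bar>K (a, b) (a, b)\<bar>" using exp[OF E] uv k by simp
    have "(k\<^sup>2)\<^sup>2 < (K (a, b) (a, b))\<^sup>2"
      using power_strict_mono[OF e, of 2] by simp
    then have "(k ^ (d - 1))\<^sup>2 * (k\<^sup>2)\<^sup>2 < (k ^ (d - 1))\<^sup>2 * (K (a, b) (a, b))\<^sup>2"
      using k0 by (intro mult_strict_left_mono) auto
    also have "\<dots> = K (a, b) (a, b) * K (k * a, k * b) (k * a, k * b)"
      unfolding kernel_scale_left kernel_scale_right by (simp add: power2_eq_square mult_ac)
    also have "(k ^ (d - 1))\<^sup>2 * (k\<^sup>2)\<^sup>2 = \<kappa>\<^sup>2"
    proof -
      have "k ^ d = k ^ (d - 1) * k" using two_le by (simp flip: power_Suc2)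
      then show ?thesis by (simp add: \<kappa> power2_eq_square mult_ac)
    qed
    finally show ?thesis unfolding uv k .
  qed
qed

lemma FF_affine: "F (F (x, 1)) = (poly (comp_form d p p q) x, poly (comp_form d q p q) x)" for x :: real
  by (simp add: form_pair_def hform_affine_real deg_p deg_q poly_comp_form)

text \<open>Chain rule: the kernel of a composition is the product of the kernels.\<close>

lemma wedge_FF: "wedge (F (F X)) (F (F Y)) = wedge X Y * (K X Y * K (F X) (F Y))"
  by (simp add: wedge_K[symmetric] mult_ac)

text \<open>At a fixed point the product is \<open>Q^2 - H\<close>, where \<open>H / Q^2\<close> is
  the multiplier of the second iterate and exceeds 1.\<close>

lemma fixpoly_derivative_sign:
  assumes exp: "\<And>a b \<kappa> :: real. (a, b) \<noteq> (0, 0) \<Longrightarrow> F (a, b) = (\<kappa> * a, \<kappa> * b)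
      \<Longrightarrow> \<kappa>\<^sup>2 < \<bar>K (a, b) (a, b)\<bar>"
    and s: "poly R s = 0"
  shows "poly (pderiv R) s * poly (comp_form d q p q) s < 0"
proof -
  let ?P = "poly (comp_form d p p q)" and ?Q = "poly (comp_form d q p q)"
  define H where "H x = K (x, 1) (s, 1) * K (F (x, 1)) (F (s, 1))" for x
  have R: "poly R x = x * ?Q x - ?P x" for x by (simp add: fixpoly_def)
  have Ps: "?P s = s * ?Q s" using s R by simp
  have "F (F (s, 1)) = (?Q s * s, ?Q s * 1)" unfolding FF_affine Ps by (simp add: mult.commute)
  from second_iterate_expanding[OF exp _ this] have neg: "(?Q s)\<^sup>2 < H s"
    unfolding H_def by simp
  define g where "g x = ?Q x * ?Q s - H x" for x
  have "poly R x * ?Q s - poly R s * ?Q s = g x * (x - s)" for x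
  proof -
    have "?P x * ?Q s - ?P s * ?Q x = (x - s) * H x"
      using wedge_FF[of "(x, 1)" "(s, 1)"] unfolding FF_affine H_def by (simp add: wedge_def)
    then show ?thesis unfolding R Ps g_def by (simp add: algebra_simps)
  qed
  moreover have "continuous_on UNIV g"
    unfolding g_def H_def form_pair_def by (intro continuous_intros)
  then have "isCont g s" by (simp add: continuous_on_eq_continuous_at)
  ultimately have "DERIV (\<lambda>x. poly R x * ?Q s) s :> g s"
    unfolding CARAT_DERIV by blast
  moreover have "DERIV (\<lambda>x. poly R x * ?Q s) s :> poly (pderiv R) s * ?Q s"
    by (auto intro!: derivative_eq_intros)
  ultimately have "poly (pderiv R) s * ?Q s = g s" by (rule DERIV_unique[rotated])
  then show ?thesis using neg by (simp add: g_def power2_eq_square)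
qed

lemma exists_nonexpanding_fixed_point:
  assumes real: "\<And>z. ceval R z = 0 \<Longrightarrow> Im z = 0"
  shows "\<exists>a b \<kappa> :: real. (a, b) \<noteq> (0, 0) \<and> F (a, b) = (\<kappa> * a, \<kappa> * b) \<and> \<bar>K (a, b) (a, b)\<bar> \<le> \<kappa>\<^sup>2"
proof (rule ccontr)
  assume "\<not> ?thesis"
  then have exp: "\<kappa>\<^sup>2 < \<bar>K (a, b) (a, b)\<bar>"
    if "(a, b) \<noteq> (0, 0)" "F (a, b) = (\<kappa> * a, \<kappa> * b)" for a b \<kappa> :: real
    using that not_le by blast
  define P where "P = comp_form d p p q"
  define Q where "Q = comp_form d q p q"
  define n where "n = d * d"
  have n: "n \<ge> 2" unfolding n_def using two_le mult_le_mono[OF two_le two_le] by simp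
  have R: "R = [:0, 1:] * Q - P" by (simp add: fixpoly_def P_def Q_def)
  have cR: "coeff R (Suc k) = coeff Q k - coeff P (Suc k)" for k by (simp add: R)
  have dP: "degree P \<le> n" and dQ: "degree Q \<le> n"
    unfolding P_def Q_def n_def by (intro degree_comp_form deg_p deg_q)+
  have dR: "degree R \<le> Suc n" using degree_fixpoly[OF deg_p deg_q] by (simp add: n_def)
  have neg: "poly (pderiv R) s * poly Q s < 0" if "poly R s = 0" for s
    unfolding Q_def by (rule fixpoly_derivative_sign[OF exp that])
  have sign: "lead_coeff R * coeff Q (degree R - 1) \<le> 0" if "degree Q < degree R"
    by (rule lead_coeff_sign[OF fixpoly_nonzero]) (use real neg that in blast)+
  show False
  proof (cases "coeff Q n = 0")
    \<comment> \<open>Infinity is not fixed by the second iterate. The top coefficients of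
      \<open>R\<close> and \<open>Q\<close> agree, so the sum of the negative numbers
      \<open>1 / (1 - multiplier)\<close> would be 1.\<close>
    case False
    have "coeff R (Suc n) = coeff Q n" using dP by (simp add: cR coeff_eq_0)
    then have deg: "degree R = Suc n" using dR False by (simp add: le_antisym le_degree)
    have "degree Q < degree R" using dQ deg by linarith
    then have "lead_coeff R * coeff Q (degree R - 1) \<le> 0" by (rule sign)
    then have "coeff Q n * coeff Q n \<le> 0" using \<open>coeff R (Suc n) = coeff Q n\<close> by (simp add: deg)
    then show False using False by (auto simp: mult_le_0_iff)
  next
    case True
    \<comment> \<open>Infinity is fixed, and its multiplier \<open>a / b\<close> exceeds 1. The
      finite fixed points then contribute \<open>a / (a - b)\<close>, which is positive.\<close>
    define a where "a = coeff Q (n - 1)"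
    define b where "b = coeff P n"
    have F10: "F (1, 0) = (coeff p d, coeff q d)" by (simp add: form_pair_def hform_infinity)
    have FF10: "F (F (1, 0)) = (b, coeff Q n)"
      unfolding F10 by (simp add: form_pair_def b_def P_def Q_def n_def coeff_comp_form deg_p deg_q)
    have b0: "b \<noteq> 0"
      using F_nonzero_real[of "coeff p d" "coeff q d"] F_nonzero_real[of 1 0] FF10 True unfolding F10
      by auto
    have "F (F (1, 0)) = (b * 1, b * 0)" using FF10 True by simp
    from second_iterate_expanding[OF exp _ this]
    have KK: "b\<^sup>2 < K (1, 0) (1, 0) * K (F (1, 0)) (F (1, 0))" by simp
    have dQ': "degree Q \<le> n - 1"
    proof (rule degree_le, intro allI impI)
      fix i assume "n - 1 < i"
      then show "coeff Q i = 0" using True dQ by (cases "i = n") (auto intro: coeff_eq_0)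
    qed
    have "b * hform (n - 1) Q (1, y) = K (1, y) (1, 0) * K (F (1, y)) (F (1, 0))" if y: "y \<noteq> 0" for y
    proof -
      \<comment> \<open>The kernel of the composition has degree \<open>n - 1\<close> in
        \<open>y\<close>, distributed over its two factors.\<close>
      have e: "n - 1 = (d - 1) + d * (d - 1)"
        using two_le unfolding n_def by (cases d) auto
      have "- (b * poly Q (1 / y)) = wedge (F (F (1 / y, 1))) (F (F (1, 0)))"
        unfolding FF_affine FF10 using True by (simp add: wedge_def Q_def)
      also have "\<dots> = - (K (1 / y, 1) (1, 0) * K (F (1 / y, 1)) (F (1, 0)))"
        unfolding wedge_FF by (simp add: wedge_def)
      finally have 1: "b * poly Q (1 / y) = K (1 / y, 1) (1, 0) * K (F (1 / y, 1)) (F (1, 0))" by simp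
      have 2: "K (1, y) (1, 0) = y ^ (d - 1) * K (1 / y, 1) (1, 0)"
        using kernel_scale_left[of d p q y "1 / y" 1 "(1, 0)"] y by simp
      have 3: "K (F (1, y)) (F (1, 0)) = y ^ (d * (d - 1)) * K (F (1 / y, 1)) (F (1, 0))"
        unfolding form_pair_def hform_reciprocal[OF y] by (simp add: kernel_scale_left power_mult)
      have "b * hform (n - 1) Q (1, y) = y ^ (n - 1) * (b * poly Q (1 / y))"
        unfolding hform_reciprocal[OF y] by (simp add: hform_affine_real[OF dQ'] del: One_nat_def)
      then show ?thesis unfolding 1 2 3 e power_add by simp
    qed
    then have "b * hform (n - 1) Q (1, 0) = K (1, 0) (1, 0) * K (F (1, 0)) (F (1, 0))"
      unfolding form_pair_def
      by (intro continuous_eq_at_0[where f = "\<lambda>y. b * hform (n - 1) Q (1, y)"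
            and g = "\<lambda>y. K (1, y) (1, 0) * K (hform d p (1, y), hform d q (1, y)) (hform d p (1, 0), hform d q (1, 0))"]
          continuous_intros)
    then have ab: "b * a = K (1, 0) (1, 0) * K (F (1, 0)) (F (1, 0))"
      by (simp add: hform_infinity a_def)
    then have 1: "b * (a - b) > 0" using KK by (simp add: algebra_simps power2_eq_square)
    have "b * a > b\<^sup>2" using KK ab by simp
    then have 2: "b * a > 0" using zero_le_power2[of b] by linarith
    have c: "coeff R n = a - b" using n cR[of "n - 1"] by (simp add: a_def b_def)
    have "coeff R (Suc n) = 0" using True dP by (simp add: cR coeff_eq_0)
    then have "degree R \<noteq> Suc n" using fixpoly_nonzero by (metis leading_coeff_0_iff)
    moreover have "coeff R n \<noteq> 0" using 1 c by auto
    ultimately have deg: "degree R = n" using dR le_degree[of R n] by linarith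
    have "degree Q < degree R" using dQ' n deg by linarith
    then have "lead_coeff R * coeff Q (degree R - 1) \<le> 0" by (rule sign)
    then have "(a - b) * a \<le> 0" by (simp add: deg c a_def)
    moreover have "0 < (b * (a - b)) * (b * a)" using 1 2 by (rule mult_pos_pos)
    then have "0 < b\<^sup>2 * ((a - b) * a)" by (simp add: power2_eq_square mult_ac)
    then have "0 < (a - b) * a" by (simp add: zero_less_mult_iff)
    ultimately show False by linarith
  qed
qed

end

section \<open>The space of rational functions\<close>

lemma bez_smult: "bez (smult c p) (smult c q) i j = c\<^sup>2 * bez p q i j"
  unfolding bez_def sum_distrib_left
  by (intro sum.cong refl) (simp add: power2_eq_square algebra_simps)

lemma pos_def_scale: "k > 0 \<Longrightarrow> pos_def n (\<lambda>i j. k * M i j) \<longleftrightarrow> pos_def n M"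
  by (simp add: pos_def_def bilin_scale zero_less_mult_iff)

lemma pos_semidef_scale: "k > 0 \<Longrightarrow> pos_semidef n (\<lambda>i j. k * M i j) \<longleftrightarrow> pos_semidef n M"
  by (simp add: pos_semidef_def bilin_scale zero_le_mult_iff)

lemma definite_scale:
  assumes "k > 0" shows "definite n (\<lambda>i j. k * M i j) \<longleftrightarrow> definite n M"
  using pos_def_scale[OF assms, of n M] pos_def_scale[OF assms, of n "\<lambda>i j. - M i j"]
  by (simp add: definite_def)

lemma fixpoly_smult:
  "fixpoly d (smult c p) (smult c q) = smult (c ^ (d + 1)) (fixpoly d p q)"
proof -
  have "comp_form d (smult c r) (smult c p) (smult c q) = smult (c ^ (d + 1)) (comp_form d r p q)" for r
  proof -
    have "smult (coeff (smult c r) i) (smult c p ^ i * smult c q ^ (d - i))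
        = smult (c ^ (d + 1)) (smult (coeff r i) (p ^ i * q ^ (d - i)))" if "i \<le> d" for i
    proof -
      have "c ^ d = c ^ i * c ^ (d - i)" using that by (simp flip: power_add)
      then show ?thesis by (simp add: smult_power mult_ac del: mult_cancel_left mult_cancel_right)
    qed
    then have "comp_form d (smult c r) (smult c p) (smult c q)
        = (\<Sum>i\<le>d. [:c ^ (d + 1):] * smult (coeff r i) (p ^ i * q ^ (d - i)))"
      unfolding comp_form_def by (intro sum.cong refl) (simp add: mult_ac)
    then show ?thesis unfolding comp_form_def sum_distrib_left[symmetric] by simp
  qed
  then show ?thesis by (simp add: fixpoly_def smult_diff_right)
qed

text \<open>Stated for arbitrary pairs, neither coprime nor normalized, so that it makes sense on
  the whole space of coefficient vectors.\<close>

definition admissible :: "nat \<Rightarrow> real poly \<Rightarrow> real poly \<Rightarrow> bool" where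
  "admissible d p q \<longleftrightarrow> definite d (bez p q)
    \<and> pos_semidef (d * d + 1) (bez (fixpoly d p q) (pderiv (fixpoly d p q)))"

lemma definite_bez_smult:
  "c \<noteq> 0 \<Longrightarrow> definite d (bez (smult c p) (smult c q)) \<longleftrightarrow> definite d (bez p q)"
  using definite_scale[of "c\<^sup>2" d "bez p q"] by (simp add: bez_smult[abs_def])

text \<open>A scalar enters both matrices through even powers, that is through positive factors, so
  the conditions depend only on the projective point.\<close>

lemma admissible_smult:
  assumes "c \<noteq> 0"
  shows "admissible d (smult c p) (smult c q) \<longleftrightarrow> admissible d p q"
proof -
  have "(c ^ (d + 1))\<^sup>2 > 0" using assms by simp
  then show ?thesis
    unfolding admissible_def definite_bez_smult[OF assms] fixpoly_smult pderiv_smult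
    by (simp add: bez_smult[abs_def] pos_semidef_scale del: power_Suc)
qed

lemma definite_pair_numer_denom:
  assumes d: "d \<ge> 2" and f: "f \<in> rat_deg d" and rf: "real_fibered f"
  shows "definite_pair d (numer f) (denom f)"
proof
  show "degree (numer f) \<le> d" "degree (denom f) \<le> d"
    using f by (auto simp: rat_deg_def rat_degree_def)
  show "definite d (bez (numer f) (denom f))"
    using real_fibered_iff_definite(1)[OF f] rf d by simp
qed (rule d)

text \<open>Orbits of nonreal points never meet a pole, so the value 0 that \<open>rat_fun\<close>
  takes there does no harm.\<close>

lemma rat_map_iterate:
  assumes rf: "real_fibered f" and z: "Im z \<noteq> 0"
  shows "(rat_map f ^^ k) (Some z) = Some ((rat_fun f ^^ k) z) \<and> Im ((rat_fun f ^^ k) z) \<noteq> 0"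
proof (induction k)
  case (Suc k)
  then show ?case using rf unfolding real_fibered_iff by (simp add: rat_map_def)
qed (simp add: z)

lemma only_real_fixed_iterate_iff:
  assumes rf: "real_fibered f"
  shows "only_real_fixed_points (rat_map f ^^ k) \<longleftrightarrow> (\<forall>z. Im z \<noteq> 0 \<longrightarrow> (rat_fun f ^^ k) z \<noteq> z)"
proof
  assume o: "only_real_fixed_points (rat_map f ^^ k)"
  show "\<forall>z. Im z \<noteq> 0 \<longrightarrow> (rat_fun f ^^ k) z \<noteq> z"
  proof (intro allI impI notI)
    fix z assume z: "Im z \<noteq> 0" "(rat_fun f ^^ k) z = z"
    then have "(rat_map f ^^ k) (Some z) = Some z" using rat_map_iterate[OF rf z(1)] by simp
    then have "Some z \<in> real_sphere" using o unfolding only_real_fixed_points_def by blast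
    then show False using z by (simp add: some_in_real_sphere)
  qed
next
  assume n: "\<forall>z. Im z \<noteq> 0 \<longrightarrow> (rat_fun f ^^ k) z \<noteq> z"
  show "only_real_fixed_points (rat_map f ^^ k)"
    unfolding only_real_fixed_points_def
  proof (intro allI impI)
    fix x assume x: "(rat_map f ^^ k) x = x"
    show "x \<in> real_sphere"
    proof (cases x)
      case None
      then show ?thesis by (simp add: real_sphere_def)
    next
      case (Some z)
      have "Im z = 0"
      proof (rule ccontr)
        assume z: "Im z \<noteq> 0"
        then show False using rat_map_iterate[OF rf z, of k] n x Some by simp
      qed
      then show ?thesis by (simp add: Some some_in_real_sphere)
    qed
  qed
qed

lemma real_periodic_iff:
  assumes "f \<in> rat_deg d" "real_fibered f"
  shows "f \<in> real_periodic d \<longleftrightarrow> (\<forall>k\<ge>1. \<forall>z. Im z \<noteq> 0 \<longrightarrow> (rat_fun f ^^ k) z \<noteq> z)"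
  using assms by (simp add: real_periodic_def only_real_fixed_iterate_iff)

lemma only_real_fixed_second_iff:
  assumes "real_fibered f"
  shows "only_real_fixed_points (rat_map f \<circ> rat_map f)
    \<longleftrightarrow> (\<forall>z. Im z \<noteq> 0 \<longrightarrow> rat_fun f (rat_fun f z) \<noteq> z)"
  using only_real_fixed_iterate_iff[OF assms, of 2] by (simp add: numeral_2_eq_2 comp_def)

lemma real_periodic_iff_second_iterate:
  assumes d: "d \<ge> 2" and f: "f \<in> rat_deg d" and rf: "real_fibered f"
  shows "f \<in> real_periodic d \<longleftrightarrow> only_real_fixed_points (rat_map f \<circ> rat_map f)"
proof -
  interpret definite_pair d "numer f" "denom f" by (rule definite_pair_numer_denom[OF d f rf])
  have \<phi>: "rat_fun f = \<phi>" by (simp add: fun_eq_iff rat_fun_def \<phi>_def)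
  have "(\<forall>k\<ge>1. \<forall>z. Im z \<noteq> 0 \<longrightarrow> (\<phi> ^^ k) z \<noteq> z) \<longleftrightarrow> (\<forall>z. Im z \<noteq> 0 \<longrightarrow> \<phi> (\<phi> z) \<noteq> z)"
  proof (intro iffI allI impI)
    fix z assume *: "\<forall>k\<ge>1. \<forall>z. Im z \<noteq> 0 \<longrightarrow> (\<phi> ^^ k) z \<noteq> z" and "Im z \<noteq> 0"
    then have "(\<phi> ^^ 2) z \<noteq> z" by simp
    then show "\<phi> (\<phi> z) \<noteq> z" by (simp add: numeral_2_eq_2)
  next
    fix k :: nat and z
    assume "\<forall>z. Im z \<noteq> 0 \<longrightarrow> \<phi> (\<phi> z) \<noteq> z" "1 \<le> k" "Im z \<noteq> 0"
    then show "(\<phi> ^^ k) z \<noteq> z" using period_divides_two by blast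
  qed
  then show ?thesis
    unfolding real_periodic_iff[OF f rf] only_real_fixed_second_iff[OF rf] \<phi> .
qed

lemma (in definite_pair) no_nonreal_second_iff:
  "(\<forall>z. Im z \<noteq> 0 \<longrightarrow> \<phi> (\<phi> z) \<noteq> z) \<longleftrightarrow> pos_semidef (d * d + 1) (bez R (pderiv R))"
  unfolding real_rooted_iff_pos_semidef[OF fixpoly_nonzero degree_fixpoly[OF deg_p deg_q], symmetric]
  using fixpoly_root_iff by blast

lemma real_periodic_iff_admissible:
  assumes d: "d \<ge> 2" and f: "f \<in> rat_deg d"
  shows "f \<in> real_periodic d \<and> real_fibered f \<longleftrightarrow> admissible d (numer f) (denom f)"
proof (cases "real_fibered f")
  case True
  interpret definite_pair d "numer f" "denom f" by (rule definite_pair_numer_denom[OF d f True])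
  have \<phi>: "rat_fun f = \<phi>" by (simp add: fun_eq_iff rat_fun_def \<phi>_def)
  show ?thesis
    unfolding real_periodic_iff_second_iterate[OF d f True] only_real_fixed_second_iff[OF True] \<phi>
      no_nonreal_second_iff admissible_def
    using True definite_bez by blast
next
  case False
  then show ?thesis using real_fibered_iff_definite(1)[OF f] d by (simp add: admissible_def)
qed

section \<open>Pairs of polynomials as coefficient vectors\<close>

definition num_poly :: "nat \<Rightarrow> (nat \<Rightarrow> real) \<Rightarrow> real poly" where
  "num_poly d v = (\<Sum>j\<le>d. monom (v (d - j)) j)"

definition den_poly :: "nat \<Rightarrow> (nat \<Rightarrow> real) \<Rightarrow> real poly" where
  "den_poly d v = (\<Sum>j\<le>d. monom (v (2 * d + 1 - j)) j)"

text \<open>Extends \<open>coeff_vec\<close> to pairs that are not the normalized numerator and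
  denominator of a function, such as perturbed pairs.\<close>

definition pair_vec :: "nat \<Rightarrow> real poly \<Rightarrow> real poly \<Rightarrow> nat \<Rightarrow> real" where
  "pair_vec d p q i = (if i \<le> d then coeff p (d - i)
    else if i \<le> 2 * d + 1 then coeff q (2 * d + 1 - i) else 0)"

lemma coeff_num_poly: "coeff (num_poly d v) j = (if j \<le> d then v (d - j) else 0)"
  by (auto simp: num_poly_def coeff_sum if_distrib cong: if_cong)

lemma coeff_den_poly: "coeff (den_poly d v) j = (if j \<le> d then v (2 * d + 1 - j) else 0)"
  by (auto simp: den_poly_def coeff_sum if_distrib cong: if_cong)

lemma degree_num_poly: "degree (num_poly d v) \<le> d"
  by (rule degree_le) (simp add: coeff_num_poly)

lemma degree_den_poly: "degree (den_poly d v) \<le> d"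
  by (rule degree_le) (simp add: coeff_den_poly)

lemma num_poly_pair_vec: "degree p \<le> d \<Longrightarrow> num_poly d (pair_vec d p q) = p"
  by (rule poly_eqI) (simp add: coeff_num_poly pair_vec_def coeff_eq_0)

lemma den_poly_pair_vec: "degree q \<le> d \<Longrightarrow> den_poly d (pair_vec d p q) = q"
  by (rule poly_eqI) (auto simp: coeff_den_poly pair_vec_def coeff_eq_0)

lemma pair_vec_num_den:
  assumes "\<And>i. i \<ge> 2 * d + 2 \<Longrightarrow> v i = 0"
  shows "pair_vec d (num_poly d v) (den_poly d v) = v"
  using assms by (auto simp: fun_eq_iff pair_vec_def coeff_num_poly coeff_den_poly)

lemma coeff_vec_eq_pair_vec: "coeff_vec d f = pair_vec d (numer f) (denom f)"
  by (simp add: fun_eq_iff coeff_vec_def pair_vec_def)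

lemma pair_vec_smult: "pair_vec d (smult c p) (smult c q) = (\<lambda>i. c * pair_vec d p q i)"
  by (simp add: fun_eq_iff pair_vec_def)

lemma num_poly_scale: "num_poly d (\<lambda>i. c * v i) = smult c (num_poly d v)"
  by (rule poly_eqI) (simp add: coeff_num_poly)

lemma den_poly_scale: "den_poly d (\<lambda>i. c * v i) = smult c (den_poly d v)"
  by (rule poly_eqI) (simp add: coeff_den_poly)

lemma num_den_coeff_vec:
  assumes "f \<in> rat_deg d"
  shows "num_poly d (coeff_vec d f) = numer f" "den_poly d (coeff_vec d f) = denom f"
  using assms unfolding coeff_vec_eq_pair_vec
  by (auto intro!: num_poly_pair_vec den_poly_pair_vec simp: rat_deg_def rat_degree_def)

text \<open>Every definite pair comes from a function of degree \<open>d\<close>; the scalar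
  \<open>c\<close> accounts for the monic denominator.\<close>

lemma (in definite_pair) realization:
  obtains f c where "f \<in> rat_deg d" "c \<noteq> 0" "numer f = smult c p" "denom f = smult c q"
    "coeff_vec d f = (\<lambda>i. c * pair_vec d p q i)"
proof -
  obtain c where c: "c \<noteq> 0" "numer (Fraction_Field.Fract p q) = smult c p"
    "denom (Fraction_Field.Fract p q) = smult c q"
    using numer_denom_Fract[OF coprime denominator_nonzero] .
  then have "Fraction_Field.Fract p q \<in> rat_deg d"
    using max_degree by (simp add: rat_deg_def rat_degree_def)
  moreover have "coeff_vec d (Fraction_Field.Fract p q) = (\<lambda>i. c * pair_vec d p q i)"
    unfolding coeff_vec_eq_pair_vec c pair_vec_smult ..
  ultimately show thesis using that c by blast
qed

section \<open>Open sets of rational functions\<close>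

lemma punctured_space_mem:
  "v \<in> topspace (punctured_space (Suc n)) \<longleftrightarrow> (\<forall>i\<ge>Suc n. v i = 0) \<and> v \<noteq> (\<lambda>_. 0)"
  by (auto simp: punctured_space_def topspace_Euclidean_space)

lemma openin_punctured_space:
  "openin (punctured_space n) S \<longleftrightarrow> (\<exists>W. open W \<and> S = W \<inter> topspace (punctured_space n))"
  unfolding punctured_space_def Euclidean_space_def subtopology_subtopology euclidean_product_topology
  by (simp add: openin_subtopology)

lemma proj_point_eq_iff: "proj_point v = proj_point w \<longleftrightarrow> (\<exists>c. c \<noteq> 0 \<and> v = (\<lambda>i. c * w i))"
proof
  assume eq: "proj_point v = proj_point w"
  have "v \<in> proj_point v" unfolding proj_point_def by (rule CollectI, rule exI[of _ 1]) simp
  then show "\<exists>c. c \<noteq> 0 \<and> v = (\<lambda>i. c * w i)" unfolding eq by (auto simp: proj_point_def)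
next
  assume "\<exists>c. c \<noteq> 0 \<and> v = (\<lambda>i. c * w i)"
  then obtain c where c: "c \<noteq> 0" "v = (\<lambda>i. c * w i)" by blast
  show "proj_point v = proj_point w"
  proof (intro equalityI subsetI)
    fix x assume "x \<in> proj_point v"
    then obtain k where "k \<noteq> 0" "x = (\<lambda>i. k * v i)" by (auto simp: proj_point_def)
    then have "k * c \<noteq> 0" "x = (\<lambda>i. (k * c) * w i)" using c by auto
    then show "x \<in> proj_point w" unfolding proj_point_def by blast
  next
    fix x assume "x \<in> proj_point w"
    then obtain k where "k \<noteq> 0" "x = (\<lambda>i. k * w i)" by (auto simp: proj_point_def)
    then have "k / c \<noteq> 0" "x = (\<lambda>i. (k / c) * v i)" using c by auto
    then show "x \<in> proj_point v" unfolding proj_point_def by blast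
  qed
qed

text \<open>The scalar allows membership in \<open>U\<close> to be tested on any representative of
  the projective point.\<close>

lemma openin_rat_topologyD:
  assumes U: "openin (rat_topology d) U" and f: "f \<in> U"
  obtains W where "open W" "coeff_vec d f \<in> W"
    "\<And>g c. g \<in> rat_deg d \<Longrightarrow> c \<noteq> 0 \<Longrightarrow> (\<lambda>i. c * coeff_vec d g i) \<in> W \<Longrightarrow> g \<in> U"
proof -
  let ?X = "punctured_space (Suc (2 * d + 1))"
  obtain V where V: "openin (real_projective_space (2 * d + 1)) V" and UV: "U = coeff_point d -` V \<inter> rat_deg d"
    using U unfolding rat_topology_def openin_pullback_topology by blast
  have "openin ?X {v \<in> topspace ?X. proj_point v \<in> V}"
    using V by (simp add: openin_real_projective_space)
  then obtain W where W: "open W" "{v \<in> topspace ?X. proj_point v \<in> V} = W \<inter> topspace ?X"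
    unfolding openin_punctured_space by blast
  have fr: "f \<in> rat_deg d" "coeff_point d f \<in> V" using f UV by auto
  have "coeff_vec d f \<in> W"
    using W(2) coeff_vec_in_punctured_space[OF fr(1)] fr(2) by (auto simp: coeff_point_def)
  moreover have "g \<in> U" if g: "g \<in> rat_deg d" "c \<noteq> 0" "(\<lambda>i. c * coeff_vec d g i) \<in> W" for g c
  proof -
    let ?v = "\<lambda>i. c * coeff_vec d g i"
    have "?v \<in> topspace ?X"
      using coeff_vec_in_punctured_space[OF g(1)] g(2)
      unfolding punctured_space_mem by (auto simp: fun_eq_iff)
    then have "proj_point ?v \<in> V" using W(2) g(3) by blast
    moreover have "proj_point ?v = proj_point (coeff_vec d g)"
      unfolding proj_point_eq_iff using g(2) by blast
    ultimately show ?thesis using UV g(1) by (simp add: coeff_point_def)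
  qed
  ultimately show thesis using that W(1) by blast
qed

text \<open>Passing to projective points is an open map: the cone over the image of \<open>W\<close>
  is the union \<open>S\<close> of the rescaled copies of \<open>W\<close>, restricted to the
  punctured space.\<close>

lemma openin_rat_topologyI:
  assumes W: "open W"
  shows "openin (rat_topology d) {f \<in> rat_deg d. \<exists>c. c \<noteq> 0 \<and> (\<lambda>i. c * coeff_vec d f i) \<in> W}"
proof -
  let ?X = "punctured_space (Suc (2 * d + 1))"
  define V where "V = proj_point ` (W \<inter> topspace ?X)"
  define S where "S = (\<Union>c\<in>-{0}. {v. (\<lambda>i. c * v i) \<in> W})"
  have "open S" unfolding S_def
  proof (intro open_UN ballI)
    fix c :: real
    have "continuous_on UNIV (\<lambda>(v::nat \<Rightarrow> real) i. c * v i)"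
      by (intro continuous_on_coordinatewise_then_product continuous_intros) auto
    then have "open ((\<lambda>(v::nat \<Rightarrow> real) i. c * v i) -` W)"
      using W by (simp add: open_vimage continuous_on_eq_continuous_at)
    then show "open {v. (\<lambda>i. c * v i) \<in> W}" by (simp add: vimage_def)
  qed
  have scale: "(\<lambda>i. c * v i) \<in> topspace ?X" if "v \<in> topspace ?X" "c \<noteq> 0" for v c
    using that unfolding punctured_space_mem by (auto simp: fun_eq_iff)
  have mem: "proj_point v \<in> V \<longleftrightarrow> v \<in> S" if v: "v \<in> topspace ?X" for v
  proof
    assume "proj_point v \<in> V"
    then obtain w where w: "w \<in> W" "proj_point w = proj_point v" by (auto simp: V_def)
    then obtain c where "c \<noteq> 0" "w = (\<lambda>i. c * v i)" unfolding proj_point_eq_iff by blast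
    then show "v \<in> S" using w(1) by (auto simp: S_def)
  next
    assume "v \<in> S"
    then obtain c where c: "c \<noteq> 0" "(\<lambda>i. c * v i) \<in> W" by (auto simp: S_def)
    then have "proj_point (\<lambda>i. c * v i) \<in> V" unfolding V_def using scale[OF v] by blast
    moreover have "proj_point (\<lambda>i. c * v i) = proj_point v"
      unfolding proj_point_eq_iff using c(1) by blast
    ultimately show "proj_point v \<in> V" by simp
  qed
  have "{v \<in> topspace ?X. proj_point v \<in> V} = S \<inter> topspace ?X" using mem by blast
  then have "openin (real_projective_space (2 * d + 1)) V"
    unfolding openin_real_projective_space openin_punctured_space
    using \<open>open S\<close> by (auto simp: V_def)
  moreover have "{f \<in> rat_deg d. \<exists>c. c \<noteq> 0 \<and> (\<lambda>i. c * coeff_vec d f i) \<in> W}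
      = coeff_point d -` V \<inter> rat_deg d"
    using mem[OF coeff_vec_in_punctured_space] by (auto simp: coeff_point_def S_def)
  ultimately show ?thesis unfolding rat_topology_def openin_pullback_topology by blast
qed

section \<open>Polynomial dependence on the coefficients\<close>

definition poly_family :: "nat \<Rightarrow> ((nat \<Rightarrow> real) \<Rightarrow> real poly) \<Rightarrow> bool" where
  "poly_family n \<Phi> \<longleftrightarrow> (\<forall>k. (\<lambda>v. coeff (\<Phi> v) k) \<in> polynomial_functions n)"

lemma poly_family_const: "poly_family n (\<lambda>v. p)"
  by (simp add: poly_family_def polynomial_functions.const)

lemma poly_family_diff: "poly_family n \<Phi> \<Longrightarrow> poly_family n \<Psi> \<Longrightarrow> poly_family n (\<lambda>v. \<Phi> v - \<Psi> v)"
  by (simp add: poly_family_def polynomial_functions_diff)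

lemma poly_family_sum: "(\<And>i. i \<in> I \<Longrightarrow> poly_family n (\<lambda>v. \<Phi> i v)) \<Longrightarrow> poly_family n (\<lambda>v. \<Sum>i\<in>I. \<Phi> i v)"
  by (simp add: poly_family_def coeff_sum polynomial_functions_sum)

lemma poly_family_mult: "poly_family n \<Phi> \<Longrightarrow> poly_family n \<Psi> \<Longrightarrow> poly_family n (\<lambda>v. \<Phi> v * \<Psi> v)"
  by (simp add: poly_family_def coeff_mult polynomial_functions_sum polynomial_functions.mult)

lemma poly_family_power: "poly_family n \<Phi> \<Longrightarrow> poly_family n (\<lambda>v. \<Phi> v ^ k)"
  by (induction k) (simp_all add: poly_family_const poly_family_mult)

lemma poly_family_smult:
  "(\<lambda>v. c v) \<in> polynomial_functions n \<Longrightarrow> poly_family n \<Phi> \<Longrightarrow> poly_family n (\<lambda>v. smult (c v) (\<Phi> v))"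
  by (simp add: poly_family_def polynomial_functions.mult)

lemma poly_family_pderiv: "poly_family n \<Phi> \<Longrightarrow> poly_family n (\<lambda>v. pderiv (\<Phi> v))"
  by (simp add: poly_family_def coeff_pderiv polynomial_functions.mult polynomial_functions.const
      del: of_nat_Suc)

lemma poly_family_num_poly: "poly_family (Suc (2 * d + 1)) (num_poly d)"
  unfolding poly_family_def
proof
  fix k show "(\<lambda>v. coeff (num_poly d v) k) \<in> polynomial_functions (Suc (2 * d + 1))"
    unfolding coeff_num_poly
    by (cases "k \<le> d") (auto intro: polynomial_functions.coord polynomial_functions.const)
qed

lemma poly_family_den_poly: "poly_family (Suc (2 * d + 1)) (den_poly d)"
  unfolding poly_family_def
proof
  fix k show "(\<lambda>v. coeff (den_poly d v) k) \<in> polynomial_functions (Suc (2 * d + 1))"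
    unfolding coeff_den_poly
    by (cases "k \<le> d") (auto intro: polynomial_functions.coord polynomial_functions.const)
qed

lemma poly_family_bez:
  assumes "poly_family n \<Phi>" "poly_family n \<Psi>"
  shows "(\<lambda>v. bez (\<Phi> v) (\<Psi> v) i j) \<in> polynomial_functions n"
  using assms unfolding bez_def poly_family_def
  by (intro polynomial_functions_sum polynomial_functions_diff polynomial_functions.mult) auto

lemma poly_family_fixpoly:
  assumes "poly_family n \<Phi>" "poly_family n \<Psi>"
  shows "poly_family n (\<lambda>v. fixpoly d (\<Phi> v) (\<Psi> v))"
proof -
  have *: "poly_family n (\<lambda>v. comp_form d (\<Theta> v) (\<Phi> v) (\<Psi> v))" if "poly_family n \<Theta>" for \<Theta>
    unfolding comp_form_def
    by (intro poly_family_sum poly_family_smult poly_family_mult poly_family_power assms)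
      (use that in \<open>simp add: poly_family_def\<close>)
  show ?thesis
    unfolding fixpoly_def by (intro poly_family_diff poly_family_mult poly_family_const * assms)
qed

abbreviation "bez_vec d v \<equiv> bez (num_poly d v) (den_poly d v)"
abbreviation "fixpoly_vec d v \<equiv> fixpoly d (num_poly d v) (den_poly d v)"

lemma bez_vec_polynomial: "(\<lambda>v. bez_vec d v i j) \<in> polynomial_functions (Suc (2 * d + 1))"
  by (intro poly_family_bez poly_family_num_poly poly_family_den_poly)

lemma fixpoly_vec_polynomial:
  "(\<lambda>v. bez (fixpoly_vec d v) (pderiv (fixpoly_vec d v)) i j) \<in> polynomial_functions (Suc (2 * d + 1))"
  by (intro poly_family_bez poly_family_pderiv poly_family_fixpoly poly_family_num_poly
      poly_family_den_poly)

lemma open_definite_bez_vec: "open {v. definite d (bez_vec d v)}"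
proof -
  have c: "continuous_on UNIV (\<lambda>v. bez_vec d v i j)" for i j
    by (rule continuous_on_polynomial_functions[OF bez_vec_polynomial])
  have "open {v. pos_def d (bez_vec d v)}" by (intro open_pos_def c sym_mat_bez)
  moreover have "open {v. pos_def d (\<lambda>i j. - bez_vec d v i j)}"
    using sym_mat_bez by (intro open_pos_def continuous_intros c) (simp add: sym_mat_def)
  ultimately show ?thesis unfolding definite_def by (rule open_Collect_disj)
qed

lemma sa_pred_admissible: "sa_pred (Suc (2 * d + 1)) (\<lambda>v. admissible d (num_poly d v) (den_poly d v))"
  unfolding admissible_def definite_def
proof (intro sa_pred_and sa_pred_or)
  show "sa_pred (Suc (2 * d + 1)) (\<lambda>v. pos_def d (bez_vec d v))"
    by (intro sa_pred_pos_def bez_vec_polynomial sym_mat_bez)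
  show "sa_pred (Suc (2 * d + 1)) (\<lambda>v. pos_def d (\<lambda>i j. - bez_vec d v i j))"
    using sym_mat_bez
    by (intro sa_pred_pos_def polynomial_functions_uminus bez_vec_polynomial) (simp add: sym_mat_def)
  show "sa_pred (Suc (2 * d + 1)) (\<lambda>v. pos_semidef (d * d + 1)
      (bez (fixpoly_vec d v) (pderiv (fixpoly_vec d v))))"
    by (intro sa_pred_pos_semidef fixpoly_vec_polynomial sym_mat_bez)
qed

definition fibered_periodic :: "nat \<Rightarrow> real poly fract set" where
  "fibered_periodic d = {f \<in> real_periodic d. real_fibered f}"

lemma fibered_periodic_subset: "fibered_periodic d \<subseteq> rat_deg d"
  by (auto simp: fibered_periodic_def real_periodic_def)

lemma fibered_periodic_iff_vec:
  assumes d: "d \<ge> 2" and f: "f \<in> rat_deg d" and c: "c \<noteq> 0" and v: "v = (\<lambda>i. c * coeff_vec d f i)"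
  shows "f \<in> fibered_periodic d \<longleftrightarrow> admissible d (num_poly d v) (den_poly d v)"
  using real_periodic_iff_admissible[OF d f] c
  by (simp add: fibered_periodic_def v num_poly_scale den_poly_scale num_den_coeff_vec[OF f] admissible_smult)

text \<open>The admissible vectors are exactly the cone over the set, because a definite Bezoutian
  forces degree \<open>d\<close> and excludes the zero vector.\<close>

lemma semialgebraic_fibered_periodic:
  assumes d: "d \<ge> 2"
  shows "semialgebraic_rat d (fibered_periodic d)"
proof -
  let ?X = "punctured_space (Suc (2 * d + 1))"
  have "{v \<in> topspace ?X. proj_point v \<in> coeff_point d ` fibered_periodic d}
    = {v \<in> topspace (Euclidean_space (Suc (2 * d + 1))). admissible d (num_poly d v) (den_poly d v)}"
    (is "?L = ?R")
  proof (intro equalityI subsetI)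
    fix v assume "v \<in> ?L"
    then obtain f where v: "v \<in> topspace ?X" and f: "f \<in> fibered_periodic d"
      and e: "proj_point v = proj_point (coeff_vec d f)"
      by (auto simp: coeff_point_def)
    obtain c where c: "c \<noteq> 0" "v = (\<lambda>i. c * coeff_vec d f i)"
      using e unfolding proj_point_eq_iff by blast
    have "f \<in> rat_deg d" using f fibered_periodic_subset by blast
    from fibered_periodic_iff_vec[OF d this c] f v show "v \<in> ?R"
      by (simp add: punctured_space_mem topspace_Euclidean_space)
  next
    fix v assume "v \<in> ?R"
    then have v: "\<And>i. i \<ge> 2 * d + 2 \<Longrightarrow> v i = 0" and a: "admissible d (num_poly d v) (den_poly d v)"
      by (auto simp: topspace_Euclidean_space)
    interpret definite_pair d "num_poly d v" "den_poly d v"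
      using d a by unfold_locales (auto simp: degree_num_poly degree_den_poly admissible_def)
    obtain f c where f: "f \<in> rat_deg d" "c \<noteq> 0"
      "coeff_vec d f = (\<lambda>i. c * pair_vec d (num_poly d v) (den_poly d v) i)"
      by (rule realization)
    have "pair_vec d (num_poly d v) (den_poly d v) = v" by (rule pair_vec_num_den) (rule v)
    then have cv: "coeff_vec d f = (\<lambda>i. c * v i)" using f(3) by simp
    then have "v = (\<lambda>i. inverse c * coeff_vec d f i)" using f(2) by (simp add: fun_eq_iff)
    from fibered_periodic_iff_vec[OF d f(1) _ this] a f(2) have "f \<in> fibered_periodic d" by simp
    moreover have "proj_point v = coeff_point d f"
      unfolding coeff_point_def proj_point_eq_iff
      using \<open>v = (\<lambda>i. inverse c * coeff_vec d f i)\<close> f(2) by (intro exI[of _ "inverse c"]) simp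
    moreover have "v \<noteq> (\<lambda>_. 0)"
      using coeff_vec_in_punctured_space[OF f(1)] unfolding punctured_space_mem cv by auto
    ultimately show "v \<in> ?L" using v by (auto simp: punctured_space_mem)
  qed
  moreover have "semialgebraic (Suc (2 * d + 1)) ?R"
    using sa_pred_admissible unfolding sa_pred_def .
  moreover have "coeff_point d ` fibered_periodic d \<subseteq> topspace (real_projective_space (2 * d + 1))"
    using fibered_periodic_subset coeff_vec_in_punctured_space
    unfolding topspace_real_projective_space coeff_point_def by blast
  ultimately show ?thesis
    unfolding semialgebraic_rat_def semialgebraic_proj_def using fibered_periodic_subset by simp
qed

text \<open>Among functions of degree \<open>d\<close> the semidefinite criterion \<open>C\<close>
  can replace the definite one, so that both conditions are closed.\<close>

lemma closedin_fibered_periodic: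
  assumes d: "d \<ge> 2"
  shows "closedin (rat_topology d) (fibered_periodic d)"
proof -
  define C where "C = {v. pos_semidef d (bez_vec d v)} \<union> {v. pos_semidef d (\<lambda>i j. - bez_vec d v i j)}"
  define D where "D = {v. pos_semidef (d * d + 1) (bez (fixpoly_vec d v) (pderiv (fixpoly_vec d v)))}"
  have "closed C" "closed D"
    unfolding C_def D_def
    by (intro closed_Un closed_pos_semidef continuous_intros
        continuous_on_polynomial_functions[OF bez_vec_polynomial]
        continuous_on_polynomial_functions[OF fixpoly_vec_polynomial])+
  then have o: "open (- (C \<inter> D))" by (intro open_Compl closed_Int)
  have mem: "f \<in> fibered_periodic d \<longleftrightarrow> (\<lambda>i. c * coeff_vec d f i) \<in> C \<inter> D"
    if f: "f \<in> rat_deg d" and c: "c \<noteq> 0" for f c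
  proof -
    have c2: "c\<^sup>2 > 0" using c by simp
    have d0: "d > 0" using d by simp
    have "(\<lambda>i. c * coeff_vec d f i) \<in> C \<longleftrightarrow> real_fibered f"
      using pos_semidef_scale[OF c2, of d "bez (numer f) (denom f)"]
        pos_semidef_scale[OF c2, of d "\<lambda>i j. - bez (numer f) (denom f) i j"]
      unfolding C_def real_fibered_iff_definite(2)[OF f d0]
      by (simp add: num_poly_scale den_poly_scale num_den_coeff_vec[OF f] bez_smult[abs_def])
    also have "\<dots> \<longleftrightarrow> definite d (bez_vec d (\<lambda>i. c * coeff_vec d f i))"
      using real_fibered_iff_definite(1)[OF f d0] definite_bez_smult[OF c, of d "numer f" "denom f"]
      by (simp add: num_poly_scale den_poly_scale num_den_coeff_vec[OF f])
    finally show ?thesis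
      unfolding fibered_periodic_iff_vec[OF d f c refl] admissible_def by (simp add: D_def)
  qed
  have "topspace (rat_topology d) - fibered_periodic d
      = {f \<in> rat_deg d. \<exists>c. c \<noteq> 0 \<and> (\<lambda>i. c * coeff_vec d f i) \<in> - (C \<inter> D)}"
    unfolding topspace_rat_topology using mem by (auto intro: exI[of _ "1::real"])
  then show ?thesis
    unfolding closedin_def using openin_rat_topologyI[OF o] fibered_periodic_subset
    by (simp add: topspace_rat_topology)
qed

section \<open>Multipliers and perturbations\<close>

context definite_pair
begin

text \<open>In the corner entry the indices of each product add up to \<open>2 * d - 1\<close>; only
  \<open>k = d - 1\<close> keeps both of them at most \<open>d\<close>.\<close>

lemma K_infinity:
  assumes "coeff q d = 0"
  shows "K (1, 0) (1, 0) = (coeff p d * coeff q (d - 1) :: real)"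
proof -
  let ?f = "\<lambda>k. coeff p ((d - 1) + (d - 1) + 1 - k) * coeff q k - coeff p k * coeff q ((d - 1) + (d - 1) + 1 - k)"
  have 0: "?f k = 0" if "k < d - 1" for k
  proof -
    have "(d - 1) + (d - 1) + 1 - k > d" using that by linarith
    then show ?thesis using deg_p deg_q by (simp add: coeff_eq_0)
  qed
  have e: "(d - 1) + (d - 1) + 1 - (d - 1) = d" using two_le by simp
  have "bez p q (d - 1) (d - 1) = (\<Sum>k\<in>{d - 1}. ?f k)"
    unfolding bez_def min.idem
  proof (rule sum.mono_neutral_right)
    show "\<forall>k\<in>{..d - 1} - {d - 1}. ?f k = 0"
    proof
      fix k assume "k \<in> {..d - 1} - {d - 1}"
      then have "k < d - 1" by auto
      then show "?f k = 0" by (rule 0)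
    qed
  qed simp_all
  also have "\<dots> = ?f (d - 1)" by simp
  also have "\<dots> = coeff p d * coeff q (d - 1)" unfolding e using assms by simp
  finally show ?thesis using two_le by (simp add: kernel_infinity)
qed

text \<open>Rescaling a fixed vector multiplies the kernel and \<open>\<kappa>\<^sup>2\<close> by
  the same positive \<open>r\<close>, so comparisons between them can be made at
  \<open>(x, 1)\<close> or \<open>(1, 0)\<close>.\<close>

lemma fixed_vector_cases:
  fixes a b \<kappa> :: real
  assumes E: "(a, b) \<noteq> (0, 0)" and F: "F (a, b) = (\<kappa> * a, \<kappa> * b)"
  obtains (finite) x r where "r > 0" "poly p x = x * poly q x" "poly q x \<noteq> 0"
      "K (a, b) (a, b) = r * K (x, 1) (x, 1)" "\<kappa>\<^sup>2 = r * (poly q x)\<^sup>2"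
    | (infinite) r where "r > 0" "coeff q d = 0" "coeff p d \<noteq> 0"
      "K (a, b) (a, b) = r * K (1, 0) (1, 0)" "\<kappa>\<^sup>2 = r * (coeff p d)\<^sup>2"
proof (cases "b = 0")
  case False
  have ab: "(a, b) = (b * (a / b), b * 1)" using False by simp
  have "F (b * (a / b), b * 1) = (b ^ d * poly p (a / b), b ^ d * poly q (a / b))"
    unfolding form_pair_def hform_scale by (simp add: hform_affine_real deg_p deg_q)
  then have e: "b ^ d * poly p (a / b) = \<kappa> * a" "b ^ d * poly q (a / b) = \<kappa> * b"
    using F ab by simp_all
  have bd: "b ^ d = b ^ (d - 1) * b" using two_le by (simp flip: power_Suc2)
  have \<kappa>: "\<kappa> = b ^ (d - 1) * poly q (a / b)"
    using e(2) False unfolding bd by (simp add: field_simps)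
  have pq: "poly p (a / b) = a / b * poly q (a / b)"
    using e(1) False unfolding \<kappa> bd by (simp add: field_simps)
  have "poly q (a / b) \<noteq> 0"
  proof
    assume q0: "poly q (a / b) = 0"
    then have "F (a / b, 1) = (0, 0)" using pq by (simp add: form_pair_def hform_affine_real deg_p deg_q)
    then show False using F_nonzero_real[of "a / b" 1] by simp
  qed
  moreover have "K (a, b) (a, b) = (b ^ (d - 1))\<^sup>2 * K (a / b, 1) (a / b, 1)"
    unfolding ab kernel_scale_left kernel_scale_right using False by (simp add: power2_eq_square)
  ultimately show thesis
    using finite[of "(b ^ (d - 1))\<^sup>2" "a / b"] False pq by (simp add: \<kappa> power_mult_distrib)
next
  case True
  then have a: "a \<noteq> 0" using E by simp
  have ad: "a ^ d = a ^ (d - 1) * a" using two_le by (simp flip: power_Suc2)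
  have F': "F (a, 0) = (coeff p d * a ^ d, coeff q d * a ^ d)" by (simp add: form_pair_def hform_infinity)
  then have q0: "coeff q d = 0" using F True a by simp
  have "coeff p d * a ^ d = \<kappa> * a" using F F' True by simp
  then have \<kappa>: "\<kappa> = a ^ (d - 1) * coeff p d" using a unfolding ad by (auto simp: mult.commute)
  have "coeff p d \<noteq> 0" using F_nonzero_real[OF E] F' True q0 by auto
  moreover have "K (a, b) (a, b) = (a ^ (d - 1))\<^sup>2 * K (1, 0) (1, 0)"
    using kernel_scale_left[of d p q a 1 0 "(a * 1, a * 0)"] kernel_scale_right[of d p q "(1, 0)" a 1 0] True
    by (simp add: power2_eq_square)
  ultimately show thesis
    using infinite[of "(a ^ (d - 1))\<^sup>2"] a q0 by (simp add: \<kappa> power_mult_distrib)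
qed

lemma K_real_nonzero: "(a, b) \<noteq> (0, 0) \<Longrightarrow> K (a, b) (a, b) \<noteq> (0::real)"
proof -
  assume "(a, b) \<noteq> (0, 0 :: real)"
  then have "wedge (a, b) (- b, a) \<noteq> (0::real)"
    by (simp add: wedge_def sum_squares_eq_zero_iff)
  from K_strict_real[OF this] show ?thesis
    by (auto simp: not_less)
qed

end

section \<open>Multipliers of fixed points\<close>

lemma deriv_rat_fun:
  assumes "degree (numer f) \<le> d" "degree (denom f) \<le> d" and q: "ceval (denom f) w \<noteq> 0"
  shows "deriv (rat_fun f) w = kernel d (numer f) (denom f) (w, 1) (w, 1) / (ceval (denom f) w)\<^sup>2"
proof -
  have "DERIV (\<lambda>w. ceval (numer f) w / ceval (denom f) w) w
    :> (poly (pderiv (cpoly (numer f))) w * ceval (denom f) w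
      - ceval (numer f) w * poly (pderiv (cpoly (denom f))) w)
      / (ceval (denom f) w * ceval (denom f) w)"
    using q by (intro DERIV_divide poly_DERIV)
  then show ?thesis
    unfolding rat_fun_def[abs_def]
    by (simp add: DERIV_imp_deriv kernel_diag assms cpoly_def power2_eq_square)
qed

text \<open>In the coordinate \<open>1 / w\<close> the derivative becomes \<open>G\<close>, with
  limit \<open>k / q_{d-1}^2\<close> at 0. As \<open>k = p_d q_{d-1}\<close>, the inverse of this
  limit is \<open>k / p_d^2\<close>. The finite limit excludes the first branch of
  \<open>multiplier\<close>.\<close>

lemma multiplier_infinity:
  assumes d: "d \<ge> 2" and f: "f \<in> rat_deg d" and rf: "real_fibered f" and q: "coeff (denom f) d = 0"
  shows "multiplier f None
    = of_real (kernel d (numer f) (denom f) (1, 0) (1, 0) / (coeff (numer f) d)\<^sup>2)"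
proof -
  interpret definite_pair d "numer f" "denom f" by (rule definite_pair_numer_denom[OF d f rf])
  let ?p = "numer f" and ?q = "denom f"
  define k :: real where "k = K (1, 0) (1, 0)"
  have k: "k = coeff ?p d * coeff ?q (d - 1)" unfolding k_def by (rule K_infinity[OF q])
  have "k \<noteq> 0" unfolding k_def by (rule K_real_nonzero) simp
  then have nz: "coeff ?p d \<noteq> 0" "coeff ?q (d - 1) \<noteq> 0" using k by auto
  have dq: "degree ?q \<le> d - 1"
  proof (rule degree_le, intro allI impI)
    fix i assume "d - 1 < i"
    then show "coeff ?q i = 0" using q deg_q by (cases "i = d") (auto intro: coeff_eq_0)
  qed
  define G where "G y = K (1, y) (1, y) / (hform (d - 1) ?q (1, y))\<^sup>2" for y :: complex
  have G0: "G 0 = of_real (k / (coeff ?q (d - 1))\<^sup>2)"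
    unfolding G_def k_def using kernel_of_real[of d ?p ?q 1 0 1 0, where 'a = complex]
    by (simp add: hform_infinity del: One_nat_def)
  have eq: "deriv (rat_fun f) w = G (inverse w)" if w: "w \<noteq> 0" "ceval ?q w \<noteq> 0" for w
  proof -
    have "ceval ?q w = hform (d - 1) ?q (w * 1, w * inverse w)"
      using w(1) hform_affine_complex[OF dq, of w] by simp
    then have 1: "ceval ?q w = w ^ (d - 1) * hform (d - 1) ?q (1, inverse w)"
      unfolding hform_scale .
    have "K (w, 1) (w, 1) = K (w * 1, w * inverse w) (w * 1, w * inverse w)" using w(1) by simp
    then have 2: "K (w, 1) (w, 1) = (w ^ (d - 1))\<^sup>2 * K (1, inverse w) (1, inverse w)"
      unfolding kernel_scale_left kernel_scale_right by (simp add: power2_eq_square)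
    show ?thesis
      unfolding deriv_rat_fun[OF deg_p deg_q w(2)] 2 unfolding 1 G_def
      using w(1) by (simp add: power_mult_distrib)
  qed
  have "bounded {w. ceval ?q w = 0}"
    by (intro finite_imp_bounded poly_roots_finite) (simp add: denom_nonzero)
  then obtain B where B: "B > 0" "\<And>w. ceval ?q w = 0 \<Longrightarrow> norm w \<le> B"
    unfolding bounded_pos by blast
  have ev: "eventually (\<lambda>w. deriv (rat_fun f) w = G (inverse w)) at_infinity"
    unfolding eventually_at_infinity
  proof (intro exI[of _ "B + 1"] allI impI)
    fix w :: complex assume w: "B + 1 \<le> norm w"
    have "w \<noteq> 0" using w B(1) by auto
    moreover have "ceval ?q w \<noteq> 0" using B(2)[of w] w by auto
    ultimately show "deriv (rat_fun f) w = G (inverse w)" by (rule eq)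
  qed
  have "continuous_on UNIV (\<lambda>y::complex. K (1, y) (1, y))"
    "continuous_on UNIV (\<lambda>y::complex. hform (d - 1) ?q (1, y))"
    by (intro continuous_intros)+
  then have "isCont G 0"
    unfolding G_def using nz(2)
    by (intro continuous_intros) (simp_all add: continuous_on_eq_continuous_at hform_infinity del: One_nat_def)
  then have "((\<lambda>w. G (inverse w)) \<longlongrightarrow> G 0) at_infinity"
    using tendsto_inverse_0 by (rule isCont_tendsto_compose)
  then have lim: "(deriv (rat_fun f) \<longlongrightarrow> G 0) at_infinity"
    using tendsto_cong[OF ev] by simp
  then have "\<not> filterlim (deriv (rat_fun f)) at_infinity at_infinity"
    using not_tendsto_and_filterlim_at_infinity trivial_limit_at_infinity by blast
  moreover have "Lim at_infinity (deriv (rat_fun f)) = G 0"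
    by (rule tendsto_Lim[OF trivial_limit_at_infinity lim])
  ultimately have "multiplier f None = inverse (G 0)" by (simp add: multiplier_def)
  also have "\<dots> = of_real (inverse (k / (coeff ?q (d - 1))\<^sup>2))"
    unfolding G0 by (rule of_real_inverse[symmetric])
  also have "inverse (k / (coeff ?q (d - 1))\<^sup>2) = k / (coeff ?p d)\<^sup>2"
    using nz by (simp add: k field_simps power2_eq_square)
  finally show ?thesis unfolding k_def .
qed

lemma multiplier_finite:
  assumes d: "d \<ge> 2" and f: "f \<in> rat_deg d" and q: "poly (denom f) x \<noteq> 0"
  shows "multiplier f (Some (of_real x))
    = of_real (kernel d (numer f) (denom f) (x, 1) (x, 1) / (poly (denom f) x)\<^sup>2)"
proof -
  have deg: "degree (numer f) \<le> d" "degree (denom f) \<le> d"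
    using f by (auto simp: rat_deg_def rat_degree_def)
  have "ceval (denom f) (of_real x) \<noteq> 0" using q by (simp add: poly_cpoly_of_real)
  from deriv_rat_fun[OF deg this] show ?thesis
    using kernel_of_real[of d "numer f" "denom f" x 1 x 1, where 'a = complex]
    by (simp add: multiplier_def poly_cpoly_of_real)
qed

lemma norm_quotient_eq_1: "norm (complex_of_real (k / l\<^sup>2)) = 1 \<longleftrightarrow> \<bar>k\<bar> = l\<^sup>2" if "l \<noteq> 0"
  using that by (auto simp: norm_divide norm_power)

text \<open>Nonreal fixed points are attracting, so an indifferent one is given by a real
  vector.\<close>

lemma has_indifferent_fixed_point_iff:
  assumes d: "d \<ge> 2" and f: "f \<in> rat_deg d" and rf: "real_fibered f"
  shows "has_indifferent_fixed_point f \<longleftrightarrow>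
    (\<exists>a b \<kappa> :: real. (a, b) \<noteq> (0, 0) \<and> form_pair d (numer f) (denom f) (a, b) = (\<kappa> * a, \<kappa> * b)
      \<and> \<bar>kernel d (numer f) (denom f) (a, b) (a, b)\<bar> = \<kappa>\<^sup>2)"
proof -
  interpret definite_pair d "numer f" "denom f" by (rule definite_pair_numer_denom[OF d f rf])
  let ?p = "numer f" and ?q = "denom f"
  have \<phi>: "rat_fun f = \<phi>" by (simp add: fun_eq_iff rat_fun_def \<phi>_def)
  have rd: "rat_degree f = d" using f by (simp add: rat_deg_def)
  show ?thesis
  proof
    assume "has_indifferent_fixed_point f"
    then obtain z where z: "rat_map f z = z" "norm (multiplier f z) = 1"
      unfolding has_indifferent_fixed_point_def by blast
    show "\<exists>a b \<kappa> :: real. (a, b) \<noteq> (0, 0) \<and> F (a, b) = (\<kappa> * a, \<kappa> * b) \<and> \<bar>K (a, b) (a, b)\<bar> = \<kappa>\<^sup>2"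
    proof (cases z)
      case None
      then have q0: "coeff ?q d = 0" using z(1) by (auto simp: rat_map_def rd split: if_splits)
      have F10: "F (1, 0 :: real) = (coeff ?p d, 0)" by (simp add: form_pair_def hform_infinity q0)
      then have "coeff ?p d \<noteq> 0" using F_nonzero_real[of 1 0] by auto
      then have "\<bar>K (1, 0) (1, 0)\<bar> = (coeff ?p d)\<^sup>2"
        using z(2) None multiplier_infinity[OF d f rf q0] norm_quotient_eq_1 by metis
      then show ?thesis using F10
        by (intro exI[of _ "1::real"] exI[of _ "0::real"] exI[of _ "coeff ?p d"]) simp
    next
      case (Some w)
      then have qw: "ceval ?q w \<noteq> 0" and fw: "\<phi> w = w"
        using z(1) by (auto simp: rat_map_def \<phi> split: if_splits)
      have "Im w = 0"
      proof (rule ccontr)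
        assume "Im w \<noteq> 0"
        from nonreal_fixed_multiplier[OF this fw]
        have "cmod (K (w, 1) (w, 1)) < (cmod (ceval ?q w))\<^sup>2"
          by (simp add: kernel_diag deg_p deg_q cpoly_pderiv flip: cpoly_def)
        then have "cmod (multiplier f z) < 1"
          unfolding multiplier_def using qw
          by (simp add: Some deriv_rat_fun[OF deg_p deg_q qw] norm_divide norm_power)
        then show False using z(2) by simp
      qed
      then have "w = of_real (Re w)" by (simp add: complex_eq_iff)
      then obtain x where x: "w = of_real x" by blast
      have qx: "poly ?q x \<noteq> 0" using qw by (simp add: x poly_cpoly_of_real)
      have "complex_of_real (poly ?p x / poly ?q x) = of_real x"
        using fw by (simp add: x \<phi>_def poly_cpoly_of_real)
      then have "poly ?p x / poly ?q x = x" by (simp only: of_real_eq_iff)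
      then have "poly ?p x = poly ?q x * x" using qx by (simp add: field_simps)
      then have "F (x, 1) = (poly ?q x * x, poly ?q x * 1)"
        by (simp add: form_pair_def hform_affine_real deg_p deg_q)
      moreover have "\<bar>K (x, 1) (x, 1)\<bar> = (poly ?q x)\<^sup>2"
        using z(2) Some x multiplier_finite[OF d f qx] norm_quotient_eq_1[OF qx] by metis
      ultimately show ?thesis
        by (intro exI[of _ x] exI[of _ "1::real"] exI[of _ "poly ?q x"]) simp
    qed
  next
    assume "\<exists>a b \<kappa> :: real. (a, b) \<noteq> (0, 0) \<and> F (a, b) = (\<kappa> * a, \<kappa> * b) \<and> \<bar>K (a, b) (a, b)\<bar> = \<kappa>\<^sup>2"
    then obtain a b \<kappa> :: real where E: "(a, b) \<noteq> (0, 0)" "F (a, b) = (\<kappa> * a, \<kappa> * b)"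
      and K: "\<bar>K (a, b) (a, b)\<bar> = \<kappa>\<^sup>2" by blast
    from E show "has_indifferent_fixed_point f"
    proof (cases rule: fixed_vector_cases)
      case (finite x r)
      then have "\<bar>K (x, 1) (x, 1)\<bar> = (poly ?q x)\<^sup>2" using K by (simp add: abs_mult)
      then have "norm (multiplier f (Some (of_real x))) = 1"
        unfolding multiplier_finite[OF d f finite(3)] norm_quotient_eq_1[OF finite(3)] .
      moreover have "rat_map f (Some (of_real x)) = Some (of_real x)"
        using finite(2,3) by (simp add: rat_map_def rat_fun_def poly_cpoly_of_real)
      ultimately show ?thesis unfolding has_indifferent_fixed_point_def by blast
    next
      case (infinite r)
      then have "\<bar>K (1, 0) (1, 0)\<bar> = (coeff ?p d)\<^sup>2" using K by (simp add: abs_mult)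
      then have "norm (multiplier f None) = 1"
        unfolding multiplier_infinity[OF d f rf infinite(2)] norm_quotient_eq_1[OF infinite(3)] .
      moreover have "rat_map f None = None" using infinite(2) by (simp add: rat_map_def rd)
      ultimately show ?thesis unfolding has_indifferent_fixed_point_def by blast
    qed
  qed
qed

lemma fibered_periodic_second_iterate:
  assumes "f \<in> fibered_periodic d" "Im z \<noteq> 0"
  shows "rat_fun f (rat_fun f z) \<noteq> z"
proof -
  have "f \<in> rat_deg d" using assms(1) fibered_periodic_subset by blast
  moreover have "f \<in> real_periodic d" "real_fibered f" using assms(1) by (auto simp: fibered_periodic_def)
  ultimately have "(rat_fun f ^^ 2) z \<noteq> z" using real_periodic_iff assms(2) by simp
  then show ?thesis by (simp add: numeral_2_eq_2)
qed

section \<open>Perturbation of fixed points and the boundary\<close>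

text \<open>A nonreal point that a real function sends to itself or to its conjugate is fixed by the
  second iterate. For small \<open>\<epsilon>\<close> the perturbed pair is still definite and
  represents a function in \<open>U\<close>, which cannot have such a point.\<close>

lemma not_interior_if_perturbed:
  assumes d: "d \<ge> 2" and f: "f \<in> rat_deg d" and rf: "real_fibered f"
    and a: "degree a \<le> d" and b: "degree b \<le> d"
    and fp: "\<And>\<epsilon>::real. \<epsilon> > 0 \<Longrightarrow> \<exists>z w. Im z \<noteq> 0 \<and> (w = z \<or> w = cnj z)
      \<and> ceval (numer f + smult (\<epsilon>\<^sup>2) a) z = w * ceval (denom f + smult (\<epsilon>\<^sup>2) b) z"
    and U: "openin (rat_topology d) U" "f \<in> U" "U \<subseteq> fibered_periodic d"
  shows False
proof -
  interpret f: definite_pair d "numer f" "denom f" by (rule definite_pair_numer_denom[OF d f rf])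
  obtain W where W: "open W" "coeff_vec d f \<in> W"
    "\<And>g c. g \<in> rat_deg d \<Longrightarrow> c \<noteq> 0 \<Longrightarrow> (\<lambda>i. c * coeff_vec d g i) \<in> W \<Longrightarrow> g \<in> U"
    using openin_rat_topologyD[OF U(1,2)] by blast
  define p where "p \<epsilon> = numer f + smult (\<epsilon>\<^sup>2) a" for \<epsilon> :: real
  define q where "q \<epsilon> = denom f + smult (\<epsilon>\<^sup>2) b" for \<epsilon> :: real
  define v where "v \<epsilon> = pair_vec d (p \<epsilon>) (q \<epsilon>)" for \<epsilon>
  have deg: "degree (p \<epsilon>) \<le> d" "degree (q \<epsilon>) \<le> d" for \<epsilon>
    unfolding p_def q_def using f.deg_p f.deg_q a b
    by (auto intro!: degree_add_le intro: order_trans[OF degree_smult_le])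
  define O' where "O' = W \<inter> {v. definite d (bez_vec d v)}"
  have "open O'" unfolding O'_def by (intro open_Int W(1) open_definite_bez_vec)
  have "continuous_on UNIV v"
  proof (rule continuous_on_coordinatewise_then_product)
    fix i
    consider "i \<le> d" | "d < i" "i \<le> 2 * d + 1" | "2 * d + 1 < i" by linarith
    then show "continuous_on UNIV (\<lambda>\<epsilon>. v \<epsilon> i)"
      by cases (simp_all add: v_def pair_vec_def p_def q_def continuous_intros)
  qed
  then have op: "open (v -` O')"
    using \<open>open O'\<close> by (simp add: open_vimage)
  have "v 0 = coeff_vec d f" unfolding v_def p_def q_def coeff_vec_eq_pair_vec by simp
  then have "0 \<in> v -` O'"
    using W(2) f.definite_bez num_den_coeff_vec[OF f] by (simp add: O'_def)
  then obtain e where e: "e > 0" "ball 0 e \<subseteq> v -` O'"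
    using op unfolding open_contains_ball by blast
  define \<epsilon> where "\<epsilon> = e / 2"
  have \<epsilon>: "\<epsilon> > 0" using e(1) by (simp add: \<epsilon>_def)
  have "\<epsilon> \<in> ball 0 e" using e(1) by (simp add: \<epsilon>_def)
  then have v: "v \<epsilon> \<in> W" "definite d (bez_vec d (v \<epsilon>))" using e(2) by (auto simp: O'_def)
  then have "definite d (bez (p \<epsilon>) (q \<epsilon>))"
    by (simp add: v_def num_poly_pair_vec den_poly_pair_vec deg)
  then interpret definite_pair d "p \<epsilon>" "q \<epsilon>"
    by unfold_locales (simp_all add: d deg)
  obtain g c where g: "g \<in> rat_deg d" "c \<noteq> 0" "numer g = smult c (p \<epsilon>)" "denom g = smult c (q \<epsilon>)"
    "coeff_vec d g = (\<lambda>i. c * pair_vec d (p \<epsilon>) (q \<epsilon>) i)"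
    by (rule realization)
  have "(\<lambda>i. inverse c * coeff_vec d g i) = v \<epsilon>"
    using g(2,5) by (simp add: fun_eq_iff v_def)
  then have "g \<in> U" using W(3)[OF g(1), of "inverse c"] g(2) v(1) by simp
  then have gA: "g \<in> fibered_periodic d" using U(3) by blast
  have \<phi>: "rat_fun g = \<phi>" using g(2) by (simp add: fun_eq_iff rat_fun_def \<phi>_def g(3,4))
  obtain z w where z: "Im z \<noteq> 0" "w = z \<or> w = cnj z"
    "ceval (p \<epsilon>) z = w * ceval (q \<epsilon>) z"
    using fp[OF \<epsilon>] unfolding p_def q_def by blast
  have w: "\<phi> z = w" using z(3) q_nonzero[OF z(1)] by (simp add: \<phi>_def)
  have "\<phi> (cnj z) = cnj (\<phi> z)" by (simp add: \<phi>_def poly_cpoly_cnj)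
  then have "\<phi> (\<phi> z) = z" using z(2) w by auto
  then show False using fibered_periodic_second_iterate[OF gA z(1)] by (simp add: \<phi>)
qed

lemma not_interior_if_indifferent:
  fixes a b \<kappa> :: real
  assumes d: "d \<ge> 2" and f: "f \<in> rat_deg d" and rf: "real_fibered f"
    and E: "(a, b) \<noteq> (0, 0)" and F: "form_pair d (numer f) (denom f) (a, b) = (\<kappa> * a, \<kappa> * b)"
    and K: "\<bar>kernel d (numer f) (denom f) (a, b) (a, b)\<bar> = \<kappa>\<^sup>2"
    and U: "openin (rat_topology d) U" "f \<in> U" "U \<subseteq> fibered_periodic d"
  shows False
proof -
  interpret definite_pair d "numer f" "denom f" by (rule definite_pair_numer_denom[OF d f rf])
  let ?p = "numer f" and ?q = "denom f"
  from E F show False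
  proof (cases rule: fixed_vector_cases)
    case (finite x r)
    have "\<bar>K (x, 1) (x, 1)\<bar> = (poly ?q x)\<^sup>2" using K finite(1,4,5) by (simp add: abs_mult)
    then have "K (x, 1) (x, 1) = (poly ?q x)\<^sup>2 \<or> K (x, 1) (x, 1) = - (poly ?q x)\<^sup>2"
      by (auto simp: abs_if split: if_splits)
    then obtain \<sigma> :: real where s: "\<sigma> = 1 \<or> \<sigma> = - 1" and Ks: "K (x, 1) (x, 1) = \<sigma> * (poly ?q x)\<^sup>2"
      by (metis mult_1 mult_minus1)
    \<comment> \<open>Here \<open>\<sigma>\<close> is the multiplier, so \<open>f(z)\<close> agrees
      with \<open>x + \<sigma> (z - x)\<close> to first order and \<open>h\<close> vanishes doubly
      at \<open>x\<close>. The cofactor \<open>s\<close> is the perturbation.\<close>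
    define h where "h = ?p - smult x ?q - smult \<sigma> ([:- x, 1:] * ?q)"
    have "poly h x = 0" using finite(2) by (simp add: h_def)
    then obtain h1 where h1: "h = [:- x, 1:] * h1" unfolding poly_eq_0_iff_dvd by (rule dvdE)
    have dh: "pderiv h = pderiv ?p - smult x (pderiv ?q) - smult \<sigma> ([:- x, 1:] * pderiv ?q + ?q)"
      unfolding h_def pderiv_diff pderiv_smult pderiv_mult by (simp add: pderiv_pCons)
    have "poly (pderiv h) x * poly ?q x = K (x, 1) (x, 1) - \<sigma> * (poly ?q x)\<^sup>2"
      unfolding dh kernel_diag[OF deg_p deg_q]
      by (simp add: finite(2) power2_eq_square algebra_simps)
    then have "poly (pderiv h) x = 0" using finite(3) Ks by simp
    moreover have "poly (pderiv h) x = poly h1 x"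
      unfolding h1 pderiv_mult by (simp add: pderiv_pCons)
    ultimately have "poly h1 x = 0" by simp
    then obtain s where "h1 = [:- x, 1:] * s" unfolding poly_eq_0_iff_dvd by (rule dvdE)
    then have hs: "h = [:- x, 1:] * ([:- x, 1:] * s)" using h1 by simp
    have "degree ([:- x, 1:] * ?q) \<le> Suc d"
      using deg_q by (intro order_trans[OF degree_mult_le]) simp
    then have "degree h \<le> Suc d"
      unfolding h_def using deg_p deg_q
      by (intro degree_diff_le order_trans[OF degree_smult_le]) auto
    moreover have "degree h = Suc (Suc (degree s))" if "s \<noteq> 0"
      unfolding hs using that by (simp add: degree_mult_eq del: mult_pCons_left)
    ultimately have ds: "degree s \<le> d" by (cases "s = 0") auto
    show False
    proof (rule not_interior_if_perturbed[OF d f rf ds _ _ U])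
      show "degree (0 :: real poly) \<le> d" by simp
      fix \<epsilon> :: real assume e: "\<epsilon> > 0"
      \<comment> \<open>At this point \<open>(z - x)^2\<close> is \<open>- \<epsilon>^2\<close>, so
        the perturbation cancels the quadratic term and \<open>z\<close> goes to
        \<open>x + \<sigma> \<i> \<epsilon>\<close>, which is \<open>z\<close> or its
        conjugate.\<close>
      define z where "z = of_real x + \<i> * of_real \<epsilon>"
      define w where "w = of_real x + of_real \<sigma> * \<i> * of_real \<epsilon>"
      have "w = z \<or> w = cnj z" using s by (auto simp: z_def w_def)
      moreover have "Im z \<noteq> 0" using e by (simp add: z_def)
      moreover have "ceval (?p + smult (\<epsilon>\<^sup>2) s) z = w * ceval (?q + smult (\<epsilon>\<^sup>2) 0) z"
      proof -
        have "?p = h + smult x ?q + smult \<sigma> ([:- x, 1:] * ?q)" by (simp add: h_def)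
        then have "ceval ?p z = ceval (h + smult x ?q + smult \<sigma> ([:- x, 1:] * ?q)) z"
          by (rule arg_cong)
        also have "\<dots> = (z - of_real x) * (z - of_real x) * ceval s z
            + (of_real x + of_real \<sigma> * (z - of_real x)) * ceval ?q z"
          unfolding hs by (simp add: algebra_simps)
        finally have P: "ceval ?p z = (z - of_real x) * (z - of_real x) * ceval s z
            + (of_real x + of_real \<sigma> * (z - of_real x)) * ceval ?q z" .
        have sq: "(z - of_real x) * (z - of_real x) = - (of_real (\<epsilon>\<^sup>2))"
          by (simp add: z_def power2_eq_square algebra_simps)
        have w: "of_real x + of_real \<sigma> * (z - of_real x) = w"
          by (simp add: z_def w_def)
        have "ceval ?p z = - (of_real (\<epsilon>\<^sup>2)) * ceval s z + w * ceval ?q z"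
          using P unfolding sq w .
        then show ?thesis by simp
      qed
      ultimately show "\<exists>z w. Im z \<noteq> 0 \<and> (w = z \<or> w = cnj z)
          \<and> ceval (?p + smult (\<epsilon>\<^sup>2) s) z = w * ceval (?q + smult (\<epsilon>\<^sup>2) 0) z"
        by blast
    qed
  next
    case (infinite r)
    have "\<bar>K (1, 0) (1, 0)\<bar> = (coeff ?p d)\<^sup>2" using K infinite(1,4,5) by (simp add: abs_mult)
    then have "K (1, 0) (1, 0) = (coeff ?p d)\<^sup>2 \<or> K (1, 0) (1, 0) = - (coeff ?p d)\<^sup>2"
      by (auto simp: abs_if split: if_splits)
    then obtain \<sigma> :: real where s: "\<sigma> = 1 \<or> \<sigma> = - 1" and Ks: "K (1, 0) (1, 0) = \<sigma> * (coeff ?p d)\<^sup>2"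
      by (metis mult_1 mult_minus1)
    have ss: "\<sigma> * \<sigma> = 1" using s by auto
    have "coeff ?p d * coeff ?q (d - 1) = coeff ?p d * (\<sigma> * coeff ?p d)"
      using Ks unfolding K_infinity[OF infinite(2)] by (simp add: power2_eq_square mult_ac)
    then have cq: "coeff ?q (d - 1) = \<sigma> * coeff ?p d" using infinite(3) by (simp only: mult_cancel_left) simp
    \<comment> \<open>The analogue at infinity: \<open>f(z)\<close> agrees with
      \<open>\<sigma> z\<close> to first order, so the coefficients of \<open>h\<close> from degree
      \<open>d\<close> on cancel.\<close>
    define h where "h = ?p - smult \<sigma> (pCons 0 ?q)"
    have dh: "degree h \<le> d - 1"
    proof (rule degree_le, intro allI impI)
      fix i assume i: "d - 1 < i"
      consider "i = d" | "i > d" using i by linarith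
      then show "coeff h i = 0"
      proof cases
        case 1
        obtain m where m: "d = Suc m" using two_le by (cases d) auto
        show ?thesis using cq ss by (simp add: h_def 1 m flip: mult.assoc)
      next
        case 2
        obtain m where m: "i = Suc m" using 2 by (cases i) auto
        have "coeff ?q m = 0" using 2 m infinite(2) deg_q by (cases "m = d") (auto intro: coeff_eq_0)
        then show ?thesis using 2 deg_p by (simp add: h_def m coeff_eq_0)
      qed
    qed
    have db: "degree (smult (- \<sigma>) (pCons 0 h)) \<le> d"
    proof (rule order_trans[OF degree_smult_le])
      have "degree (pCons 0 h) \<le> Suc (degree h)" by (simp add: degree_pCons_le)
      then show "degree (pCons 0 h) \<le> d" using dh two_le by linarith
    qed
    show False
    proof (rule not_interior_if_perturbed[OF d f rf _ db _ U])
      show "degree (0 :: real poly) \<le> d" by simp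
      fix \<epsilon> :: real assume e: "\<epsilon> > 0"
      \<comment> \<open>Since \<open>\<epsilon>^2 z^2 = -1\<close> and
        \<open>\<sigma>^2 = 1\<close>, the added term of the denominator times \<open>w\<close> is
        \<open>h(z)\<close>, so that \<open>z\<close> goes to \<open>w\<close>.\<close>
      define z where "z = \<i> * of_real (1 / \<epsilon>)"
      define w where "w = of_real \<sigma> * z"
      have "w = z \<or> w = cnj z" using s by (auto simp: z_def w_def)
      moreover have "Im z \<noteq> 0" using e by (simp add: z_def)
      moreover have "ceval (?p + smult (\<epsilon>\<^sup>2) 0) z
          = w * poly (cpoly (?q + smult (\<epsilon>\<^sup>2) (smult (- \<sigma>) (pCons 0 h)))) z"
      proof -
        have "?p = h + smult \<sigma> (pCons 0 ?q)" by (simp add: h_def)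
        then have "ceval ?p z = ceval (h + smult \<sigma> (pCons 0 ?q)) z" by (rule arg_cong)
        then have P: "ceval ?p z = ceval h z + w * ceval ?q z"
          by (simp add: w_def)
        have "w * (of_real (\<epsilon>\<^sup>2) * (of_real (- \<sigma>) * (z * ceval h z)))
            = - (of_real (\<sigma> * \<sigma>) * (of_real (\<epsilon>\<^sup>2) * (z * z))) * ceval h z"
          by (simp add: w_def)
        also have "of_real (\<epsilon>\<^sup>2) * (z * z) = - 1"
          using e by (simp add: z_def power2_eq_square)
        finally have h: "w * (of_real (\<epsilon>\<^sup>2) * (of_real (- \<sigma>) * (z * ceval h z))) = ceval h z"
          by (simp add: ss)
        have "w * poly (cpoly (?q + smult (\<epsilon>\<^sup>2) (smult (- \<sigma>) (pCons 0 h)))) z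
          = w * ceval ?q z + w * (of_real (\<epsilon>\<^sup>2) * (of_real (- \<sigma>) * (z * ceval h z)))"
          by (simp add: algebra_simps)
        then show ?thesis unfolding h by (simp add: P)
      qed
      ultimately show "\<exists>z w. Im z \<noteq> 0 \<and> (w = z \<or> w = cnj z)
          \<and> ceval (?p + smult (\<epsilon>\<^sup>2) 0) z
            = w * poly (cpoly (?q + smult (\<epsilon>\<^sup>2) (smult (- \<sigma>) (pCons 0 h)))) z"
        by blast
    qed
  qed
qed

text \<open>Julia's inequality for a multiple of the normalized pair, so that it applies directly to
  nearby coefficient vectors.\<close>

lemma fibered_periodicI:
  fixes a b \<kappa> :: real
  assumes d: "d \<ge> 2" and g: "g \<in> rat_deg d" and c: "c \<noteq> 0"
    and p: "p = smult c (numer g)" and q: "q = smult c (denom g)" and def: "definite d (bez p q)"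
    and E: "(a, b) \<noteq> (0, 0)" and F: "form_pair d p q (a, b) = (\<kappa> * a, \<kappa> * b)"
    and K: "\<bar>kernel d p q (a, b) (a, b)\<bar> \<le> \<kappa>\<^sup>2"
  shows "g \<in> fibered_periodic d"
proof -
  have deg: "degree (numer g) \<le> d" "degree (denom g) \<le> d"
    using g by (auto simp: rat_deg_def rat_degree_def)
  interpret definite_pair d p q
    using d deg def by unfold_locales (auto simp: p q intro: order_trans[OF degree_smult_le])
  have "rat_fun g z = \<phi> z" for z
    unfolding \<phi>_def rat_fun_def using c by (simp add: p q)
  then have \<phi>: "rat_fun g = \<phi>" by blast
  have "definite d (bez (numer g) (denom g))"
    using def definite_bez_smult[OF c] by (simp add: p q)
  then have rf: "real_fibered g" using real_fibered_iff_definite(1)[OF g] d by simp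
  moreover have "g \<in> real_periodic d"
    unfolding real_periodic_iff[OF g rf] \<phi> using no_nonreal_periodic[OF E F K] by blast
  ultimately show ?thesis by (simp add: fibered_periodic_def)
qed

lemma continuous_on_hform_num_poly:
  fixes f g :: "'b::topological_space \<Rightarrow> real"
  assumes "continuous_on A v" "continuous_on A f" "continuous_on A g"
  shows "continuous_on A (\<lambda>x. hform d (num_poly d (v x)) (f x, g x))"
    and "continuous_on A (\<lambda>x. hform d (den_poly d (v x)) (f x, g x))"
proof -
  have c: "continuous_on A (\<lambda>x. v x i)" for i
    using continuous_on_product_then_coordinatewise[OF assms(1)] .
  have *: "continuous_on A (\<lambda>x. coeff (num_poly d (v x)) i)" "continuous_on A (\<lambda>x. coeff (den_poly d (v x)) i)" for i
    unfolding coeff_num_poly coeff_den_poly by (cases "i \<le> d"; simp add: c)+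
  show "continuous_on A (\<lambda>x. hform d (num_poly d (v x)) (f x, g x))"
    "continuous_on A (\<lambda>x. hform d (den_poly d (v x)) (f x, g x))"
    unfolding hform_def fst_conv snd_conv of_real_eq_id id_apply
    by (intro continuous_intros assms *)+
qed

lemma continuous_on_kernel_vec:
  fixes f g :: "'b::topological_space \<Rightarrow> real"
  assumes v: "continuous_on A v" and "continuous_on A f" "continuous_on A g"
  shows "continuous_on A (\<lambda>x. kernel d (num_poly d (v x)) (den_poly d (v x)) (f x, g x) (f x, g x))"
proof -
  have *: "continuous_on A (\<lambda>x. bez_vec d (v x) i j)" for i j
    by (rule continuous_on_compose2[OF continuous_on_polynomial_functions[OF bez_vec_polynomial] v]) simp
  show ?thesis
    unfolding kernel_def bilin_def pvec_def fst_conv snd_conv of_real_eq_id id_apply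
    by (intro continuous_intros assms *)
qed

lemma interior_if_attracting:
  fixes a b \<kappa> :: real
  assumes d: "d \<ge> 2" and f: "f \<in> rat_deg d" and rf: "real_fibered f"
    and E: "(a, b) \<noteq> (0, 0)" and F: "form_pair d (numer f) (denom f) (a, b) = (\<kappa> * a, \<kappa> * b)"
    and K: "\<bar>kernel d (numer f) (denom f) (a, b) (a, b)\<bar> < \<kappa>\<^sup>2"
  shows "\<exists>U. openin (rat_topology d) U \<and> f \<in> U \<and> U \<subseteq> fibered_periodic d"
proof -
  interpret f: definite_pair d "numer f" "denom f" by (rule definite_pair_numer_denom[OF d f rf])
  \<comment> \<open>A line through \<open>(a, b)\<close> in the orthogonal direction; its vectors
    represent all real points near the fixed point.\<close>
  define X where "X t = (a + t * b, b - t * a)" for t :: real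
  define v0 where "v0 = coeff_vec d f"
  have v0: "num_poly d v0 = numer f" "den_poly d v0 = denom f"
    unfolding v0_def by (rule num_den_coeff_vec[OF f])+
  \<comment> \<open>The zeros of \<open>\<Phi> v\<close> are the parameters of fixed points.\<close>
  define \<Phi> where "\<Phi> v t = wedge (form_pair d (num_poly d v) (den_poly d v) (X t)) (X t)" for v t
  \<comment> \<open>At a vector with \<open>F X = l X\<close> this is
    \<open>(|K X X| - l^2) |X|^2\<close>. Writing \<open>|F X|^2\<close> for
    \<open>l^2 |X|^2\<close> defines it for all \<open>t\<close>, so that being attracting becomes
    an open condition on \<open>v\<close> and \<open>t\<close>.\<close>
  define \<Psi> where "\<Psi> v t = \<bar>kernel d (num_poly d v) (den_poly d v) (X t) (X t)\<bar> * ((fst (X t))\<^sup>2 + (snd (X t))\<^sup>2)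
      - ((hform d (num_poly d v) (X t))\<^sup>2 + (hform d (den_poly d v) (X t))\<^sup>2)" for v t
  define N where "N = a\<^sup>2 + b\<^sup>2"
  have N: "N > 0" using E by (auto simp: N_def sum_power2_gt_zero_iff)
  have X0: "X 0 = (a, b)" by (simp add: X_def)
  have NX: "(fst (X t))\<^sup>2 + (snd (X t))\<^sup>2 = N * (1 + t\<^sup>2)" for t
    by (simp add: X_def N_def power2_eq_square algebra_simps)
  have Xnz: "X t \<noteq> (0, 0)" for t
  proof
    assume "X t = (0, 0)"
    then have "N * (1 + t\<^sup>2) = 0" using NX[of t] by simp
    then show False using N by (simp add: add_nonneg_eq_0_iff)
  qed
  have k0: "\<kappa> \<noteq> 0" using K by auto
  have \<Psi>0: "\<Psi> v0 0 < 0"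
  proof -
    have "\<Psi> v0 0 = (\<bar>f.K (a, b) (a, b)\<bar> - \<kappa>\<^sup>2) * N"
      using F unfolding \<Psi>_def v0 X0 by (simp add: form_pair_def N_def power_mult_distrib algebra_simps)
    then show ?thesis using K N by (simp add: mult_less_0_iff)
  qed
  have cont\<Psi>: "continuous_on UNIV (\<lambda>x. \<Psi> (fst x) (snd x))"
    unfolding \<Psi>_def X_def fst_conv snd_conv
    by (intro continuous_intros continuous_on_kernel_vec continuous_on_hform_num_poly)
  have cont\<Phi>: "continuous_on UNIV (\<lambda>x. \<Phi> (fst x) (snd x))"
    unfolding \<Phi>_def X_def wedge_def form_pair_def fst_conv snd_conv
    by (intro continuous_intros continuous_on_hform_num_poly)
  have "open {x. \<Psi> (fst x) (snd x) < 0}"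
    by (intro open_Collect_less cont\<Psi> continuous_intros)
  moreover have "(v0, 0) \<in> {x. \<Psi> (fst x) (snd x) < 0}" using \<Psi>0 by simp
  ultimately obtain V1 T where V1: "open V1" "v0 \<in> V1" and T: "open T" "0 \<in> T"
    and VT: "V1 \<times> T \<subseteq> {x. \<Psi> (fst x) (snd x) < 0}"
    by (rule open_prod_elim) auto
  \<comment> \<open>The zero of \<open>\<Phi> v0\<close> at 0 is simple: \<open>c 0\<close> is
    \<open>N * (K - \<kappa>^2) / \<kappa>\<close>, nonzero since the multiplier is less than 1. A
    sign change persists under perturbation.\<close>
  define c where "c t = N * f.K (X t) (a, b) / \<kappa> + wedge (f.F (X t)) (b, - a)" for t
  have \<Phi>c: "\<Phi> v0 t = t * c t" for t
  proof -
    have "wedge (f.F (X t)) (\<kappa> * a, \<kappa> * b) = wedge (X t) (a, b) * f.K (X t) (a, b)"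
      unfolding f.wedge_K F ..
    then have "\<kappa> * wedge (f.F (X t)) (a, b) = t * N * f.K (X t) (a, b)"
      by (simp add: wedge_def X_def N_def power2_eq_square algebra_simps)
    then have "wedge (f.F (X t)) (a, b) = t * (N * f.K (X t) (a, b) / \<kappa>)"
      using k0 by (simp add: field_simps)
    moreover have "\<Phi> v0 t = wedge (f.F (X t)) (a, b) + t * wedge (f.F (X t)) (b, - a)"
      unfolding \<Phi>_def v0 by (simp add: X_def wedge_def algebra_simps)
    ultimately show ?thesis by (simp add: c_def algebra_simps)
  qed
  have c0: "c 0 \<noteq> 0"
  proof -
    have "c 0 = N * (f.K (a, b) (a, b) - \<kappa>\<^sup>2) / \<kappa>"
      using k0 unfolding c_def X0 F by (simp add: wedge_def N_def power2_eq_square field_simps)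
    moreover have "f.K (a, b) (a, b) - \<kappa>\<^sup>2 < 0" using K by linarith
    ultimately show ?thesis using N k0 by simp
  qed
  have "continuous_on UNIV c"
    unfolding c_def X_def wedge_def form_pair_def fst_conv snd_conv by (intro continuous_intros) (use k0 in auto)
  then have "open {t. c t * c 0 > 0}" by (intro open_Collect_less continuous_intros)
  then have "open (T \<inter> {t. c t * c 0 > 0})" using T(1) by (rule open_Int[rotated])
  moreover have "0 \<in> T \<inter> {t. c t * c 0 > 0}" using T(2) c0 by (auto simp: zero_less_mult_iff linorder_neq_iff)
  ultimately obtain e where e: "e > 0" "ball 0 e \<subseteq> T \<inter> {t. c t * c 0 > 0}"
    unfolding open_contains_ball by blast
  define \<delta> where "\<delta> = e / 2"
  have \<delta>: "\<delta> > 0" using e(1) by (simp add: \<delta>_def)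
  have small: "t \<in> T \<and> c t * c 0 > 0" if "\<bar>t\<bar> \<le> \<delta>" for t
  proof -
    have "t \<in> ball 0 e" using that e(1) by (simp add: \<delta>_def)
    then show ?thesis using e(2) by blast
  qed
  \<comment> \<open>Nearby vectors for which \<open>\<Phi> v\<close> still has opposite signs at
    \<open>\<delta>\<close> and \<open>- \<delta>\<close>.\<close>
  define V where "V = V1 \<inter> {v. definite d (bez_vec d v)} \<inter> {v. \<Phi> v \<delta> * c 0 > 0} \<inter> {v. \<Phi> v (- \<delta>) * c 0 < 0}"
  have "continuous_on UNIV (\<lambda>v. \<Phi> v t)" for t
    by (rule continuous_on_compose2[OF cont\<Phi>, of _ "\<lambda>v. (v, t)", simplified]) (intro continuous_intros)
  then have "open V" unfolding V_def
    by (intro open_Int V1(1) open_definite_bez_vec open_Collect_less continuous_intros)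
  have v0V: "v0 \<in> V"
  proof -
    have "\<Phi> v0 \<delta> * c 0 = \<delta> * (c \<delta> * c 0)" "\<Phi> v0 (- \<delta>) * c 0 = - (\<delta> * (c (- \<delta>) * c 0))"
      unfolding \<Phi>c by simp_all
    moreover have "\<delta> * (c \<delta> * c 0) > 0" "\<delta> * (c (- \<delta>) * c 0) > 0"
      using small[of \<delta>] small[of "- \<delta>"] \<delta> by simp_all
    ultimately have "\<Phi> v0 \<delta> * c 0 > 0" "\<Phi> v0 (- \<delta>) * c 0 < 0" by linarith+
    then show ?thesis using V1(2) f.definite_bez by (simp add: V_def v0)
  qed
  have sub: "g \<in> fibered_periodic d" if g: "g \<in> rat_deg d" and k: "k \<noteq> 0" and kv: "(\<lambda>i. k * coeff_vec d g i) \<in> V"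
    for g k
  proof -
    define v where "v = (\<lambda>i. k * coeff_vec d g i)"
    have v: "v \<in> V1" "definite d (bez_vec d v)" "\<Phi> v \<delta> * c 0 > 0" "\<Phi> v (- \<delta>) * c 0 < 0"
      using kv by (auto simp: V_def v_def)
    have pq: "num_poly d v = smult k (numer g)" "den_poly d v = smult k (denom g)"
      by (simp_all add: v_def num_poly_scale den_poly_scale num_den_coeff_vec[OF g])
    have "continuous_on UNIV (\<lambda>t. \<Phi> v t * c 0)"
      by (intro continuous_intros
          continuous_on_compose2[OF cont\<Phi>, of _ "\<lambda>t. (v, t)", simplified])
    then have "continuous_on {- \<delta>..\<delta>} (\<lambda>t. \<Phi> v t * c 0)" by (rule continuous_on_subset) simp
    then obtain t where t: "- \<delta> \<le> t" "t \<le> \<delta>" "\<Phi> v t * c 0 = 0"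
      using IVT'[of "\<lambda>t. \<Phi> v t * c 0" "- \<delta>" 0 \<delta>] v(3,4) \<delta> by auto
    then have \<Phi>t: "\<Phi> v t = 0" using c0 by simp
    have "\<bar>t\<bar> \<le> \<delta>" using t by linarith
    then have "t \<in> T" using small by blast
    then have "(v, t) \<in> {x. \<Psi> (fst x) (snd x) < 0}" using VT v(1) by blast
    then have \<Psi>t: "\<Psi> v t < 0" by simp
    obtain x y where xy: "X t = (x, y)" by (cases "X t")
    have xy0: "(x, y) \<noteq> (0, 0)" using Xnz[of t] xy by simp
    obtain l where l: "hform d (num_poly d v) (x, y) = l * x" "hform d (den_poly d v) (x, y) = l * y"
      using \<Phi>t unfolding \<Phi>_def xy form_pair_def by (rule wedge_eq_0_cases[OF _ xy0])
    have "(\<bar>kernel d (num_poly d v) (den_poly d v) (x, y) (x, y)\<bar> - l\<^sup>2) * (x\<^sup>2 + y\<^sup>2) < 0"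
      using \<Psi>t unfolding \<Psi>_def xy l by (simp add: power_mult_distrib algebra_simps)
    moreover have "x\<^sup>2 + y\<^sup>2 > 0" using xy0 by (auto simp: sum_power2_gt_zero_iff)
    ultimately have "\<bar>kernel d (num_poly d v) (den_poly d v) (x, y) (x, y)\<bar> \<le> l\<^sup>2"
      by (simp add: mult_less_0_iff)
    moreover have "form_pair d (num_poly d v) (den_poly d v) (x, y) = (l * x, l * y)"
      by (simp add: form_pair_def l)
    ultimately show ?thesis
      using fibered_periodicI[OF d g k pq v(2) xy0] by blast
  qed
  define U where "U = {g \<in> rat_deg d. \<exists>k. k \<noteq> 0 \<and> (\<lambda>i. k * coeff_vec d g i) \<in> V}"
  have "openin (rat_topology d) U" unfolding U_def by (rule openin_rat_topologyI[OF \<open>open V\<close>])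
  moreover have "f \<in> U" using v0V f unfolding U_def v0_def by (auto intro!: exI[of _ "1::real"])
  moreover have "U \<subseteq> fibered_periodic d" unfolding U_def using sub by blast
  ultimately show ?thesis by blast
qed

lemma frontier_fibered_periodic:
  assumes d: "d \<ge> 2"
  shows "rat_topology d frontier_of fibered_periodic d
    = {f \<in> rat_deg d. real_fibered f \<and> has_indifferent_fixed_point f}"
proof -
  \<comment> \<open>The set is closed, so its frontier is the set without its interior.\<close>
  have fr: "rat_topology d frontier_of fibered_periodic d
    = {f \<in> fibered_periodic d. \<not> (\<exists>U. openin (rat_topology d) U \<and> f \<in> U \<and> U \<subseteq> fibered_periodic d)}"
    unfolding frontier_of_def closure_of_closedin[OF closedin_fibered_periodic[OF d]]
    by (auto simp: interior_of_def)
  show ?thesis unfolding fr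
  proof (intro equalityI subsetI; clarify)
    fix f assume A: "f \<in> fibered_periodic d"
      and ni: "\<not> (\<exists>U. openin (rat_topology d) U \<and> f \<in> U \<and> U \<subseteq> fibered_periodic d)"
    have f: "f \<in> rat_deg d" using A fibered_periodic_subset by blast
    have rf: "real_fibered f" using A by (simp add: fibered_periodic_def)
    interpret definite_pair d "numer f" "denom f" by (rule definite_pair_numer_denom[OF d f rf])
    have \<phi>: "rat_fun f = \<phi>" by (simp add: fun_eq_iff rat_fun_def \<phi>_def)
    have "Im z = 0" if "ceval R z = 0" for z
      using that fixpoly_root_iff fibered_periodic_second_iterate[OF A] unfolding \<phi> by blast
    then obtain a b \<kappa> :: real where E: "(a, b) \<noteq> (0, 0)" "F (a, b) = (\<kappa> * a, \<kappa> * b)"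
      and K: "\<bar>K (a, b) (a, b)\<bar> \<le> \<kappa>\<^sup>2"
      using exists_nonexpanding_fixed_point by blast
    have "\<not> \<bar>K (a, b) (a, b)\<bar> < \<kappa>\<^sup>2"
      using interior_if_attracting[OF d f rf E] ni by blast
    then have "\<bar>K (a, b) (a, b)\<bar> = \<kappa>\<^sup>2" using K by simp
    then show "f \<in> rat_deg d \<and> real_fibered f \<and> has_indifferent_fixed_point f"
      using has_indifferent_fixed_point_iff[OF d f rf] f rf E by blast
  next
    fix f assume f: "f \<in> rat_deg d" and rf: "real_fibered f" and ind: "has_indifferent_fixed_point f"
    interpret definite_pair d "numer f" "denom f" by (rule definite_pair_numer_denom[OF d f rf])
    obtain a b \<kappa> :: real where E: "(a, b) \<noteq> (0, 0)" "F (a, b) = (\<kappa> * a, \<kappa> * b)"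
      and K: "\<bar>K (a, b) (a, b)\<bar> = \<kappa>\<^sup>2"
      using has_indifferent_fixed_point_iff[OF d f rf] ind by blast
    have "f \<in> fibered_periodic d"
      by (rule fibered_periodicI[OF d f, of 1, OF _ _ _ definite_bez E]) (simp_all add: K)
    then show "f \<in> fibered_periodic d
      \<and> \<not> (\<exists>U. openin (rat_topology d) U \<and> f \<in> U \<and> U \<subseteq> fibered_periodic d)"
      using not_interior_if_indifferent[OF d f rf E K] by blast
  qed
qed

theorem theorem3:
  fixes d :: nat
  assumes "d \<ge> 2"
  shows "(\<forall>f \<in> rat_deg d. real_fibered f \<longrightarrow>
            (f \<in> real_periodic d \<longleftrightarrow> only_real_fixed_points (rat_map f \<circ> rat_map f)))
       \<and> closedin (rat_topology d) {f \<in> real_periodic d. real_fibered f}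
       \<and> semialgebraic_rat d {f \<in> real_periodic d. real_fibered f}
       \<and> rat_topology d frontier_of {f \<in> real_periodic d. real_fibered f}
           = {f \<in> rat_deg d. real_fibered f \<and> has_indifferent_fixed_point f}"
  using real_periodic_iff_second_iterate[OF assms] closedin_fibered_periodic[OF assms]
    semialgebraic_fibered_periodic[OF assms] frontier_fibered_periodic[OF assms]
  unfolding fibered_periodic_def by blast

end
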